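(* (a) Let $\alpha=\frac23+\sum_{k=1}^\infty 4^{-2^k}$. Then the star-discrepancy $D_N^*$ of $(\{n\alpha\})_{n\ge1}$ satisfies $N D_N^*=\mathcal{O}(\log N)$, whereas the star-discrepancy $\widetilde D_N^*$ of $(\{n_k\alpha\})_{k\ge1}$ satisfies, for every $\varepsilon>0$, $N\widetilde D_N^*=\mathcal{O}\left(N^{\frac{\log 3}{\log 4}+\varepsilon}\right)$ and $N\widetilde D_N^*=\Omega\left(N^{\frac{\log 3}{\log 4}-\varepsilon}\right)$. (b) Let $\gamma=\sum_{n\ge0}(1-t_n)2^{-(n+1)}$, i.e. $\gamma=0.1001011001101001\ldots$ in base 2. Then the star-discrepancy $D_N^*$ of $(\{n\gamma\})_{n\ge1}$ satisfies $N D_N^*=\mathcal{O}(N^\varepsilon)$ for every $\varepsilon>0$, whereas the star-discrepancy $\widetilde D_N^*$ of $(\{n_k\gamma\})_{k\ge1}$ satisfies $N\widetilde D_N^*=\Omega\left(N^{0.6178775}\right)$.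
   Context: $(t_n)_{n\ge0}=(0,1,1,0,1,0,0,1,\dots)$ is the Thue--Morse sequence: $t_n$ is the parity of the binary digit sum of $n$. $(n_k)_{k\ge1}$ denotes the Thue--Morse integers, i.e. the non-negative integers $n$ with $t_n=0$, in increasing order. $\{x\}$ is the fractional part. The star-discrepancy of the first $N$ terms $x_1,\dots,x_N\in[0,1]$ is $\sup_{a\in[0,1]}\left|\frac1N\#\{n\le N:x_n\in[0,a]\}-a\right|$. For positive $g$, $F(N)=\Omega(g(N))$ means there is $c>0$ with $F(N)\ge c\,g(N)$ for infinitely many $N$. *)

theory Defs
  imports Complex_Main "HOL-Library.Infinite_Set" "HOL-Library.Landau_Symbols"
begin

definition thue_morse :: "nat \<Rightarrow> nat" where
  "thue_morse n = card {i. bit n i} mod 2"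

(* The integers are indexed from 1 (so the first one is 0), whereas enumerate counts from 0;
   the value at index 0 is irrelevant. *)
definition thue_morse_integer :: "nat \<Rightarrow> nat" where
  "thue_morse_integer k = enumerate {n. thue_morse n = 0} (k - 1)"

definition star_discrepancy :: "(nat \<Rightarrow> real) \<Rightarrow> nat \<Rightarrow> real" where
  "star_discrepancy x N =
     (SUP a\<in>{0..1}. \<bar>real (card {n \<in> {1..N}. x n \<in> {0..a}}) / real N - a\<bar>)"

(* Unlike the Omega of HOL-Library.Landau_Symbols, the lower bound is only required for
   infinitely many N. *)
definition infinitely_often_Omega :: "(nat \<Rightarrow> real) \<Rightarrow> (nat \<Rightarrow> real) \<Rightarrow> bool" where
  "infinitely_often_Omega F g \<longleftrightarrow> (\<exists>c>0. \<exists>\<^sub>\<infinity>N. F N \<ge> c * g N)"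

definition alpha :: real where
  "alpha = 2 / 3 + (\<Sum>k. 1 / 4 ^ (2 ^ Suc k))"

definition gamma :: real where
  "gamma = (\<Sum>n. (1 - real (thue_morse n)) / 2 ^ (n + 1))"

end

theory Submission
  imports Defs "HOL-Analysis.Analysis" "HOL-Library.Z2"
    "HOL-Computational_Algebra.Polynomial_FPS" "HOL-Real_Asymp.Real_Asymp"
begin

text \<open>
  Star discrepancies of Thue--Morse subsequences are compared with the exponential sums
  \<open>\<Sum>n<M. (-1)^t\<^sub>n e(n x)\<close>, which for \<open>M = 2^L\<close> factor as \<open>\<Prod>i<L. 1 - e(2^i x)\<close>.

  Kronecker sequences: if \<open>\<bar>q \<theta> - p\<bar> \<ge> c q^(-1-\<delta>)\<close> throughout, Dirichlet's theorem supplies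
  denominators close to \<open>N\<close>, blocks of that length have bounded discrepancy, and the error is
  \<open>O(N^\<delta> log N)\<close>. For \<open>\<alpha>\<close> this holds with \<open>\<delta> = 0\<close> because \<open>\<Sum>k. 4^(-2^k)\<close> has a folded continued fraction
  with entries \<open>\<plusminus>16, \<plusminus>1\<close>. For \<open>\<gamma>\<close> it holds with every \<open>\<delta> > 0\<close>: over the field with two elements the
  generating series of \<open>t\<^sub>n\<close> is quadratic, so Liouville's argument bounds the order of every Pade remainder,
  and the functional equation \<open>T(z) = (1 - z) T(z^2)\<close> turns Pade approximants into rational
  approximations at all scales.

  Upper bound for \<open>\<alpha>\<close>: \<open>\<bar>sin y\<bar>^2 \<bar>sin 2y\<bar> \<le> (sqrt 3 / 2)^3\<close> bounds every exponential sum by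
  \<open>O(M^(log 3 / log 4))\<close>, and a finite Fourier expansion of intervals costs one further logarithm.

  Lower bounds: Koksma's inequality reduces them to the products. For \<open>\<alpha>\<close> almost all \<open>2^i \<alpha>\<close> are near
  \<open>1/3\<close> or \<open>2/3\<close> modulo 1, where the factor is \<open>sqrt 3\<close>. For \<open>\<gamma>\<close> the frequency 21 is used, and
  the factors are estimated on blocks of 16 binary digits.
\<close>

text \<open>Exactly one of 2n and 2n+1 is a Thue-Morse integer, so the first N of them are those
  below 2N, with indicator (1 + (-1)^t_n) / 2. Half of every count is an ordinary Kronecker count;
  what distinguishes the subsequence lies in the signed half. The exponent log 3 / log 4 is the
  base-2 logarithm of sqrt 3, the size of a factor at 1/3 and at 2/3. Doubling modulo 1 exchanges
  these points, so an orbit staying near them almost attains the general upper bound. The number 2/3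
  + beta has such an orbit: the sparse digits of beta disturb it only near powers of two, every
  range of i between consecutive powers of two costs a bounded factor, and the total loss is a power
  of log N. Hence the epsilon in the lower bound. For gamma the pigeonhole principle gives Pade
  remainders of order at least 2d+1, but does not exclude a much higher order. A rational number
  proportional to such an approximant would then be approximated too well, and no integer
  determinant could detect it; the zero estimate closes this gap. Koksma's inequality holds at each
  fixed frequency h at the cost of a factor h, so h may be chosen to make the product large.\<close>

unbundle no vec_syntax
unbundle fps_syntax

section \<open>Discrepancy of Kronecker sequences\<close>

text \<open>The starting phase \<open>s\<close> is arbitrary because splitting off a block of N
  terms moves the start of the rest by N theta; the estimates have to be uniform in it.\<close>

definition rotation_dev :: "real \<Rightarrow> real \<Rightarrow> nat \<Rightarrow> real \<Rightarrow> real" where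
  "rotation_dev \<theta> s N a = \<bar>real (card {n \<in> {..<N}. frac (s + real n * \<theta>) \<le> a}) - real N * a\<bar>"

lemma bij_betw_mult_add_mod:
  fixes p s :: int and q :: nat
  assumes "q > 0" "coprime p (int q)"
  shows "bij_betw (\<lambda>n. nat ((int n * p + s) mod int q)) {..<q} {..<q}"
proof -
  have "inj_on (\<lambda>n. nat ((int n * p + s) mod int q)) {..<q}"
  proof (rule inj_onI)
    fix x y assume xy: "x \<in> {..<q}" "y \<in> {..<q}"
      and eq: "nat ((int x * p + s) mod int q) = nat ((int y * p + s) mod int q)"
    have "(int x * p + s) mod int q = (int y * p + s) mod int q"
      using eq assms(1) by (simp add: nat_eq_iff)
    then have "int q dvd (int x * p + s) - (int y * p + s)"
      by (simp add: mod_eq_dvd_iff)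
    then have "int q dvd (int x - int y) * p" by (simp add: algebra_simps)
    then have "int q dvd int x - int y"
      using assms(2) by (simp add: coprime_commute coprime_dvd_mult_left_iff)
    moreover have "\<bar>int x - int y\<bar> < int q" using xy by auto
    ultimately show "x = y" using zdvd_imp_le[of "int q" "\<bar>int x - int y\<bar>"] by force
  qed
  moreover have "(\<lambda>n. nat ((int n * p + s) mod int q)) ` {..<q} \<subseteq> {..<q}"
    using assms(1) by (auto simp: nat_less_iff)
  ultimately show ?thesis
    by (simp add: bij_betw_def endo_inj_surj)
qed

lemma card_bij_preimage:
  assumes "bij_betw m A A"
  shows "card {n \<in> A. m n \<in> B} = card (B \<inter> A)"
proof -
  have "bij_betw m {n \<in> A. m n \<in> B} (B \<inter> A)"
    using assms by (auto simp: bij_betw_def inj_on_def image_iff)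
  then show ?thesis by (rule bij_betw_same_card)
qed

lemma frac_eqI: "x - of_int k = y \<Longrightarrow> 0 \<le> y \<Longrightarrow> y < 1 \<Longrightarrow> frac x = y" for x y :: real
  by (metis frac_unique_iff Ints_of_int add.commute diff_add_cancel diff_diff_eq2 add_diff_cancel_left')

lemma abs_divide_diff: "N > 0 \<Longrightarrow> \<bar>x / N - a\<bar> = \<bar>x - N * a\<bar> / N" for x a N :: real
proof -
  assume "N > 0"
  then have "x / N - a = (x - N * a) / N" by (simp add: field_simps)
  then show ?thesis using \<open>N > 0\<close> by simp
qed

text \<open>Modulo 1 the first q points lie close to the grid points m/q, and n -> n p + s0 permutes
  the residues. The count therefore agrees with that of the full grid up to boundary
  effects.\<close>

lemma rotation_dev_block:
  fixes p :: int and q :: nat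
  assumes q: "q > 0" "coprime p (int q)" and ap: "\<bar>\<theta> - p / q\<bar> \<le> 1 / (real q)^2"
    and a: "a \<in> {0..1}"
  shows "rotation_dev \<theta> s q a \<le> 3"
proof -
  define s0 where "s0 = \<lfloor>real q * s\<rfloor>"
  define m where "m = (\<lambda>n::nat. nat ((int n * p + s0) mod int q))"
  define w where "w = (\<lambda>n::nat. (int n * p + s0) div int q)"
  define y where "y = (\<lambda>n::nat. s + real n * \<theta> - of_int (w n))"
  have bij: "bij_betw m {..<q} {..<q}"
    unfolding m_def by (rule bij_betw_mult_add_mod) fact+
  have mq: "m n < q" for n using q by (simp add: m_def nat_less_iff)
  \<comment> \<open>Replacing theta by p/q moves q times the point by less than 1 in either
    direction; rounding q s down to \<open>s0\<close> adds up to 1 more on the right.\<close>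
  have yb: "real (m n) - 1 < real q * y n \<and> real q * y n < real (m n) + 2" if "n < q" for n
  proof -
    have "int n * p + s0 = int q * w n + int (m n)"
      using q by (simp add: m_def w_def)
    then have e: "real n * of_int p + of_int s0 = real q * of_int (w n) + real (m n)"
      by (metis of_int_add of_int_mult of_int_of_nat_eq)
    have "\<bar>real n * (real q * (\<theta> - p / q))\<bar> = real n * real q * \<bar>\<theta> - p / q\<bar>"
      by (simp add: abs_mult)
    also have "\<dots> \<le> real n * real q * (1 / (real q)^2)"
      using ap by (intro mult_left_mono) auto
    also have "\<dots> = real n / real q" using q by (simp add: power2_eq_square)
    also have "\<dots> < 1" using that q by simp
    finally have "\<bar>real n * (real q * (\<theta> - p / q))\<bar> < 1" .
    moreover have "real n * (real q * (\<theta> - p / q)) = real n * (real q * \<theta>) - real n * p"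
      using q by (simp add: field_simps)
    ultimately have "\<bar>real n * (real q * \<theta>) - real n * p\<bar> < 1" by simp
    moreover have "of_int s0 \<le> real q * s" "real q * s < of_int s0 + 1"
      unfolding s0_def by linarith+
    moreover have "real q * y n = real q * s + real n * (real q * \<theta>) - real q * of_int (w n)"
      by (simp add: y_def algebra_simps)
    ultimately show ?thesis using e unfolding abs_less_iff by linarith
  qed
  have fr: "frac (s + real n * \<theta>) = y n" if "0 \<le> y n" "y n < 1" for n
    by (rule frac_eqI[where k = "w n"]) (use that in \<open>auto simp: y_def\<close>)
  define T where "T = {n \<in> {..<q}. frac (s + real n * \<theta>) \<le> a}"
  \<comment> \<open>Residue 0 is left out because \<open>y n\<close> may be negative there and wrap
    around to the top of the unit interval.\<close>
  have "{n \<in> {..<q}. m n \<in> {1..<nat \<lfloor>real q * a\<rfloor> - 1}} \<subseteq> T"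
  proof (safe)
    fix n assume n: "n < q" "m n \<in> {1..<nat \<lfloor>real q * a\<rfloor> - 1}"
    then have 1: "1 \<le> m n" "real (m n) + 2 \<le> real q * a" by (auto; linarith)+
    have "real q * y n > 0" using yb[OF n(1)] 1 by simp
    then have y0: "y n > 0" using q by (simp add: zero_less_mult_iff)
    have "real q * y n < real q * a" using yb[OF n(1)] 1 by simp
    then have y1: "y n < a" using q by simp
    show "n \<in> T" using fr[of n] y0 y1 a n by (simp add: T_def)
  qed
  then have "card {n \<in> {..<q}. m n \<in> {1..<nat \<lfloor>real q * a\<rfloor> - 1}} \<le> card T"
    by (intro card_mono) (auto simp: T_def)
  moreover have "{1..<nat \<lfloor>real q * a\<rfloor> - 1} \<inter> {..<q} = {1..<nat \<lfloor>real q * a\<rfloor> - 1}"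
  proof -
    have "real q * a \<le> real q" using a by (simp add: mult_left_le)
    then show ?thesis by (auto; linarith)
  qed
  ultimately have "nat \<lfloor>real q * a\<rfloor> - 2 \<le> card T"
    using card_bij_preimage[OF bij, of "{1..<nat \<lfloor>real q * a\<rfloor> - 1}"] by simp
  then have lo: "real q * a - 3 \<le> real (card T)" by linarith
  \<comment> \<open>Residue q - 1 is the only one for which \<open>y n\<close> can reach 1 and wrap
    around to a small fractional part.\<close>
  have "T \<subseteq> {n \<in> {..<q}. m n \<in> {..<nat \<lceil>real q * a + 1\<rceil>} \<union> {q - 1}}"
  proof
    fix n assume n: "n \<in> T"
    then have nq: "n < q" by (simp add: T_def)
    show "n \<in> {n \<in> {..<q}. m n \<in> {..<nat \<lceil>real q * a + 1\<rceil>} \<union> {q - 1}}"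
    proof (rule ccontr)
      assume "\<not> ?thesis"
      then have c: "m n \<ge> nat \<lceil>real q * a + 1\<rceil>" "m n \<noteq> q - 1" using nq by auto
      have aq: "real q * a \<ge> 0" using a by simp
      have 1: "real (m n) \<ge> real q * a + 1" using c by linarith
      then have "real q * y n > real q * a" using yb[OF nq] by simp
      then have y0: "y n > a" using q by simp
      have "m n + 2 \<le> q" using c mq[of n] by linarith
      then have "real (m n) + 2 \<le> real q" by linarith
      then have "real q * y n < real q" using yb[OF nq] by linarith
      then have "y n < 1" using q by simp
      then show False using fr[of n] y0 a n by (simp add: T_def)
    qed
  qed
  then have "card T \<le> card {n \<in> {..<q}. m n \<in> {..<nat \<lceil>real q * a + 1\<rceil>} \<union> {q - 1}}"
    by (intro card_mono) auto
  also have "\<dots> = card (({..<nat \<lceil>real q * a + 1\<rceil>} \<union> {q - 1}) \<inter> {..<q})"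
    by (rule card_bij_preimage[OF bij])
  also have "\<dots> \<le> card ({..<nat \<lceil>real q * a + 1\<rceil>} \<union> {q - 1})"
    by (intro card_mono) auto
  also have "\<dots> \<le> card {..<nat \<lceil>real q * a + 1\<rceil>} + card {q - 1}"
    by (rule card_Un_le)
  also have "\<dots> = nat \<lceil>real q * a + 1\<rceil> + 1" by simp
  finally have "real (card T) \<le> real q * a + 3" using a
    by (smt (verit) of_nat_1 of_nat_add of_nat_le_iff of_nat_nat of_int_nonneg ceiling_correct atLeastAtMost_iff mult_nonneg_nonneg of_nat_0_le_iff zero_le_ceiling)
  then show ?thesis using lo unfolding rotation_dev_def T_def by linarith
qed

lemma rotation_dev_add: "rotation_dev \<theta> s (N + M) a \<le> rotation_dev \<theta> s N a + rotation_dev \<theta> (s + real N * \<theta>) M a"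
proof -
  let ?A = "{n \<in> {..<N}. frac (s + real n * \<theta>) \<le> a}"
  let ?B = "{n \<in> {..<M}. frac (s + real N * \<theta> + real n * \<theta>) \<le> a}"
  have "{n \<in> {..<N + M}. frac (s + real n * \<theta>) \<le> a} = ?A \<union> (\<lambda>n. N + n) ` ?B"
  proof (intro equalityI subsetI)
    fix n assume n: "n \<in> {n \<in> {..<N + M}. frac (s + real n * \<theta>) \<le> a}"
    show "n \<in> ?A \<union> (\<lambda>n. N + n) ` ?B"
    proof (cases "n < N")
      case False
      then have "n = N + (n - N)" by simp
      moreover have "n - N \<in> ?B"
        using n False by (auto simp: of_nat_diff algebra_simps)
      ultimately show ?thesis by blast
    qed (use n in auto)
  qed (auto simp: algebra_simps)
  moreover have "card (?A \<union> (\<lambda>n. N + n) ` ?B) = card ?A + card ((\<lambda>n. N + n) ` ?B)"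
    by (rule card_Un_disjoint) auto
  moreover have "card ((\<lambda>n. N + n) ` ?B) = card ?B" by (intro card_image) simp
  ultimately have "card {n \<in> {..<N + M}. frac (s + real n * \<theta>) \<le> a} = card ?A + card ?B"
    by simp
  then show ?thesis unfolding rotation_dev_def by (simp add: algebra_simps)
qed

lemma rotation_dev_blocks:
  fixes p :: int and q :: nat
  assumes q: "q > 0" "coprime p (int q)" and ap: "\<bar>\<theta> - p / q\<bar> \<le> 1 / (real q)^2"
    and a: "a \<in> {0..1}"
  shows "rotation_dev \<theta> s (b * q) a \<le> 3 * real b"
proof (induction b arbitrary: s)
  case (Suc b)
  have "rotation_dev \<theta> s (Suc b * q) a \<le> rotation_dev \<theta> s q a + rotation_dev \<theta> (s + real q * \<theta>) (b * q) a"
    using rotation_dev_add[of \<theta> s q "b * q" a] by simp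
  also have "\<dots> \<le> 3 + 3 * real b"
    using rotation_dev_block[OF q ap a] Suc by (meson add_mono)
  finally show ?case by simp
qed (simp add: rotation_dev_def)

text \<open>The Diophantine lower bound forces the Dirichlet denominator q to satisfy q^(1+delta) >=
  c N, so there are at most N^delta / c full blocks. The remainder is smaller than q, hence at most
  N/2, and strong induction adds one such term per halving: 1 + log2 r = log2 (2 r) <= log2
  N.\<close>

lemma rotation_dev_diophantine:
  fixes \<theta> \<delta> c :: real
  assumes c: "c > 0" and \<delta>: "\<delta> \<ge> 0"
    and lb: "\<And>(q::nat) (p::int). q \<ge> 1 \<Longrightarrow> \<bar>real q * \<theta> - p\<bar> \<ge> c / real q powr (1 + \<delta>)"
    and a: "a \<in> {0..1}"
  shows "N \<ge> 1 \<Longrightarrow> rotation_dev \<theta> s N a \<le> 3 / c * real N powr \<delta> * (1 + log 2 (real N))"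
proof (induction N arbitrary: s rule: less_induct)
  case (less N)
  obtain h k where hk: "coprime h k" "0 < k" "k \<le> int N" "\<bar>of_int k * \<theta> - of_int h\<bar> < 1/N"
    using Dirichlet_approx_coprime[of N \<theta>] less.prems by auto
  define q where "q = nat k"
  have q: "q > 0" "q \<le> N" "coprime h (int q)" "k = int q" using hk by (auto simp: q_def)
  have ap: "\<bar>\<theta> - h / q\<bar> \<le> 1 / (real q)^2"
  proof -
    have "\<bar>\<theta> - h / q\<bar> = \<bar>real q * \<theta> - h\<bar> / real q"
      using q abs_divide_diff[of "real q" h \<theta>] by (simp add: abs_minus_commute)
    also have "\<dots> \<le> (1 / N) / real q"
      using hk q by (intro divide_right_mono) auto
    also have "\<dots> \<le> (1 / q) / real q"
      using q by (intro divide_right_mono) (auto simp: field_simps)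
    finally show ?thesis by (simp add: power2_eq_square)
  qed
  define b r where "b = N div q" and "r = N mod q"
  have N: "N = b * q + r" by (simp add: b_def r_def)
  have "b \<ge> 1" using q by (simp add: b_def div_greater_zero_iff Suc_leI)
  then have "q \<le> b * q" by simp
  moreover have rq: "r < q" using q by (simp add: r_def)
  ultimately have r: "2 * r \<le> N" using N by linarith
  have Npos: "real N > 0" using less.prems by simp
  have "c / real q powr (1 + \<delta>) \<le> 1 / N"
    using lb[of q h] hk q by fastforce
  then have "c * real N \<le> real q powr (1 + \<delta>)"
    using q Npos by (simp add: field_simps)
  also have "\<dots> = real q * real q powr \<delta>" using q by (simp add: powr_add)
  also have "\<dots> \<le> real q * real N powr \<delta>"
    using q \<delta> by (intro mult_left_mono powr_mono2) auto
  finally have "real N / real q \<le> real N powr \<delta> / c"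
    using c q by (simp add: field_simps)
  moreover have "real b \<le> real N / real q"
    unfolding b_def by (rule of_nat_div_le_of_nat)
  ultimately have b: "3 * real b \<le> 3 / c * real N powr \<delta>" by simp
  have "rotation_dev \<theta> s N a \<le> rotation_dev \<theta> s (b * q) a + rotation_dev \<theta> (s + real (b * q) * \<theta>) r a"
    unfolding N by (rule rotation_dev_add)
  also have "rotation_dev \<theta> s (b * q) a \<le> 3 / c * real N powr \<delta>"
    using rotation_dev_blocks[OF q(1,3) ap a] b by (meson order_trans)
  also have "rotation_dev \<theta> (s + real (b * q) * \<theta>) r a \<le> 3 / c * real N powr \<delta> * log 2 N"
  proof (cases "r = 0")
    case True
    then show ?thesis using c less.prems by (simp add: rotation_dev_def)
  next
    case False
    then have r1: "r \<ge> 1" by simp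
    have "r < N" using r False by linarith
    then have "rotation_dev \<theta> (s + real (b * q) * \<theta>) r a \<le> 3 / c * real r powr \<delta> * (1 + log 2 r)"
      using less.IH r1 by blast
    also have "\<dots> = 3 / c * real r powr \<delta> * log 2 (2 * r)" using r1 by (simp add: log_mult)
    also have "\<dots> \<le> 3 / c * real N powr \<delta> * log 2 N"
    proof (intro mult_mono)
      show "real r powr \<delta> \<le> real N powr \<delta>" using \<open>r < N\<close> \<delta> by (intro powr_mono2) auto
      show "log 2 (real (2 * r)) \<le> log 2 N" using r r1 by (intro log_mono) auto
    qed (use c r1 in auto)
    finally show ?thesis .
  qed
  finally show ?case by (simp only: distrib_left mult_1_right)
qed

section \<open>Star discrepancy as a supremum of counting errors\<close>

lemma star_discrepancy_le:
  assumes "\<And>a. a \<in> {0..1} \<Longrightarrow> \<bar>real (card {n \<in> {1..N}. x n \<in> {0..a}}) - real N * a\<bar> \<le> B"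
  shows "real N * star_discrepancy x N \<le> B"
proof (cases "N = 0")
  case True
  then show ?thesis using assms[of 0] by simp
next
  case False
  have "star_discrepancy x N \<le> B / real N"
    unfolding star_discrepancy_def
  proof (rule cSUP_least)
    fix a :: real assume a: "a \<in> {0..1}"
    have "\<bar>real (card {n \<in> {1..N}. x n \<in> {0..a}}) / real N - a\<bar>
       = \<bar>real (card {n \<in> {1..N}. x n \<in> {0..a}}) - real N * a\<bar> / real N"
      using False by (simp add: abs_divide_diff)
    also have "\<dots> \<le> B / real N" using assms[OF a] by (simp add: divide_right_mono)
    finally show "\<bar>real (card {n \<in> {1..N}. x n \<in> {0..a}}) / real N - a\<bar> \<le> B / real N" .
  qed auto
  then show ?thesis using False by (simp add: field_simps)
qed

lemma star_discrepancy_ge: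
  assumes a: "a \<in> {0..1}"
  shows "\<bar>real (card {n \<in> {1..N}. x n \<in> {0..a}}) - real N * a\<bar> \<le> real N * star_discrepancy x N"
proof (cases "N = 0")
  case False
  have "bdd_above ((\<lambda>a. \<bar>real (card {n \<in> {1..N}. x n \<in> {0..a}}) / real N - a\<bar>) ` {0..1})"
  proof (rule bdd_aboveI2)
    fix a :: real assume a: "a \<in> {0..1}"
    have "card {n \<in> {1..N}. x n \<in> {0..a}} \<le> card {1..N}" by (intro card_mono) auto
    then have "real (card {n \<in> {1..N}. x n \<in> {0..a}}) / real N \<le> 1"
      using False by (simp add: field_simps)
    moreover have "real (card {n \<in> {1..N}. x n \<in> {0..a}}) / real N \<ge> 0" by simp
    ultimately show "\<bar>real (card {n \<in> {1..N}. x n \<in> {0..a}}) / real N - a\<bar> \<le> 1"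
      using a unfolding abs_le_iff atLeastAtMost_iff by linarith
  qed
  then have "\<bar>real (card {n \<in> {1..N}. x n \<in> {0..a}}) / real N - a\<bar> \<le> star_discrepancy x N"
    unfolding star_discrepancy_def using a by (intro cSUP_upper) auto
  moreover have "\<bar>real (card {n \<in> {1..N}. x n \<in> {0..a}}) / real N - a\<bar>
       = \<bar>real (card {n \<in> {1..N}. x n \<in> {0..a}}) - real N * a\<bar> / real N"
    using False by (simp add: abs_divide_diff)
  ultimately show ?thesis using False by (simp add: field_simps)
qed simp

lemma star_discrepancy_nonneg: "real N * star_discrepancy x N \<ge> 0"
  using star_discrepancy_ge[of 0 N x] by (meson abs_ge_zero atLeastAtMost_iff order_refl order_trans zero_le_one)

lemma kronecker_star_discrepancy_le:
  assumes "\<And>s a. a \<in> {0..1} \<Longrightarrow> rotation_dev \<theta> s N a \<le> B"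
  shows "real N * star_discrepancy (\<lambda>n. frac (real n * \<theta>)) N \<le> B"
proof (rule star_discrepancy_le)
  fix a :: real assume a: "a \<in> {0..1}"
  have "{n \<in> {1..N}. frac (real n * \<theta>) \<in> {0..a}} = Suc ` {n \<in> {..<N}. frac (\<theta> + real n * \<theta>) \<le> a}"
  proof (intro equalityI subsetI)
    fix n assume n: "n \<in> {n \<in> {1..N}. frac (real n * \<theta>) \<in> {0..a}}"
    then have "n = Suc (n - 1)" by auto
    moreover have "\<theta> + real (n - 1) * \<theta> = real n * \<theta>" using n by (simp add: of_nat_diff algebra_simps)
    ultimately show "n \<in> Suc ` {n \<in> {..<N}. frac (\<theta> + real n * \<theta>) \<le> a}"
      using n by (intro image_eqI[of _ _ "n - 1"]) auto
  qed (auto simp: algebra_simps)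
  then have "card {n \<in> {1..N}. frac (real n * \<theta>) \<in> {0..a}} = card {n \<in> {..<N}. frac (\<theta> + real n * \<theta>) \<le> a}"
    by (simp add: card_image)
  then show "\<bar>real (card {n \<in> {1..N}. frac (real n * \<theta>) \<in> {0..a}}) - real N * a\<bar> \<le> B"
    using assms[OF a, of \<theta>] by (simp add: rotation_dev_def)
qed

section \<open>Thue--Morse signs and exponential sums\<close>

definition tm_sign :: "nat \<Rightarrow> real" where
  "tm_sign n = (-1) ^ thue_morse n"

lemma finite_bit_nat: "finite {i. bit (n::nat) i}"
proof (rule finite_subset)
  show "{i. bit n i} \<subseteq> {..n}"
  proof
    fix i assume "i \<in> {i. bit n i}"
    then have "2 ^ i \<le> n" by (metis mem_Collect_eq bit_iff_odd div_less even_zero not_le)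
    then show "i \<in> {..n}" by (metis atMost_iff less_exp less_imp_le order_trans)
  qed
qed simp

lemma thue_morse_0 [simp]: "thue_morse 0 = 0"
  by (simp add: thue_morse_def)

lemma thue_morse_double [simp]: "thue_morse (2 * n) = thue_morse n"
proof -
  have "{i. bit (2 * n) i} = Suc ` {i. bit n i}"
    by (auto simp: bit_double_iff image_iff gr0_conv_Suc)
  then show ?thesis by (simp add: thue_morse_def card_image)
qed

lemma thue_morse_Suc_double [simp]: "thue_morse (Suc (2 * n)) = 1 - thue_morse n"
proof -
  have "{i. bit (Suc (2 * n)) i} = insert 0 (Suc ` {i. bit n i})"
  proof (intro set_eqI)
    fix i show "i \<in> {i. bit (Suc (2 * n)) i} \<longleftrightarrow> i \<in> insert 0 (Suc ` {i. bit n i})"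
      by (cases i) (auto simp: bit_Suc bit_0)
  qed
  then have "card {i. bit (Suc (2 * n)) i} = Suc (card {i. bit n i})"
    by (simp add: card_insert_disjoint card_image finite_bit_nat image_iff)
  then show ?thesis by (simp add: thue_morse_def mod_Suc)
qed

lemma thue_morse_le_1: "thue_morse n \<le> 1"
  by (simp add: thue_morse_def)

lemma thue_morse_cases: "thue_morse n = 0 \<or> thue_morse n = 1"
  using thue_morse_le_1[of n] by linarith

lemma tm_sign_0 [simp]: "tm_sign 0 = 1" by (simp add: tm_sign_def)
lemma tm_sign_double [simp]: "tm_sign (2 * n) = tm_sign n" by (simp add: tm_sign_def)
lemma tm_sign_Suc_double [simp]: "tm_sign (Suc (2 * n)) = - tm_sign n"
  using thue_morse_cases[of n] by (auto simp: tm_sign_def)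
lemma tm_sign_cases: "tm_sign n = 1 \<or> tm_sign n = -1"
  using thue_morse_cases[of n] by (auto simp: tm_sign_def)
lemma abs_tm_sign [simp]: "\<bar>tm_sign n\<bar> = 1" using tm_sign_cases[of n] by auto
lemma tm_sign_eq: "tm_sign n = 1 - 2 * real (thue_morse n)"
  using thue_morse_cases[of n] by (auto simp: tm_sign_def)

lemma tm_sign_split: "r < 2 ^ k \<Longrightarrow> tm_sign (2 ^ k * m + r) = tm_sign m * tm_sign r"
proof (induction k arbitrary: r)
  case (Suc k)
  define r' where "r' = r div 2"
  have r': "r' < 2 ^ k" using Suc.prems by (simp add: r'_def less_mult_imp_div_less)
  show ?case
  proof (cases "even r")
    case True
    then have "r = 2 * r'" by (simp add: r'_def)
    moreover have "2 ^ Suc k * m + 2 * r' = 2 * (2 ^ k * m + r')" by simp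
    ultimately show ?thesis using Suc.IH[OF r'] by (metis tm_sign_double)
  next
    case False
    then have "r = Suc (2 * r')" by (simp add: r'_def)
    moreover have "2 ^ Suc k * m + Suc (2 * r') = Suc (2 * (2 ^ k * m + r'))" by simp
    ultimately show ?thesis using Suc.IH[OF r'] by (metis tm_sign_Suc_double mult_minus_right)
  qed
qed simp

text \<open>Each pair 2n, 2n+1 contributes exactly one element, namely
  \<open>2 * n + thue_morse n\<close>. Passing from indices to values thus creates no error
  term.\<close>

lemma card_thue_morse_less: "card {n. thue_morse n = 0 \<and> n < 2 * N} = N"
proof (induction N)
  case (Suc N)
  have "{n. thue_morse n = 0 \<and> n < 2 * Suc N} =
      insert (2 * N + thue_morse N) {n. thue_morse n = 0 \<and> n < 2 * N}"
    using thue_morse_cases[of N] by (auto simp: less_Suc_eq)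
  then show ?case using Suc by simp
qed simp

lemma infinite_thue_morse: "infinite {n. thue_morse n = 0}"
proof
  assume "finite {n. thue_morse n = 0}"
  then obtain b where b: "{n. thue_morse n = 0} \<subseteq> {..<b}" by (meson finite_nat_bounded)
  have "card {n. thue_morse n = 0 \<and> n < 2 * Suc b} \<le> card {..<b}"
    using b by (intro card_mono) auto
  then show False using card_thue_morse_less[of "Suc b"] by simp
qed

lemma bij_betw_enumerate_initial:
  fixes S :: "nat set"
  assumes "infinite S" "card {n. n \<in> S \<and> n < M} = N"
  shows "bij_betw (enumerate S) {..<N} {n. n \<in> S \<and> n < M}"
proof -
  have fin: "finite {n. n \<in> S \<and> n < M}" by simp
  have inj: "inj_on (enumerate S) {..<N}"
    using assms(1) by (auto simp: inj_on_def strict_mono_eq strict_mono_enumerate)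
  have sub: "enumerate S ` {..<N} \<supseteq> {n. n \<in> S \<and> n < M}"
  proof
    fix n assume n: "n \<in> {n. n \<in> S \<and> n < M}"
    then obtain i where i: "enumerate S i = n" using assms(1) enumerate_Ex by blast
    have "enumerate S ` {..i} \<subseteq> {n. n \<in> S \<and> n < M}"
    proof safe
      fix j assume "j \<le> i"
      show "enumerate S j \<in> S" using assms(1) by (rule enumerate_in_set)
      have "enumerate S j \<le> enumerate S i"
        using \<open>j \<le> i\<close> assms(1) by (simp add: strict_mono_less_eq strict_mono_enumerate)
      then show "enumerate S j < M" using i n by simp
    qed
    then have "card (enumerate S ` {..i}) \<le> N" using card_mono[OF fin] assms(2) by metis
    moreover have "card (enumerate S ` {..i}) = Suc i"
      using assms(1) by (subst card_image) (auto simp: inj_on_def strict_mono_eq strict_mono_enumerate)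
    ultimately show "n \<in> enumerate S ` {..<N}" using i by auto
  qed
  have "enumerate S ` {..<N} = {n. n \<in> S \<and> n < M}"
    by (rule card_subset_eq[symmetric]) (use inj sub assms in \<open>auto simp: card_image\<close>)
  then show ?thesis using inj by (simp add: bij_betw_def)
qed

lemma bij_betw_thue_morse_integer:
  "bij_betw thue_morse_integer {1..N} {n. thue_morse n = 0 \<and> n < 2 * N}"
proof -
  have "bij_betw (enumerate {n. thue_morse n = 0}) {..<N} {n. n \<in> {n. thue_morse n = 0} \<and> n < 2 * N}"
    by (rule bij_betw_enumerate_initial) (auto simp: infinite_thue_morse card_thue_morse_less)
  moreover have "bij_betw (\<lambda>k. k - 1) {1..N} {..<N}"
    by (rule bij_betwI[where g = Suc]) auto
  ultimately have "bij_betw (enumerate {n. thue_morse n = 0} \<circ> (\<lambda>k. k - 1)) {1..N}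
      {n. n \<in> {n. thue_morse n = 0} \<and> n < 2 * N}"
    using bij_betw_trans by blast
  moreover have "enumerate {n. thue_morse n = 0} \<circ> (\<lambda>k. k - 1) = thue_morse_integer"
    by (simp add: fun_eq_iff thue_morse_integer_def)
  ultimately show ?thesis by simp
qed

text \<open>The indicator of t_n = 0 is (1 + tm_sign n) / 2. Vector-valued \<open>f\<close> lets the
  same identity serve the real counts and the complex exponential sums.\<close>

lemma sum_thue_morse_integer:
  fixes f :: "nat \<Rightarrow> 'a::real_vector"
  shows "(\<Sum>k=1..N. f (thue_morse_integer k)) = (1/2) *\<^sub>R ((\<Sum>n<2*N. f n) + (\<Sum>n<2*N. tm_sign n *\<^sub>R f n))"
proof -
  have "(\<Sum>k=1..N. f (thue_morse_integer k)) = (\<Sum>n\<in>{n. thue_morse n = 0 \<and> n < 2 * N}. f n)"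
    by (rule sum.reindex_bij_betw[OF bij_betw_thue_morse_integer])
  also have "\<dots> = (\<Sum>n\<in>{..<2*N}. if thue_morse n = 0 then f n else 0)"
    by (subst sum.inter_filter[symmetric]) (auto intro!: sum.cong)
  also have "\<dots> = (\<Sum>n\<in>{..<2*N}. (1/2) *\<^sub>R (f n + tm_sign n *\<^sub>R f n))"
  proof (intro sum.cong refl)
    fix n show "(if thue_morse n = 0 then f n else 0) = (1/2) *\<^sub>R (f n + tm_sign n *\<^sub>R f n)"
      using thue_morse_cases[of n] by (auto simp: tm_sign_def scaleR_2[symmetric])
  qed
  finally show ?thesis by (simp add: scaleR_sum_right sum.distrib scaleR_right_distrib)
qed

section \<open>Exponential sums with Thue-Morse signs\<close>

definition ee :: "real \<Rightarrow> complex" where "ee x = cis (2 * pi * x)"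

lemma ee_add: "ee (x + y) = ee x * ee y" by (simp add: ee_def cis_mult distrib_left)
lemma norm_ee [simp]: "norm (ee x) = 1" by (simp add: ee_def)
lemma ee_of_int [simp]: "ee (of_int n) = 1"
  by (simp add: ee_def cis_multiple_2pi)
lemma ee_of_nat [simp]: "ee (of_nat n) = 1" using ee_of_int[of "int n"] by simp
lemma ee_0 [simp]: "ee 0 = 1" by (simp add: ee_def)
lemma ee_add_int: "ee (x + of_int n) = ee x" by (simp add: ee_add)
lemma ee_of_nat_mult: "ee (of_nat n * x) = ee x ^ n"
  unfolding ee_def Complex.DeMoivre by (simp add: mult_ac)
lemma norm_one_minus_ee: "norm (1 - ee x) = 2 * \<bar>sin (pi * x)\<bar>"
proof -
  have "norm (1 - ee x) ^ 2 = (1 - cos (2 * (pi * x)))^2 + (sin (2 * (pi * x)))^2"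
    by (simp add: ee_def cmod_power2 mult.assoc)
  also have "\<dots> = (2 * \<bar>sin (pi * x)\<bar>)^2"
    unfolding cos_double_sin sin_double using sin_cos_squared_add[of "pi * x"]
    by (simp add: power2_eq_square) algebra
  finally show ?thesis by (metis abs_ge_zero mult_nonneg_nonneg norm_ge_zero power2_eq_iff_nonneg zero_le_numeral)
qed

definition tm_sum :: "nat \<Rightarrow> real \<Rightarrow> complex" where
  "tm_sum M x = (\<Sum>n<M. of_real (tm_sign n) * ee (real n * x))"

lemma tm_sum_double: "tm_sum (2 * M) x = (1 - ee x) * tm_sum M (2 * x)"
proof -
  have "tm_sum (2 * M) x = (\<Sum>n<M. of_real (tm_sign (2 * n)) * ee (real (2 * n) * x)
      + of_real (tm_sign (Suc (2 * n))) * ee (real (Suc (2 * n)) * x))"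
    unfolding tm_sum_def by (induction M) (simp_all add: add_ac)
  also have "\<dots> = (\<Sum>n<M. (1 - ee x) * (of_real (tm_sign n) * ee (real n * (2 * x))))"
  proof (intro sum.cong refl)
    fix n
    have "real (Suc (2 * n)) * x = x + real n * (2 * x)" by (simp add: algebra_simps)
    then have "ee (real (Suc (2 * n)) * x) = ee x * ee (real n * (2 * x))" by (simp only: ee_add)
    moreover have "real (2 * n) * x = real n * (2 * x)" by simp
    ultimately show "of_real (tm_sign (2 * n)) * ee (real (2 * n) * x)
      + of_real (tm_sign (Suc (2 * n))) * ee (real (Suc (2 * n)) * x)
      = (1 - ee x) * (of_real (tm_sign n) * ee (real n * (2 * x)))"
      by (simp only: tm_sign_double tm_sign_Suc_double) (simp add: algebra_simps)
  qed
  finally show ?thesis by (simp add: tm_sum_def sum_distrib_left)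
qed

lemma tm_sum_pow2: "tm_sum (2 ^ L) x = (\<Prod>i<L. 1 - ee (2 ^ i * x))"
proof (induction L arbitrary: x)
  case 0
  then show ?case by (simp add: tm_sum_def)
next
  case (Suc L)
  have "tm_sum (2 ^ Suc L) x = (1 - ee x) * (\<Prod>i<L. 1 - ee (2 ^ i * (2 * x)))"
    using tm_sum_double[of "2 ^ L" x] Suc by simp
  then show ?case by (subst prod.lessThan_Suc_shift) (simp add: mult_ac)
qed

text \<open>The last binary digit of M is peeled off: an odd M costs one term of modulus 1, and
  halving the even part pulls out the first factor and doubles x. The j-th digit thus contributes at
  most the product of the first j factors.\<close>

lemma norm_tm_sum_le: "M < 2 ^ L \<Longrightarrow> norm (tm_sum M x) \<le> (\<Sum>j<L. \<Prod>i<j. norm (1 - ee (2 ^ i * x)))"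
proof (induction L arbitrary: M x)
  case 0
  then show ?case by (simp add: tm_sum_def)
next
  case (Suc L)
  define M' where "M' = M div 2"
  have M': "M' < 2 ^ L" using Suc.prems by (simp add: M'_def less_mult_imp_div_less)
  have "norm (tm_sum M x) \<le> 1 + norm (tm_sum (2 * M') x)"
  proof (cases "even M")
    case False
    then have "M = Suc (2 * M')" by (simp add: M'_def)
    then have "tm_sum M x = tm_sum (2 * M') x + of_real (tm_sign (2 * M')) * ee (real (2 * M') * x)"
      by (simp add: tm_sum_def)
    also have "norm \<dots> \<le> norm (tm_sum (2 * M') x) + norm (of_real (tm_sign (2 * M')) * ee (real (2 * M') * x))"
      by (rule norm_triangle_ineq)
    finally show ?thesis by (simp add: norm_mult)
  qed (simp add: M'_def)
  also have "norm (tm_sum (2 * M') x) \<le> norm (1 - ee x) * (\<Sum>j<L. \<Prod>i<j. norm (1 - ee (2 ^ i * (2 * x))))"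
    unfolding tm_sum_double norm_mult by (intro mult_left_mono Suc.IH[OF M']) auto
  also have "1 + \<dots> = (\<Sum>j<Suc L. \<Prod>i<j. norm (1 - ee (2 ^ i * x)))"
    by (subst sum.lessThan_Suc_shift)
      (simp add: prod.lessThan_Suc_shift sum_distrib_left mult_ac del: prod.lessThan_Suc)
  finally show ?case by simp
qed

text \<open>In u = sin^2 x the square of the left side is u^3 (1 - u). The factor (4 u - 3)^2 below
  is the double root at the maximum u = 3/4, that is x = pi/3.\<close>

lemma sin_cubed_cos_le: "\<bar>sin x ^ 3 * cos x\<bar> \<le> 3 * sqrt 3 / 16" for x :: real
proof -
  define u where "u = (sin x)^2"
  have u: "0 \<le> u" "u \<le> 1" by (auto simp: u_def abs_square_le_1)
  have "27 - 256 * u^3 * (1 - u) = (4 * u - 3)^2 * (16 * u^2 + 8 * u + 3)"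
    by algebra
  also have "\<dots> \<ge> 0" using u by (intro mult_nonneg_nonneg) auto
  finally have "u^3 * (1 - u) \<le> 27 / 256" by simp
  moreover have "(sin x ^ 3 * cos x)^2 = u^3 * (1 - u)"
    unfolding u_def by (simp add: power_mult_distrib cos_squared_eq flip: power_mult)
  moreover have "(3 * sqrt 3 / 16)^2 = (27 / 256 :: real)" by (simp add: power_divide power_mult_distrib)
  ultimately have "\<bar>sin x ^ 3 * cos x\<bar> ^ 2 \<le> (3 * sqrt 3 / 16)^2" by simp
  then show ?thesis by (rule power2_le_imp_le) simp
qed

text \<open>The cube of the product regroups into factors \<open>\<bar>sin y\<bar>^2 \<bar>sin 2y\<bar>\<close>, whose maximum, attained at
  \<open>y = pi / 3\<close>, does not exceed \<open>(sqrt 3 / 2)^3\<close>.\<close>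
lemma prod_norm_one_minus_ee_le: "(\<Prod>i<j. norm (1 - ee (2 ^ i * x))) \<le> 2 * sqrt 3 ^ j"
proof (cases j)
  case (Suc m)
  define f where "f = (\<lambda>i. norm (1 - ee (2 ^ i * x)))"
  have f0: "f i \<ge> 0" for i by (simp add: f_def)
  have f2: "f i \<le> 2" for i by (simp add: f_def norm_one_minus_ee)
  have step: "f i ^ 2 * f (Suc i) \<le> sqrt 3 ^ 3" for i
  proof -
    define y where "y = pi * (2 ^ i * x)"
    have "f i ^ 2 * f (Suc i) = 8 * (\<bar>sin y\<bar> ^ 2 * \<bar>sin (2 * y)\<bar>)"
      by (simp add: f_def norm_one_minus_ee y_def power_mult_distrib mult_ac)
    also have "\<dots> = 16 * \<bar>sin y ^ 3 * cos y\<bar>"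
      by (simp add: sin_double abs_mult power2_eq_square power3_eq_cube power_abs)
    also have "\<dots> \<le> 16 * (3 * sqrt 3 / 16)" by (intro mult_left_mono sin_cubed_cos_le) auto
    also have "\<dots> = sqrt 3 ^ 3" by (simp add: power3_eq_cube)
    finally show ?thesis .
  qed
  have "(\<Prod>i<Suc m. f i) ^ 3 = f 0 * f m ^ 2 * (\<Prod>i<m. f i ^ 2 * f (Suc i))" for m
  proof (induction m)
    case (Suc m)
    have "(\<Prod>i<Suc (Suc m). f i) ^ 3 = (\<Prod>i<Suc m. f i) ^ 3 * f (Suc m) ^ 3"
      by (simp add: power_mult_distrib)
    also have "\<dots> = f 0 * f (Suc m) ^ 2 * (\<Prod>i<Suc m. f i ^ 2 * f (Suc i))"
      unfolding Suc by (simp add: power2_eq_square power3_eq_cube)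
    finally show ?case .
  qed (simp add: power2_eq_square power3_eq_cube)
  then have "(\<Prod>i<j. f i) ^ 3 = f 0 * f m ^ 2 * (\<Prod>i<m. f i ^ 2 * f (Suc i))"
    using Suc by simp
  \<comment> \<open>The unpaired boundary factors contribute at most 2 * 4 = 2^3, whose cube root is
    the constant 2 of the statement.\<close>
  also have "\<dots> \<le> 2 * 2 ^ 2 * (\<Prod>i<m. sqrt 3 ^ 3)"
  proof (intro mult_mono)
    show "(\<Prod>i<m. f i ^ 2 * f (Suc i)) \<le> (\<Prod>i<m. sqrt 3 ^ 3)"
      using f0 step by (intro prod_mono) simp
    show "f m ^ 2 \<le> 2 ^ 2" using f0 f2 by (intro power_mono)
  qed (use f0 f2 in \<open>auto intro!: prod_nonneg\<close>)
  also have "\<dots> = (2 * sqrt 3 ^ m) ^ 3"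
    by (simp only: power_mult_distrib prod_constant card_lessThan power_mult[symmetric] mult.commute[of m]) simp
  finally have "(\<Prod>i<j. f i) ^ Suc 2 \<le> (2 * sqrt 3 ^ m) ^ Suc 2" by (simp only: numeral_3_eq_3 numeral_2_eq_2)
  then have "(\<Prod>i<j. f i) \<le> 2 * sqrt 3 ^ m"
    by (rule power_le_imp_le_base) simp
  also have "\<dots> \<le> 2 * sqrt 3 ^ j" using Suc by simp
  finally show ?thesis by (simp add: f_def)
qed simp

lemma norm_tm_sum_bound:
  assumes "M \<ge> 1"
  shows "norm (tm_sum M x) \<le> 6 * real M powr (ln 3 / ln 4)"
proof -
  obtain L where L: "2 ^ L \<le> M" "M < 2 ^ Suc L" using ex_power_ivl1[of 2 M] assms by auto
  have "norm (tm_sum M x) \<le> (\<Sum>j<Suc L. \<Prod>i<j. norm (1 - ee (2 ^ i * x)))"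
    by (rule norm_tm_sum_le) fact
  also have "\<dots> \<le> (\<Sum>j<Suc L. 2 * sqrt 3 ^ j)"
    by (intro sum_mono prod_norm_one_minus_ee_le)
  \<comment> \<open>The constant 6 is inductive because 6 + 2 sqrt 3 <= 6 sqrt 3, that is sqrt 3 >=
    3/2.\<close>
  also have "\<dots> \<le> 6 * sqrt 3 ^ L"
  proof (induction L)
    case (Suc L)
    have s: "sqrt 3 \<ge> 3 / 2" by (rule real_le_rsqrt) (simp add: power_divide)
    have "(\<Sum>j<Suc (Suc L). 2 * sqrt 3 ^ j) \<le> 6 * sqrt 3 ^ L + 2 * sqrt 3 ^ Suc L" using Suc by simp
    also have "\<dots> \<le> 6 * sqrt 3 ^ Suc L"
      using mult_right_mono[OF s, of "4 * sqrt 3 ^ L"] by simp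
    finally show ?case .
  qed simp
  also have "sqrt 3 ^ L = (2 ^ L) powr (ln 3 / ln 4)"
  proof -
    have "ln (4::real) = 2 * ln 2" using ln_realpow[of 2 2] by simp
    have "sqrt 3 ^ L = exp (real L * ln (sqrt 3))" by (simp add: exp_of_nat_mult)
    also have "\<dots> = (2 ^ L) powr (ln 3 / ln 4)"
      using \<open>ln 4 = 2 * ln 2\<close> by (simp add: powr_def ln_realpow ln_sqrt)
    finally show ?thesis .
  qed
  also have "\<dots> \<le> real M powr (ln 3 / ln 4)"
    using L by (intro powr_mono2) (auto simp flip: of_nat_le_iff)
  finally show ?thesis by simp
qed

section \<open>Finite Fourier analysis of intervals modulo Q\<close>

lemma sum_ee_orthogonal:
  fixes d :: int and Q :: nat
  assumes "\<bar>d\<bar> < int Q"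
  shows "(\<Sum>h<Q. ee (real h * (d / Q))) = (if d = 0 then of_nat Q else 0)"
proof (cases "d = 0")
  case False
  have Q: "Q > 0" using assms by linarith
  have "ee (d / Q) \<noteq> 1"
  proof
    assume "ee (d / Q) = 1"
    then have "norm (1 - ee (d / Q)) = 0" by simp
    then have "sin (pi * (d / Q)) = 0" by (simp add: norm_one_minus_ee)
    then obtain k :: int where "pi * (d / Q) = of_int k * pi" using sin_zero_iff_int2 by blast
    then have "real_of_int d = of_int (k * int Q)" using Q by (simp add: field_simps)
    then have "d = k * int Q" by (simp only: of_int_eq_iff)
    then have "int Q dvd d" by simp
    then show False using assms False zdvd_imp_le[of "int Q" "\<bar>d\<bar>"] by simp
  qed
  moreover have "ee (d / Q) ^ Q = 1"
    using ee_of_nat_mult[of Q "d / Q"] Q by simp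
  ultimately show ?thesis using False
    by (simp only: ee_of_nat_mult sum_gp_strict) simp
qed simp

text \<open>The chord bound with a factor 2 given away: sin u >= u - u^3/6 >= u/2 on [0, 8/5], which
  contains [0, pi/2], and pi >= 2.\<close>

lemma sin_pi_ge:
  assumes "0 \<le> t" "t \<le> 1"
  shows "sin (pi * t) \<ge> min t (1 - t)"
proof -
  have *: "sin (pi * t) \<ge> t" if t: "0 \<le> t" "t \<le> 1 / 2" for t
  proof -
    define u where "u = pi * t"
    have "pi * t \<le> pi * (1/2)" using t by (intro mult_left_mono) auto
    also have "pi * (1/2) \<le> 8 / 5" using pi_approx(2) by simp
    finally have "u \<le> 8 / 5" unfolding u_def .
    moreover have "0 \<le> u" using t by (simp add: u_def)
    ultimately have u: "0 \<le> u" "u \<le> 8 / 5" by simp_all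
    have "\<bar>sin u - (\<Sum>m<3. sin_coeff m * u ^ m)\<bar> \<le> inverse (fact 3) * \<bar>u\<bar> ^ 3"
      by (rule Maclaurin_sin_bound)
    moreover have "(\<Sum>m<3. sin_coeff m * u ^ m) = u"
      by (simp add: sin_coeff_def numeral_3_eq_3)
    moreover have "fact 3 = (6::real)" by (simp add: numeral_3_eq_3)
    ultimately have "\<bar>sin u - u\<bar> \<le> u ^ 3 / 6" using u by simp
    then have 1: "sin u \<ge> u - u ^ 3 / 6" by linarith
    have "u^2 \<le> (8 / 5)^2" using u by (intro power_mono) auto
    then have "u * u^2 \<le> u * (8 / 5)^2" using u by (intro mult_left_mono) auto
    then have "u - u ^ 3 / 6 \<ge> u / 2" using u by (simp add: power2_eq_square power3_eq_cube)
    moreover have "u / 2 \<ge> t"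
      using mult_right_mono[of 2 pi t] pi_approx t by (simp add: u_def)
    ultimately show ?thesis using 1 by (simp add: u_def)
  qed
  show ?thesis
  proof (cases "t \<le> 1 / 2")
    case True
    then show ?thesis using *[of t] assms by simp
  next
    case False
    have "sin (pi * t) = sin (pi * (1 - t))"
      using sin_pi_minus[of "pi * t"] by (simp add: algebra_simps)
    then show ?thesis using *[of "1 - t"] assms False by simp
  qed
qed

lemma norm_sum_ee_le:
  assumes "0 < t" "t < 1"
  shows "norm (\<Sum>y<J. ee (- real y * t)) \<le> 1 / t + 1 / (1 - t)"
proof -
  have s: "norm (1 - ee (-t)) \<ge> 2 * min t (1 - t)"
    using sin_pi_ge[of t] assms by (simp add: norm_one_minus_ee)
  then have pos: "norm (1 - ee (-t)) > 0" using assms by (smt (verit) min_less_iff_conj)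
  then have ne: "ee (-t) \<noteq> 1" by auto
  have "(\<Sum>y<J. ee (- real y * t)) = (\<Sum>y<J. ee (-t) ^ y)"
    by (simp flip: ee_of_nat_mult)
  also have "\<dots> = (1 - ee (-t) ^ J) / (1 - ee (-t))" using ne by (simp add: sum_gp_strict)
  finally have "norm (\<Sum>y<J. ee (- real y * t)) = norm (1 - ee (-t) ^ J) / norm (1 - ee (-t))"
    by (simp add: norm_divide)
  also have "\<dots> \<le> 2 / norm (1 - ee (-t))"
    using norm_triangle_ineq4[of 1 "ee (-t) ^ J"] pos by (intro divide_right_mono) (auto simp: norm_power)
  also have "\<dots> \<le> 2 / (2 * min t (1 - t))"
    using s assms pos by (intro divide_left_mono mult_pos_pos) auto
  \<comment> \<open>Bounding the maximum of 1/t and 1/(1-t) by their sum makes the later sum over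
    frequencies split into two harmonic sums.\<close>
  also have "\<dots> \<le> 1 / t + 1 / (1 - t)" using assms by (simp add: min_def)
  finally show ?thesis .
qed

lemma harm_le_ln: "n \<ge> 1 \<Longrightarrow> harm n \<le> 1 + ln (real n)"
proof -
  assume "n \<ge> 1"
  then obtain m where m: "n = Suc m" by (cases n) auto
  have "harm (Suc m) - ln (real (Suc m)) \<le> harm (Suc 0) - ln (real (Suc 0))"
    using decseq_harm_diff_ln by (rule decseqD) simp
  then show ?thesis by (simp add: m harm_def)
qed

text \<open>Replaces the Erdos--Turan inequality: on \<open>Z/QZ\<close> the indicator of an interval is an exact
  finite Fourier sum whose coefficients have \<open>l\<^sub>1\<close> norm \<open>O(log Q)\<close>, so no smoothing is needed.\<close>
lemma finite_fourier_bound: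
  fixes x :: "nat \<Rightarrow> int" and c :: "nat \<Rightarrow> real"
  assumes Q: "Q \<ge> 1" and J: "J \<le> Q" and x: "\<And>n. n < M \<Longrightarrow> 0 \<le> x n \<and> x n < int Q"
    and B: "\<And>h. norm (\<Sum>n<M. of_real (c n) * ee (real h * (x n / Q))) \<le> B"
  shows "\<bar>\<Sum>n<M. c n * (if x n < int J then 1 else 0)\<bar> \<le> (3 + 2 * ln Q) * B"
proof -
  define S where "S = (\<lambda>h. \<Sum>n<M. of_real (c n) * ee (real h * (x n / Q)))"
  define D where "D = (\<lambda>h. \<Sum>y<J. ee (- real y * (real h / Q)))"
  have B0: "B \<ge> 0" using B[of 0] norm_ge_zero order_trans by blast
  have ind: "of_real (if x n < int J then 1 else 0) = (\<Sum>h<Q. D h * ee (real h * (x n / Q))) / of_nat Q"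
    if "n < M" for n
  proof -
    have "(\<Sum>h<Q. D h * ee (real h * (x n / Q)))
        = (\<Sum>h<Q. \<Sum>y<J. ee (real h * ((x n - int y) / Q)))"
      unfolding D_def sum_distrib_right
      by (intro sum.cong refl) (simp add: ee_add[symmetric] diff_divide_distrib algebra_simps)
    also have "\<dots> = (\<Sum>y<J. \<Sum>h<Q. ee (real h * ((x n - int y) / Q)))"
      by (rule sum.swap)
    also have "\<dots> = (\<Sum>y<J. if x n - int y = 0 then of_nat Q else 0)"
      using x[OF that] J by (intro sum.cong refl sum_ee_orthogonal) auto
    also have "\<dots> = (\<Sum>y<J. if y = nat (x n) then of_nat Q else 0)"
      using x[OF that] by (intro sum.cong) auto
    also have "\<dots> = (if x n < int J then of_nat Q else 0)"
      using x[OF that] by (simp add: nat_less_iff)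
    finally show ?thesis using Q by simp
  qed
  have "of_real (\<Sum>n<M. c n * (if x n < int J then 1 else 0))
      = (\<Sum>n<M. of_real (c n) * ((\<Sum>h<Q. D h * ee (real h * (x n / Q))) / of_nat Q))"
    unfolding of_real_sum of_real_mult using ind by (intro sum.cong) auto
  also have "\<dots> = (\<Sum>n<M. \<Sum>h<Q. D h * (of_real (c n) * ee (real h * (x n / Q)))) / of_nat Q"
    by (simp add: sum_divide_distrib sum_distrib_left mult_ac)
  also have "\<dots> = (\<Sum>h<Q. D h * S h) / of_nat Q"
    by (subst sum.swap) (simp add: S_def sum_distrib_left)
  finally have eq: "of_real (\<Sum>n<M. c n * (if x n < int J then 1 else 0)) = (\<Sum>h<Q. D h * S h) / of_nat Q" .
  have "\<bar>\<Sum>n<M. c n * (if x n < int J then 1 else 0)\<bar> = norm (\<Sum>h<Q. D h * S h) / Q"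
    using arg_cong[OF eq, of norm] by (simp only: norm_of_real norm_divide norm_of_nat)
  also have "\<dots> \<le> (\<Sum>h<Q. norm (D h) * B) / Q"
    using B by (intro divide_right_mono sum_norm_le) (auto simp: norm_mult S_def intro!: mult_left_mono)
  also have "\<dots> = (\<Sum>h<Q. norm (D h)) * B / Q" by (simp add: sum_distrib_right)
  also have "(\<Sum>h<Q. norm (D h)) \<le> Q * (3 + 2 * ln Q)"
  proof -
    obtain m where m: "Q = Suc m" using Q by (cases Q) auto
    have "(\<Sum>h<Q. norm (D h)) = norm (D 0) + (\<Sum>h<m. norm (D (Suc h)))"
      unfolding m by (rule sum.lessThan_Suc_shift)
    also have "norm (D 0) \<le> Q" using J by (simp add: D_def)
    also have "(\<Sum>h<m. norm (D (Suc h))) \<le> (\<Sum>h<m. Q / real (Suc h) + Q / real (m - h))"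
    proof (rule sum_mono)
      fix h assume h: "h \<in> {..<m}"
      define t where "t = real (Suc h) / Q"
      have t: "0 < t" "t < 1" using h m by (auto simp: t_def)
      have "1 - t = real (m - h) / Q" using h m by (simp add: t_def field_simps of_nat_diff)
      then show "norm (D (Suc h)) \<le> Q / real (Suc h) + Q / real (m - h)"
        using norm_sum_ee_le[OF t, of J] by (simp add: D_def t_def)
    qed
    also have "\<dots> = Q * ((\<Sum>h<m. 1 / real (Suc h)) + (\<Sum>h<m. 1 / real (m - h)))"
      by (simp add: sum.distrib sum_distrib_left distrib_left)
    also have "(\<Sum>h<m. 1 / real (m - h)) = (\<Sum>h<m. 1 / real (Suc h))"
      by (subst sum.nat_diff_reindex[symmetric]) (auto intro!: sum.cong)
    also have "(\<Sum>h<m. 1 / real (Suc h)) = harm m"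
      by (simp add: harm_def sum.atLeast1_atMost_eq inverse_eq_divide)
    finally have le: "(\<Sum>h<Q. norm (D h)) \<le> Q + Q * (harm m + harm m)" by simp
    have "harm m \<le> 1 + ln Q"
    proof (cases "m = 0")
      case False
      then have "harm m \<le> 1 + ln (real m)" by (intro harm_le_ln) simp
      also have "ln (real m) \<le> ln Q" using m False by simp
      finally show ?thesis by simp
    qed (use Q in \<open>simp add: harm_def\<close>)
    then have "Q * (harm m + harm m) \<le> Q * ((1 + ln Q) + (1 + ln Q))"
      by (intro mult_left_mono add_mono) auto
    then show ?thesis using le by (simp add: algebra_simps)
  qed
  finally show ?thesis using Q B0 by (simp add: mult_right_mono divide_right_mono)
qed

section \<open>Discrepancy along the Thue--Morse integers\<close>

text \<open>Koksma's inequality for e(h t), which has total variation 2 pi h. Each 1 - e(h x_k) is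
  the integral of the derivative over [x_k, 1]; summing gives the integral of the counting function
  \<open>A\<close> against \<open>f'\<close>. Subtracting N times the integral of t f'(t), which is
  N, leaves A(t) - N t under the integral, and this is at most N times the discrepancy.\<close>

lemma koksma:
  fixes x :: "nat \<Rightarrow> real" and h :: nat
  assumes h: "h \<ge> 1" and x: "\<And>k. k \<in> {1..N} \<Longrightarrow> x k \<in> {0..1}"
  shows "norm (\<Sum>k=1..N. ee (real h * x k)) \<le> 2 * pi * h * (real N * star_discrepancy x N)"
proof -
  define f' where "f' = (\<lambda>t. of_real (2 * pi * h) * (\<i> * ee (real h * t)))"
  define A where "A = (\<lambda>t. real (card {k \<in> {1..N}. x k \<in> {0..t}}))"
  have dv: "((\<lambda>t. ee (real h * t)) has_vector_derivative f' t) (at t within S)" for t S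
  proof -
    have "((\<lambda>z. exp (\<i> * (of_real (2 * pi * h) * z))) has_field_derivative f' t) (at (of_real t))"
      unfolding f'_def ee_def cis_conv_exp
      by (rule derivative_eq_intros refl | simp add: mult_ac)+
    then have "((\<lambda>t. exp (\<i> * (of_real (2 * pi * h) * of_real t))) has_vector_derivative f' t) (at t within S)"
      by (rule has_vector_derivative_real_field)
    then show ?thesis by (simp add: ee_def cis_conv_exp mult_ac)
  qed
  have h1: "ee (real h) = 1" by simp
  have i1: "((\<lambda>t. if x k \<le> t then f' t else 0) has_integral (1 - ee (real h * x k))) {0..1}"
    if k: "k \<in> {1..N}" for k
  proof -
    have xk: "0 \<le> x k" "x k \<le> 1" using x[OF k] by auto
    have "(f' has_integral (ee (real h * 1) - ee (real h * x k))) {x k..1}"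
      by (rule fundamental_theorem_of_calculus) (use dv xk in auto)
    then have "((\<lambda>t. if t \<in> {x k..1} then f' t else 0) has_integral (1 - ee (real h * x k))) {0..1}"
      using xk h1 by (subst has_integral_restrict) auto
    then show ?thesis by (rule has_integral_eq[rotated]) (use xk in auto)
  qed
  have "((\<lambda>t. \<Sum>k=1..N. if x k \<le> t then f' t else 0) has_integral (\<Sum>k=1..N. 1 - ee (real h * x k))) {0..1}"
    by (rule has_integral_sum) (use i1 in auto)
  moreover have "(\<Sum>k=1..N. if x k \<le> t then f' t else 0) = A t * f' t" if "t \<in> {0..1}" for t
  proof -
    have "(\<Sum>k=1..N. if x k \<le> t then f' t else 0) = (\<Sum>k\<in>{k \<in> {1..N}. x k \<in> {0..t}}. f' t)"
      using x by (subst sum.inter_filter) (auto intro!: sum.cong)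
    then show ?thesis by (simp add: A_def)
  qed
  ultimately have I1: "((\<lambda>t. A t * f' t) has_integral (\<Sum>k=1..N. 1 - ee (real h * x k))) {0..1}"
    by (metis (no_types, lifting) has_integral_cong)
  have "((\<lambda>t. t * f' t) has_integral 1) {0..1}"
  proof -
    \<comment> \<open>An antiderivative of t f'(t), found by parts; \<open>H 1 - H 0\<close> is 1
      because e(h) = e(0).\<close>
    define H where "H = (\<lambda>t. of_real t * ee (real h * t) - ee (real h * t) / (of_real (2 * pi * h) * \<i>))"
    have "((\<lambda>t. t * f' t) has_integral (H 1 - H 0)) {0..1}"
    proof (rule fundamental_theorem_of_calculus)
      fix t :: real
      have "(H has_vector_derivative (of_real t * f' t + of_real 1 * ee (real h * t)
          - f' t / (of_real (2 * pi * h) * \<i>))) (at t within {0..1})"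
        unfolding H_def
        by (intro has_vector_derivative_diff has_vector_derivative_mult dv has_vector_derivative_divide
            has_vector_derivative_of_real DERIV_ident)
      moreover have "f' t / (of_real (2 * pi * h) * \<i>) = ee (real h * t)"
        using h by (simp add: f'_def)
      ultimately show "(H has_vector_derivative t * f' t) (at t within {0..1})" by simp
    qed simp
    then show ?thesis by (simp add: H_def h1)
  qed
  then have I2: "((\<lambda>t. of_nat N * (t * f' t)) has_integral (of_nat N * 1)) {0..1}"
    by (rule has_integral_mult_right)
  have I: "((\<lambda>t. A t * f' t - of_nat N * (t * f' t)) has_integral
      ((\<Sum>k=1..N. 1 - ee (real h * x k)) - of_nat N * 1)) (cbox 0 1)"
    using has_integral_diff[OF I1 I2] by simp
  have "norm ((\<Sum>k=1..N. 1 - ee (real h * x k)) - of_nat N * 1)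
      \<le> (2 * pi * h * (real N * star_discrepancy x N)) * Henstock_Kurzweil_Integration.content (cbox 0 (1::real))"
  proof (rule has_integral_bound[OF _ I])
    show "0 \<le> 2 * pi * h * (real N * star_discrepancy x N)"
      by (rule mult_nonneg_nonneg[OF _ star_discrepancy_nonneg]) simp
    fix t :: real assume t: "t \<in> cbox 0 1"
    have "A t * f' t - of_nat N * (t * f' t) = of_real (A t - real N * t) * f' t"
      by (simp add: algebra_simps)
    then have "norm (A t * f' t - of_nat N * (t * f' t)) = \<bar>A t - real N * t\<bar> * norm (f' t)"
      by (simp only: norm_mult norm_of_real)
    also have "norm (f' t) = 2 * pi * h" by (simp add: f'_def norm_mult)
    also have "\<bar>A t - real N * t\<bar> * (2 * pi * h) \<le> (real N * star_discrepancy x N) * (2 * pi * h)"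
      using star_discrepancy_ge[of t N x] t by (intro mult_right_mono) (auto simp: A_def)
    finally show "norm (A t * f' t - of_nat N * (t * f' t)) \<le> 2 * pi * h * (real N * star_discrepancy x N)"
      by (simp only: mult_ac)
  qed
  moreover have "(\<Sum>k=1..N. 1 - ee (real h * x k)) - of_nat N * 1 = - (\<Sum>k=1..N. ee (real h * x k))"
    by (simp add: sum_subtractf)
  ultimately show ?thesis by simp
qed

section \<open>Signed counts and their transfer to residues modulo Q\<close>

definition tm_dev :: "real \<Rightarrow> nat \<Rightarrow> real \<Rightarrow> real" where
  "tm_dev \<theta> M a = (\<Sum>n<M. tm_sign n * (if frac (real n * \<theta>) \<le> a then 1 else 0))"

lemma frac_div_int:
  fixes z :: int and Q :: nat
  assumes Q: "Q > 0" and e: "0 \<le> e" "e < 1 / Q"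
  shows "frac (z / Q + e) = (z mod int Q) / Q + e"
proof (rule frac_eqI[where k = "z div int Q"])
  have "real_of_int z = of_int (z div int Q * int Q + z mod int Q)" by simp
  then have "real_of_int z = of_int (z div int Q) * real Q + of_int (z mod int Q)"
    unfolding of_int_add of_int_mult by simp
  then show "z / Q + e - of_int (z div int Q) = (z mod int Q) / Q + e"
    using Q by (simp add: field_simps)
  show "0 \<le> (z mod int Q) / Q + e" using Q e by simp
  have "z mod int Q + 1 \<le> int Q" using Q pos_mod_bound[of "int Q" z] by linarith
  then have "real_of_int (z mod int Q) + 1 \<le> real Q" by linarith
  then have "(z mod int Q) / Q + 1 / Q \<le> 1" using Q by (simp add: field_simps)
  then show "(z mod int Q) / Q + e < 1" using e by linarith
qed

text \<open>Replacing theta by P/Q from below shifts each of the M points by less than 1/Q to the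
  right, so a point stays in its cell [z/Q, (z+1)/Q) and does not wrap around. Membership in [0, a]
  is then decided by the residue z, except in the cell \<open>J\<close> containing a; since n -> n P
  is injective modulo Q and M <= Q, that cell is met at most once. The signed count of residues is
  left to the finite Fourier bound.\<close>

lemma tm_dev_bound:
  fixes P :: int and Q :: nat
  assumes M: "1 \<le> M" "M \<le> Q" and cop: "coprime P (int Q)"
    and ap: "0 \<le> \<theta> - P / Q" "real M * (\<theta> - P / Q) < 1 / Q"
    and a: "a \<in> {0..1}"
  shows "\<bar>tm_dev \<theta> M a\<bar> \<le> (3 + 2 * ln Q) * (6 * real M powr (ln 3 / ln 4)) + 1"
proof -
  have Q: "Q > 0" using M by linarith
  define z where "z = (\<lambda>n::nat. (int n * P) mod int Q)"
  define J where "J = nat \<lfloor>a * Q\<rfloor>"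
  have J: "real J \<le> a * Q" "a * Q < real J + 1" using a unfolding J_def by (auto; linarith)+
  have "a * Q \<le> 1 * real Q" using a by (intro mult_right_mono) auto
  then have JQ: "J \<le> Q" using J by linarith
  define g where "g = (\<lambda>n. if z n < int J then 1 else 0 :: real)"
  define f where "f = (\<lambda>n. if frac (real n * \<theta>) \<le> a then 1 else 0 :: real)"
  have fg: "f n = g n" if n: "n < M" "z n \<noteq> int J" for n
  proof -
    define e where "e = real n * (\<theta> - P / Q)"
    have e: "0 \<le> e" using ap by (simp add: e_def)
    have "e \<le> real M * (\<theta> - P / Q)" unfolding e_def using n ap by (intro mult_right_mono) auto
    then have e1: "e < 1 / Q" using ap by linarith
    have "real n * \<theta> = real_of_int (int n * P) / Q + e" using Q by (simp add: e_def field_simps)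
    then have fr: "frac (real n * \<theta>) = z n / Q + e"
      using frac_div_int[OF Q e e1, of "int n * P"] by (simp add: z_def)
    show ?thesis
    proof (cases "z n < int J")
      case True
      then have "real_of_int (z n) + 1 \<le> real J" by linarith
      then have "(z n + 1) / Q \<le> a" using Q J by (simp add: field_simps)
      then have "frac (real n * \<theta>) \<le> a" using fr e1 by (simp add: add_divide_distrib)
      then show ?thesis using True by (simp add: f_def g_def)
    next
      case False
      then have "real_of_int (z n) \<ge> real J + 1" using n by linarith
      then have "z n / Q > a" using Q J by (simp add: field_simps)
      then have "\<not> frac (real n * \<theta>) \<le> a" using fr e by simp
      then show ?thesis using False by (simp add: f_def g_def)
    qed
  qed
  have "\<bar>\<Sum>n<M. tm_sign n * (f n - g n)\<bar> \<le> (\<Sum>n<M. \<bar>tm_sign n * (f n - g n)\<bar>)"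
    by (rule sum_abs)
  also have "\<dots> \<le> (\<Sum>n<M. if z n = int J then 1 else 0)"
    using fg by (intro sum_mono) (auto simp: abs_mult f_def g_def)
  also have "\<dots> = real (card {n \<in> {..<M}. z n = int J})"
    by (simp add: sum.If_cases Int_def)
  also have "card {n \<in> {..<M}. z n = int J} \<le> 1"
  proof -
    have "inj_on (\<lambda>n. nat ((int n * P + 0) mod int Q)) {..<Q}"
      using bij_betw_mult_add_mod[OF Q cop, of 0] by (simp add: bij_betw_def)
    then have "n = n'" if "n < Q" "n' < Q" "z n = z n'" for n n'
      using that by (auto simp: z_def inj_on_def)
    then show ?thesis using M by (intro card_le_Suc0_iff_eq[THEN iffD2, folded One_nat_def]) auto
  qed
  finally have 1: "\<bar>\<Sum>n<M. tm_sign n * (f n - g n)\<bar> \<le> 1" by simp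
  have 2: "\<bar>\<Sum>n<M. tm_sign n * g n\<bar> \<le> (3 + 2 * ln Q) * (6 * real M powr (ln 3 / ln 4))"
    unfolding g_def
  proof (rule finite_fourier_bound)
    fix h
    \<comment> \<open>Reduction modulo Q changes the phase by an integer, so the sum is an ordinary
      Thue-Morse sum at the point h P / Q.\<close>
    have "ee (real h * (z n / Q)) = ee (real n * (real h * P / Q))" for n
    proof -
      have "z n = int n * P - (int n * P div int Q) * int Q"
        unfolding z_def by (simp add: minus_div_mult_eq_mod)
      then have zn: "real_of_int (z n) = real n * P - of_int (int n * P div int Q) * real Q" by simp
      have "real n * (real h * P / Q) = real h * (z n / Q) + of_int (int h * (int n * P div int Q))"
        unfolding zn using Q by (simp add: field_simps)
      then show ?thesis by (simp only: ee_add_int)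
    qed
    then have "(\<Sum>n<M. of_real (tm_sign n) * ee (real h * (z n / Q))) = tm_sum M (real h * P / Q)"
      by (simp add: tm_sum_def)
    then show "norm (\<Sum>n<M. of_real (tm_sign n) * ee (real h * (z n / Q))) \<le> 6 * real M powr (ln 3 / ln 4)"
      using norm_tm_sum_bound[OF M(1)] by simp
  qed (use Q JQ in \<open>auto simp: z_def\<close>)
  have "tm_dev \<theta> M a = (\<Sum>n<M. tm_sign n * g n) + (\<Sum>n<M. tm_sign n * (f n - g n))"
    by (simp add: tm_dev_def f_def sum.distrib[symmetric] algebra_simps)
  then show ?thesis using 1 2 by linarith
qed

lemma thue_morse_star_discrepancy_le:
  assumes d: "\<And>a. a \<in> {0..1} \<Longrightarrow> rotation_dev \<theta> 0 (2 * N) a \<le> B"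
    and t: "\<And>a. a \<in> {0..1} \<Longrightarrow> \<bar>tm_dev \<theta> (2 * N) a\<bar> \<le> C"
  shows "real N * star_discrepancy (\<lambda>k. frac (real (thue_morse_integer k) * \<theta>)) N \<le> (B + C) / 2"
proof (rule star_discrepancy_le)
  have half: "\<bar>X\<bar> \<le> (B + C) / 2" if "2 * X = Y + T" "\<bar>Y\<bar> \<le> B" "\<bar>T\<bar> \<le> C" for X Y T :: real
  proof -
    have "\<bar>X\<bar> * 2 \<le> B + C" using that by linarith
    then show ?thesis by simp
  qed
  fix a :: real assume a: "a \<in> {0..1}"
  define f where "f = (\<lambda>n. if frac (real n * \<theta>) \<le> a then 1 else 0 :: real)"
  have "real (card {n \<in> {1..N}. frac (real (thue_morse_integer n) * \<theta>) \<in> {0..a}})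
     = (\<Sum>k=1..N. f (thue_morse_integer k))"
    by (simp add: f_def sum.If_cases Int_def)
  also have "\<dots> = (1/2) * ((\<Sum>n<2*N. f n) + tm_dev \<theta> (2 * N) a)"
    using sum_thue_morse_integer[of f N] by (simp add: tm_dev_def f_def)
  also have "(\<Sum>n<2*N. f n) = real (card {n \<in> {..<2*N}. frac (0 + real n * \<theta>) \<le> a})"
    by (simp add: f_def sum.If_cases Int_def)
  finally have "2 * (real (card {n \<in> {1..N}. frac (real (thue_morse_integer n) * \<theta>) \<in> {0..a}}) - real N * a)
     = (real (card {n \<in> {..<2*N}. frac (0 + real n * \<theta>) \<le> a}) - real (2 * N) * a) + tm_dev \<theta> (2 * N) a"
    by (simp add: algebra_simps)
  then show "\<bar>real (card {n \<in> {1..N}. frac (real (thue_morse_integer n) * \<theta>) \<in> {0..a}}) - real N * a\<bar> \<le> (B + C) / 2"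
    using d[OF a] t[OF a] unfolding rotation_dev_def by (rule half)
qed

lemma ee_frac: "ee (real h * frac x) = ee (real h * x)"
proof -
  have "real h * x = real h * frac x + of_int (int h * \<lfloor>x\<rfloor>)" by (simp add: frac_def algebra_simps)
  then show ?thesis by (simp only: ee_add_int)
qed

text \<open>Along the Thue-Morse integers the exponential sum is half a geometric sum plus half a
  signed sum. The geometric part is bounded uniformly in L, so only the product can grow. It has
  \<open>Suc L\<close> factors because the first 2^L Thue-Morse integers are those below
  2^(L+1).\<close>

lemma thue_morse_star_discrepancy_ge:
  fixes h :: nat
  assumes h: "h \<ge> 1" and irr: "ee (real h * \<theta>) \<noteq> 1"
  shows "2 ^ L * star_discrepancy (\<lambda>k. frac (real (thue_morse_integer k) * \<theta>)) (2 ^ L)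
    \<ge> ((\<Prod>i<Suc L. norm (1 - ee (2 ^ i * (real h * \<theta>)))) - 2 / norm (1 - ee (real h * \<theta>))) / (4 * pi * h)"
proof -
  let ?N = "2 ^ L :: nat"
  let ?x = "\<lambda>k. frac (real (thue_morse_integer k) * \<theta>)"
  define w where "w = ee (real h * \<theta>)"
  define G where "G = (\<Sum>n<2*?N. ee (real n * (real h * \<theta>)))"
  have "(\<Sum>k=1..?N. ee (real h * ?x k)) = (\<Sum>k=1..?N. ee (real (thue_morse_integer k) * (real h * \<theta>)))"
    by (simp add: ee_frac mult.left_commute)
  also have "\<dots> = (1/2) *\<^sub>R (G + tm_sum (2 * ?N) (real h * \<theta>))"
    by (subst sum_thue_morse_integer) (simp add: G_def tm_sum_def scaleR_conv_of_real)
  finally have "norm (G + tm_sum (2 * ?N) (real h * \<theta>)) = 2 * norm (\<Sum>k=1..?N. ee (real h * ?x k))"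
    by simp
  also have "\<dots> \<le> 2 * (2 * pi * h * (real ?N * star_discrepancy ?x ?N))"
    by (intro mult_left_mono koksma h) (auto simp: frac_lt_1 less_imp_le)
  finally have 1: "norm (G + tm_sum (2 * ?N) (real h * \<theta>)) \<le> 4 * pi * h * (2 ^ L * star_discrepancy ?x ?N)"
    by simp
  have "G = (1 - w ^ (2 * ?N)) / (1 - w)"
    using irr by (simp add: G_def w_def ee_of_nat_mult sum_gp_strict)
  then have "norm G \<le> 2 / norm (1 - w)"
    using norm_triangle_ineq4[of 1 "w ^ (2 * ?N)"]
    by (simp add: norm_divide divide_right_mono w_def norm_power)
  moreover have "norm (tm_sum (2 * ?N) (real h * \<theta>)) = (\<Prod>i<Suc L. norm (1 - ee (2 ^ i * (real h * \<theta>))))"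
    using tm_sum_pow2[of "Suc L" "real h * \<theta>"] by (simp add: prod_norm)
  moreover have "norm (tm_sum (2 * ?N) (real h * \<theta>)) \<le> norm (G + tm_sum (2 * ?N) (real h * \<theta>)) + norm G"
    using norm_triangle_ineq4[of "G + tm_sum (2 * ?N) (real h * \<theta>)" G] by simp
  ultimately have "(\<Prod>i<Suc L. norm (1 - ee (2 ^ i * (real h * \<theta>)))) - 2 / norm (1 - w)
      \<le> 4 * pi * h * (2 ^ L * star_discrepancy ?x ?N)"
    using 1 by linarith
  then show ?thesis using h by (simp add: w_def field_simps)
qed

section \<open>Bad approximability of alpha\<close>

text \<open>The pairs \<open>(q i, p i)\<close> are the denominators and numerators of the convergents of \<open>P / Q\<close> for a signed
  continued fraction with entries alternating between \<open>\<plusminus>16\<close> and \<open>\<plusminus>1\<close>; the index is shifted so that \<open>i = 0\<close> is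
  the formal convergent \<open>1 / 0\<close>.\<close>
definition fold_chain :: "nat \<Rightarrow> int \<Rightarrow> int \<Rightarrow> (nat \<Rightarrow> int) \<Rightarrow> (nat \<Rightarrow> int) \<Rightarrow> bool" where
  "fold_chain L Q P q p \<longleftrightarrow> even L \<and> L \<ge> 2 \<and> q 0 = 0 \<and> p 0 = 1 \<and> q 1 = 1 \<and> p 1 = 0 \<and> q L = Q \<and> p L = P \<and>
     (\<forall>i. 1 \<le> i \<and> i < L \<longrightarrow> (\<exists>a. \<bar>a\<bar> = (if odd i then 16 else 1) \<and>
        q (Suc i) = a * q i + q (i - 1) \<and> p (Suc i) = a * p i + p (i - 1)))"

lemma fold_chain_step:
  assumes "fold_chain L Q P q p" "1 \<le> i" "i < L"
  obtains a where "\<bar>a\<bar> = (if odd i then 16 else 1)"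
    "q (Suc i) = a * q i + q (i - 1)" "p (Suc i) = a * p i + p (i - 1)"
  using assms unfolding fold_chain_def by blast

lemma fold_chain_det:
  assumes "fold_chain L Q P q p"
  shows "i < L \<Longrightarrow> \<bar>p i * q (Suc i) - q i * p (Suc i)\<bar> = 1"
proof (induction i)
  case 0
  then show ?case using assms by (simp add: fold_chain_def)
next
  case (Suc i)
  obtain a where a: "q (Suc (Suc i)) = a * q (Suc i) + q i" "p (Suc (Suc i)) = a * p (Suc i) + p i"
    using fold_chain_step[OF assms, of "Suc i"] Suc.prems by auto
  have "p (Suc i) * q (Suc (Suc i)) - q (Suc i) * p (Suc (Suc i)) = - (p i * q (Suc i) - q i * p (Suc i))"
    unfolding a by (simp add: algebra_simps)
  then show ?case using Suc by simp
qed

lemma fold_chain_coprime: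
  assumes "fold_chain L Q P q p" "i < L"
  shows "coprime (p i) (q i)"
proof (rule coprimeI)
  fix c assume "c dvd p i" "c dvd q i"
  then have "c dvd \<bar>p i * q (Suc i) - q i * p (Suc i)\<bar>" by simp
  then show "is_unit c" using fold_chain_det[OF assms] by simp
qed

text \<open>The second half of the new chain is the reversed old chain, moved by the unipotent map
  \<open>(q, p) \<mapsto> (q, p) + (p Q - q P) (Q, P)\<close>, which fixes the meeting point \<open>(Q, P)\<close>.\<close>
lemma fold_chain_fold:
  assumes ch: "fold_chain L Q P q p"
  shows "\<exists>q' p'. fold_chain (2 * L) (Q ^ 2) (P * Q + 1) q' p'"
proof -
  define D where "D = (\<lambda>j. p j * Q - q j * P)"
  define q' where "q' = (\<lambda>i. if i \<le> L then q i else q (2 * L - i) + D (2 * L - i) * Q)"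
  define p' where "p' = (\<lambda>i. if i \<le> L then p i else p (2 * L - i) + D (2 * L - i) * P)"
  have L: "even L" "L \<ge> 2" and QP: "q L = Q" "p L = P" and init: "q 0 = 0" "p 0 = 1" "q 1 = 1" "p 1 = 0"
    using ch by (auto simp: fold_chain_def)
  have DL: "D L = 0" by (simp add: D_def QP)
  have refl: "q' (2 * L - j) = q j + D j * Q \<and> p' (2 * L - j) = p j + D j * P" if "j \<le> L" for j
    using that DL by (cases "j = L") (auto simp: q'_def p'_def)
  have step: "\<exists>a. \<bar>a\<bar> = (if odd i then 16 else 1) \<and>
        q' (Suc i) = a * q' i + q' (i - 1) \<and> p' (Suc i) = a * p' i + p' (i - 1)"
    if i: "1 \<le> i" "i < 2 * L" for i
  proof -
    consider "i < L" | "i = L" | "i > L" by linarith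
    then show ?thesis
    proof cases
      case 1
      obtain a where a: "\<bar>a\<bar> = (if odd i then 16 else 1)"
          "q (Suc i) = a * q i + q (i - 1)" "p (Suc i) = a * p i + p (i - 1)"
        using fold_chain_step[OF ch i(1) 1] by auto
      have "Suc i \<le> L" "i \<le> L" "i - 1 \<le> L" using 1 by auto
      then show ?thesis using a by (intro exI[of _ a]) (simp add: q'_def p'_def)
    next
      case 2
      \<comment> \<open>The entry inserted at the fold is the determinant of the last two
        convergents. It is 1 or -1, as required at the even index L.\<close>
      have "\<bar>D (L - 1)\<bar> = 1"
        using fold_chain_det[OF ch, of "L - 1"] L QP by (simp add: D_def)
      moreover have "q' (Suc L) = D (L - 1) * q' L + q' (L - 1)" "p' (Suc L) = D (L - 1) * p' L + p' (L - 1)"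
        using refl[of "L - 1"] L QP by (auto simp: q'_def p'_def)
      ultimately show ?thesis using 2 L by auto
    next
      case 3
      define j where "j = 2 * L - i"
      have j: "1 \<le> j" "j < L" "i = 2 * L - j" "odd i = odd j" using 3 i by (auto simp: j_def)
      obtain a where a: "\<bar>a\<bar> = (if odd j then 16 else 1)"
          "q (Suc j) = a * q j + q (j - 1)" "p (Suc j) = a * p j + p (j - 1)"
        using fold_chain_step[OF ch j(1,2)] by auto
      have Da: "D (Suc j) = a * D j + D (j - 1)"
        unfolding D_def a by (simp add: algebra_simps)
      have "Suc i = 2 * L - (j - 1)" "i - 1 = 2 * L - Suc j" using j by auto
      \<comment> \<open>Reading the recurrence backwards changes the sign of the entry; reflection
        at the even number 2 L keeps the parity of its index.\<close>
      then have "q' (Suc i) = (- a) * q' i + q' (i - 1)" "p' (Suc i) = (- a) * p' i + p' (i - 1)"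
        using refl[of "j - 1"] refl[of j] refl[of "Suc j"] j Da a(2,3) by (auto simp: algebra_simps)
      then show ?thesis using a(1) j(4) by (intro exI[of _ "-a"]) auto
    qed
  qed
  \<comment> \<open>The image of the formal convergent (0, 1): its quotient is P/Q + 1/Q^2, exactly
    one further term of the series for beta.\<close>
  have "q' (2 * L) = Q ^ 2" "p' (2 * L) = P * Q + 1"
    using refl[of 0] init by (auto simp: D_def power2_eq_square)
  moreover have "q' 0 = 0" "p' 0 = 1" "q' 1 = 1" "p' 1 = 0" using L init by (auto simp: q'_def p'_def)
  ultimately have "fold_chain (2 * L) (Q ^ 2) (P * Q + 1) q' p'"
    using L step unfolding fold_chain_def by auto
  then show ?thesis by blast
qed

text \<open>With signed entries a step by 1 or -1 could cause cancellation. But after a step by 16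
  or -16 the previous denominator is at most 1/14 of the current one, so the following step by 1 or
  -1 changes the size by less than a factor 2. This in turn keeps the next large step between 16 - 2
  and 16 + 2.\<close>

lemma fold_chain_growth:
  assumes ch: "fold_chain L Q P q p"
  shows "1 \<le> i \<Longrightarrow> i < L \<Longrightarrow> q i \<noteq> 0 \<and>
    (if odd i then 14 * \<bar>q i\<bar> \<le> \<bar>q (Suc i)\<bar> \<and> \<bar>q (Suc i)\<bar> \<le> 18 * \<bar>q i\<bar>
     else \<bar>q i\<bar> \<le> 2 * \<bar>q (Suc i)\<bar> \<and> \<bar>q (Suc i)\<bar> \<le> 2 * \<bar>q i\<bar>)"
proof (induction i rule: nat_induct_at_least)
  case base
  obtain a where "\<bar>a\<bar> = 16" "q (Suc 1) = a * q 1 + q 0"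
    using fold_chain_step[OF ch, of 1] base by auto
  moreover have "q 0 = 0" "q 1 = 1" using ch by (auto simp: fold_chain_def)
  ultimately show ?case by simp
next
  case (Suc i)
  obtain a where a: "\<bar>a\<bar> = (if odd (Suc i) then 16 else 1)" "q (Suc (Suc i)) = a * q (Suc i) + q i"
    using fold_chain_step[OF ch, of "Suc i"] Suc.prems by auto
  show ?case
  proof (cases "odd i")
    case True
    then have "a = 1 \<or> a = -1" using a(1) by auto
    then have "q (Suc (Suc i)) = q (Suc i) + q i \<or> q (Suc (Suc i)) = - q (Suc i) + q i" using a(2) by auto
    moreover have *: "q i \<noteq> 0" "14 * \<bar>q i\<bar> \<le> \<bar>q (Suc i)\<bar>" using Suc True by auto
    ultimately have "\<bar>q (Suc i)\<bar> \<le> 2 * \<bar>q (Suc (Suc i))\<bar> \<and> \<bar>q (Suc (Suc i))\<bar> \<le> 2 * \<bar>q (Suc i)\<bar>"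
      by (elim disjE; intro conjI; linarith)
    moreover have "q (Suc i) \<noteq> 0" using * by auto
    ultimately show ?thesis using True by simp
  next
    case False
    then have "a = 16 \<or> a = -16" using a(1) by auto
    then have "q (Suc (Suc i)) = 16 * q (Suc i) + q i \<or> q (Suc (Suc i)) = - 16 * q (Suc i) + q i"
      using a(2) by auto
    moreover have *: "q i \<noteq> 0" "\<bar>q i\<bar> \<le> 2 * \<bar>q (Suc i)\<bar>" using Suc False by auto
    ultimately have "14 * \<bar>q (Suc i)\<bar> \<le> \<bar>q (Suc (Suc i))\<bar> \<and> \<bar>q (Suc (Suc i))\<bar> \<le> 18 * \<bar>q (Suc i)\<bar>"
      by (elim disjE; intro conjI; linarith)
    moreover have "q (Suc i) \<noteq> 0" using * by auto
    ultimately show ?thesis using False by simp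
  qed
qed

lemma fold_chain_nonzero:
  assumes ch: "fold_chain L Q P q p" and "Q \<noteq> 0" "1 \<le> i" "i \<le> L"
  shows "q i \<noteq> 0"
  using fold_chain_growth[OF ch, of i] assms by (cases "i = L") (auto simp: fold_chain_def)

lemma fold_chain_diff:
  assumes ch: "fold_chain L Q P q p" and "Q \<noteq> 0" "1 \<le> i" "i < L"
  shows "\<bar>p i / q i - p (Suc i) / q (Suc i)\<bar> = 1 / (\<bar>real_of_int (q i)\<bar> * \<bar>real_of_int (q (Suc i))\<bar>)"
proof -
  have nz: "q i \<noteq> 0" "q (Suc i) \<noteq> 0" using fold_chain_nonzero[OF ch] assms by auto
  have "p i / q i - p (Suc i) / q (Suc i) = real_of_int (p i * q (Suc i) - q i * p (Suc i)) / (q i * q (Suc i))"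
    using nz by (simp add: field_simps)
  moreover have "\<bar>real_of_int (p i * q (Suc i) - q i * p (Suc i))\<bar> = 1"
    using fold_chain_det[OF ch assms(4)] by (metis of_int_abs of_int_1)
  ultimately show ?thesis by (simp only: abs_divide of_int_mult abs_mult)
qed

text \<open>Backward induction from P/Q in double steps. Two steps enlarge the denominator at least
  7 times, so the differences of neighbouring convergents form a dominated geometric sum: 2 + 2/7 +
  4/49 <= 4.\<close>

lemma fold_chain_error:
  assumes ch: "fold_chain L Q P q p" and Q: "Q \<noteq> 0"
  shows "2 * d < L \<Longrightarrow> \<bar>p (L - 2 * d) / q (L - 2 * d) - P / Q\<bar> \<le> 4 / (real_of_int (q (L - 2 * d)))^2"
proof (induction d)
  case 0
  then show ?case using ch by (simp add: fold_chain_def)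
next
  case (Suc d)
  define i where "i = L - 2 * Suc d"
  have L: "even L" using ch by (simp add: fold_chain_def)
  have i: "L - 2 * d = Suc (Suc i)" "i \<ge> 1" "Suc i < L" "even i" using Suc.prems L by (auto simp: i_def)
  define a b c where "a = \<bar>real_of_int (q i)\<bar>" and "b = \<bar>real_of_int (q (Suc i))\<bar>" and "c = \<bar>real_of_int (q (Suc (Suc i)))\<bar>"
  have a0: "a > 0" using fold_chain_nonzero[OF ch Q, of i] i by (simp add: a_def)
  have "\<bar>q i\<bar> \<le> 2 * \<bar>q (Suc i)\<bar>" using fold_chain_growth[OF ch, of i] i by simp
  then have ab: "b \<ge> a / 2" unfolding a_def b_def by linarith
  have "14 * \<bar>q (Suc i)\<bar> \<le> \<bar>q (Suc (Suc i))\<bar>" using fold_chain_growth[OF ch, of "Suc i"] i by simp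
  then have "c \<ge> 14 * b" unfolding c_def b_def by linarith
  then have ac: "c \<ge> 7 * a" using ab by linarith
  have "1 / (a * b) \<le> 1 / (a * (a / 2))"
    using a0 ab by (intro divide_left_mono mult_left_mono mult_pos_pos) auto
  moreover have "1 / (b * c) \<le> 1 / ((a / 2) * (7 * a))"
    using a0 ab ac by (intro divide_left_mono mult_mono mult_pos_pos) auto
  moreover have "4 / c^2 \<le> 4 / (7 * a)^2"
    using a0 ac by (intro divide_left_mono power_mono mult_pos_pos) auto
  ultimately have "1 / (a * b) + 1 / (b * c) + 4 / c^2 \<le> 2 / a^2 + 2 / 7 / a^2 + 4 / 49 / a^2"
    by (simp add: power2_eq_square)
  also have "\<dots> \<le> 4 / a^2" using a0 by (simp add: field_simps)
  finally have 1: "1 / (a * b) + 1 / (b * c) + 4 / c^2 \<le> 4 / a^2" .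
  have "\<bar>p i / q i - p (Suc i) / q (Suc i)\<bar> = 1 / (a * b)"
    using fold_chain_diff[OF ch Q, of i] i by (simp add: a_def b_def)
  moreover have "\<bar>p (Suc i) / q (Suc i) - p (Suc (Suc i)) / q (Suc (Suc i))\<bar> = 1 / (b * c)"
    using fold_chain_diff[OF ch Q, of "Suc i"] i by (simp add: b_def c_def)
  moreover have "\<bar>p (Suc (Suc i)) / q (Suc (Suc i)) - P / Q\<bar> \<le> 4 / c^2"
    using Suc.IH Suc.prems i by (simp add: c_def)
  ultimately have "\<bar>p i / q i - P / Q\<bar> \<le> 4 / a^2" using 1 by linarith
  then show ?case by (simp add: i_def a_def)
qed

section \<open>Partial sums of beta and their convergents\<close>

definition bden :: "nat \<Rightarrow> nat" where "bden k = 4 ^ (2 ^ Suc k)"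

fun bnum :: "nat \<Rightarrow> nat" where
  "bnum 0 = 1" | "bnum (Suc k) = bnum k * bden k + 1"

definition beta :: real where "beta = (\<Sum>k. 1 / 4 ^ (2 ^ Suc k))"

lemma alpha_beta: "alpha = 2 / 3 + beta" by (simp add: alpha_def beta_def)

lemma bden_Suc: "bden (Suc k) = bden k ^ 2"
  by (simp add: bden_def power_mult[symmetric] mult.commute)

text \<open>The first partial sum 1/16 has the single entry 16, the origin of the large entries;
  each fold appends the next term of the series.\<close>

lemma fold_chain_beta: "\<exists>q p. fold_chain (2 ^ Suc k) (int (bden k)) (int (bnum k)) q p"
proof (induction k)
  case 0
  have "fold_chain 2 16 1 (\<lambda>i. if i = 0 then 0 else if i = 1 then 1 else 16) (\<lambda>i. if i = 1 then 0 else 1)"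
  proof -
    have "i = 1" if "1 \<le> i" "i < 2" for i :: nat using that by linarith
    then show ?thesis unfolding fold_chain_def by (auto intro!: exI[of _ "16::int"])
  qed
  then show ?case by (auto simp: bden_def)
next
  case (Suc k)
  then obtain q p where "fold_chain (2 ^ Suc k) (int (bden k)) (int (bnum k)) q p" by blast
  from fold_chain_fold[OF this] show ?case by (simp add: bden_Suc add.commute)
qed

lemma bnum_div_bden: "bnum k / bden k = (\<Sum>j\<le>k. 1 / 4 ^ (2 ^ Suc j))"
proof (induction k)
  case (Suc k)
  have "real (bnum (Suc k)) / bden (Suc k) = bnum k / bden k + 1 / bden (Suc k)"
  proof -
    have "real (bden k) > 0" by (simp add: bden_def)
    then show ?thesis by (simp add: bden_Suc power2_eq_square field_simps)
  qed
  then show ?case using Suc by (simp add: bden_def)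
qed (simp add: bden_def)

lemma beta_term_le: "1 / 4 ^ (2 ^ Suc (j + Suc k)) \<le> (1 / (real (bden k))^2) * (1 / 4) ^ j"
proof -
  have "2 ^ Suc (Suc k) + j \<le> (2::nat) ^ Suc (j + Suc k)"
  proof (induction j)
    case (Suc j)
    have "2 ^ Suc (Suc k) + Suc j \<le> 2 ^ Suc (j + Suc k) + (1::nat)" using Suc by simp
    also have "\<dots> \<le> 2 ^ Suc (j + Suc k) + 2 ^ Suc (j + Suc k)" by (intro add_mono) simp_all
    finally show ?case by simp
  qed simp
  then have "(4::real) ^ (2 ^ Suc (Suc k) + j) \<le> 4 ^ (2 ^ Suc (j + Suc k))" by (intro power_increasing) auto
  then have "1 / (4::real) ^ (2 ^ Suc (j + Suc k)) \<le> 1 / 4 ^ (2 ^ Suc (Suc k) + j)"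
    by (intro divide_left_mono) auto
  also have "\<dots> = (1 / (real (bden k))^2) * (1 / 4) ^ j"
    by (simp add: power_add bden_def power_divide power_mult[symmetric] mult.commute)
  finally show ?thesis .
qed

lemma summable_beta: "summable (\<lambda>k. 1 / 4 ^ (2 ^ Suc k) :: real)"
proof -
  have "summable (\<lambda>j. (1 / (real (bden 0))^2) * (1 / 4) ^ j)"
    by (intro summable_mult summable_geometric) simp
  then have "summable (\<lambda>j. 1 / 4 ^ (2 ^ Suc (j + Suc 0)) :: real)"
    by (rule summable_comparison_test'[where N = 0]) (use beta_term_le[of _ 0] in simp)
  then show ?thesis using summable_iff_shift[of "\<lambda>k. 1 / 4 ^ (2 ^ Suc k) :: real" "Suc 0"] by simp
qed

text \<open>The tail is dominated by a geometric series of ratio 1/4 starting at 1/(bden k)^2.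
  Positivity matters later, since \<open>tm_dev_bound\<close> asks for approximants from
  below.\<close>

lemma beta_bounds: "0 < beta - bnum k / bden k" "beta - bnum k / bden k \<le> 2 / (real (bden k))^2"
proof -
  have "beta = (\<Sum>j. 1 / 4 ^ (2 ^ Suc (j + Suc k))) + (\<Sum>j<Suc k. 1 / 4 ^ (2 ^ Suc j))"
    unfolding beta_def by (rule suminf_split_initial_segment[OF summable_beta])
  then have eq: "beta - bnum k / bden k = (\<Sum>j. 1 / 4 ^ (2 ^ Suc (j + Suc k)))"
    unfolding bnum_div_bden by (simp only: lessThan_Suc_atMost add_diff_cancel_right')
  have sm: "summable (\<lambda>j. 1 / 4 ^ (2 ^ Suc (j + Suc k)) :: real)"
    using summable_beta by (subst summable_iff_shift)
  show "0 < beta - bnum k / bden k" unfolding eq by (intro suminf_pos sm) simp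
  have "(\<Sum>j. 1 / 4 ^ (2 ^ Suc (j + Suc k))) \<le> (\<Sum>j. (1 / (real (bden k))^2) * (1 / 4) ^ j)"
    by (intro suminf_le sm beta_term_le summable_mult summable_geometric) simp
  also have "\<dots> = (1 / (real (bden k))^2) * (4 / 3)"
    by (subst suminf_mult) (auto simp: suminf_geometric)
  also have "\<dots> \<le> (1 / (real (bden k))^2) * 2" by (intro mult_left_mono) auto
  also have "\<dots> = 2 / (real (bden k))^2" by simp
  finally show "beta - bnum k / bden k \<le> 2 / (real (bden k))^2" unfolding eq .
qed

lemma bden_unbounded: "\<exists>k. bden k \<ge> n"
proof -
  have "n \<le> 2 ^ n" by (simp add: less_imp_le)
  also have "\<dots> \<le> 4 ^ n" by (intro power_mono) auto
  also have "\<dots> \<le> 4 ^ (2 ^ Suc n)"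
    by (intro power_increasing) (auto intro: order_trans[OF less_imp_le[OF less_exp]])
  finally show ?thesis unfolding bden_def by blast
qed

text \<open>Take the first even index whose denominator reaches X. The preceding even-indexed
  denominator is below X (at the start, \<open>q 1 = 1\<close> takes over), and a double step
  multiplies by at most 2 * 18 = 36. The error is 4/q^2 from the chain plus 2/q^2 from the tail of
  the series.\<close>

lemma beta_approx:
  assumes "X \<ge> (1::nat)"
  shows "\<exists>(q::int) p. coprime p q \<and> int X \<le> \<bar>q\<bar> \<and> \<bar>q\<bar> \<le> 36 * int X \<and> \<bar>beta - p / q\<bar> \<le> 6 / (real_of_int q)^2"
proof -
  \<comment> \<open>The final denominator lies beyond the range searched, so the selected index is
    strictly inside the chain.\<close>
  obtain k where k: "bden k \<ge> 36 * X + 1" using bden_unbounded by blast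
  define Q P where "Q = int (bden k)" and "P = int (bnum k)"
  obtain q p where ch: "fold_chain (2 ^ Suc k) Q P q p"
    using fold_chain_beta[of k] by (auto simp: Q_def P_def)
  have Q0: "Q > 36 * int X" using k by (simp add: Q_def)
  have qL: "q (2 ^ Suc k) = Q" using ch by (simp add: fold_chain_def)
  define j where "j = (LEAST j. int X \<le> \<bar>q (2 * Suc j)\<bar>)"
  define i where "i = 2 * Suc j"
  have "int X \<le> \<bar>q (2 * Suc (2 ^ k - 1))\<bar>" using qL Q0 by simp
  then have j: "int X \<le> \<bar>q (2 * Suc j)\<bar>" "j \<le> 2 ^ k - 1"
    unfolding j_def by (rule LeastI, rule Least_le)
  have iL: "i \<le> 2 ^ Suc k" using j(2) unfolding i_def
    by (metis One_nat_def Suc_le_mono Suc_pred mult_le_mono2 pos2 power_Suc zero_less_power)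
  have up: "\<bar>q i\<bar> \<le> 36 * int X"
  proof -
    have "\<bar>q (Suc (i - 1))\<bar> \<le> 18 * \<bar>q (i - 1)\<bar>"
      using fold_chain_growth[OF ch, of "i - 1"] iL by (simp add: i_def)
    then have 1: "\<bar>q i\<bar> \<le> 18 * \<bar>q (i - 1)\<bar>" by (simp add: i_def)
    have "\<bar>q (i - 1)\<bar> \<le> 2 * int X"
    proof (cases "j = 0")
      case True
      then show ?thesis using ch assms by (simp add: i_def fold_chain_def)
    next
      case False
      have "j - 1 < j" using False by simp
      then have "\<not> int X \<le> \<bar>q (2 * Suc (j - 1))\<bar>" unfolding j_def by (rule not_less_Least)
      then have "\<bar>q (i - 2)\<bar> < int X" using False by (simp add: i_def)
      moreover have "\<bar>q (Suc (i - 2))\<bar> \<le> 2 * \<bar>q (i - 2)\<bar>"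
        using fold_chain_growth[OF ch, of "i - 2"] iL False by (simp add: i_def)
      moreover have "Suc (i - 2) = i - 1" by (simp add: i_def)
      ultimately show ?thesis by simp
    qed
    then show ?thesis using 1 by linarith
  qed
  have "i \<noteq> 2 ^ Suc k" using up qL Q0 by (metis abs_ge_self linorder_not_less order.trans order.strict_trans2)
  then have iL': "i < 2 ^ Suc k" using iL by simp
  define d where "d = 2 ^ k - Suc j"
  have "2 ^ Suc k - 2 * d = i" "2 * d < 2 ^ Suc k" using iL by (auto simp: d_def i_def)
  then have e1: "\<bar>p i / q i - P / Q\<bar> \<le> 4 / (real_of_int (q i))^2"
    using fold_chain_error[OF ch, of d] Q0 by simp
  have "\<bar>beta - P / Q\<bar> \<le> 2 / (real_of_int Q)^2"
    using beta_bounds[of k] by (simp add: P_def Q_def)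
  also have "\<dots> \<le> 2 / (real_of_int (q i))^2"
  proof (intro divide_left_mono)
    have "\<bar>q i\<bar> \<le> \<bar>Q\<bar>" using up Q0 by linarith
    then show "(real_of_int (q i))^2 \<le> (real_of_int Q)^2"
      unfolding abs_le_square_iff[symmetric] by linarith
    show "0 < (real_of_int Q)^2 * (real_of_int (q i))^2"
      using Q0 fold_chain_nonzero[OF ch, of i] iL by (simp add: i_def)
  qed simp
  finally have "\<bar>beta - p i / q i\<bar> \<le> 6 / (real_of_int (q i))^2"
    using e1 by (simp add: abs_le_iff field_simps)
  moreover have "coprime (p i) (q i)" by (rule fold_chain_coprime[OF ch iL'])
  moreover have "int X \<le> \<bar>q i\<bar>" using j by (simp add: i_def)
  ultimately show ?thesis using up by blast
qed

text \<open>A convergent p0/q0 with |q0| between 12 q and 432 q differs from p/q, because it is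
  reduced and |q0| > q; hence q p0/q0 is at least 1/|q0| away from p. The scale 12 q makes the
  approximation error at most half of that, and 864 = 2 * 432.\<close>

lemma beta_badly_approximable:
  assumes "q \<ge> (1::nat)"
  shows "\<bar>real q * beta - of_int p\<bar> \<ge> (1 / 864) / real q"
proof -
  obtain q0 p0 :: int where c: "coprime p0 q0" "int (12 * q) \<le> \<bar>q0\<bar>" "\<bar>q0\<bar> \<le> 36 * int (12 * q)"
      "\<bar>beta - p0 / q0\<bar> \<le> 6 / (real_of_int q0)^2"
    using beta_approx[of "12 * q"] assms by auto
  have q0: "q0 \<noteq> 0" using c assms by auto
  define A where "A = \<bar>real_of_int q0\<bar>"
  have A: "A > 0" "12 * real q \<le> A" "A \<le> 432 * real q" using c(2,3) q0 unfolding A_def by linarith+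
  have "int q * p0 - p * q0 \<noteq> 0"
  proof
    assume "int q * p0 - p * q0 = 0"
    then have "q0 dvd int q * p0" by (metis dvd_triv_right eq_iff_diff_eq_0)
    then have "q0 dvd int q" using c(1) by (simp add: coprime_commute coprime_dvd_mult_left_iff)
    then have "\<bar>q0\<bar> \<le> int q" using assms zdvd_imp_le[of "\<bar>q0\<bar>" "int q"] by simp
    then show False using c(2) assms by simp
  qed
  then have "1 \<le> \<bar>real_of_int (int q * p0 - p * q0)\<bar>" by linarith
  then have "1 / A \<le> \<bar>real_of_int (int q * p0 - p * q0)\<bar> / A" using A by (intro divide_right_mono) auto
  also have "\<dots> = \<bar>real q * (p0 / q0) - p\<bar>"
    unfolding A_def abs_divide[symmetric] using q0 by (simp add: field_simps)
  finally have 1: "1 / A \<le> \<bar>real q * (p0 / q0) - p\<bar>" .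
  have "\<bar>real q * beta - real q * (p0 / q0)\<bar> = real q * \<bar>beta - p0 / q0\<bar>"
    by (simp only: abs_mult abs_of_nat flip: right_diff_distrib)
  also have "\<dots> \<le> real q * (6 / A^2)" using c(4) by (intro mult_left_mono) (auto simp: A_def)
  also have "\<dots> \<le> 1 / (2 * A)" using A by (simp add: field_simps power2_eq_square)
  finally have "\<bar>real q * beta - real q * (p0 / q0)\<bar> \<le> 1 / (2 * A)" .
  moreover have "u - v \<le> \<bar>x - z\<bar>" if "u \<le> \<bar>y - z\<bar>" "\<bar>x - y\<bar> \<le> v" for u v x y z :: real
    using that by linarith
  ultimately have "\<bar>real q * beta - of_int p\<bar> \<ge> 1 / A - 1 / (2 * A)" using 1 by blast
  moreover have "1 / A - 1 / (2 * A) = 1 / (2 * A)" by simp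
  moreover have "1 / (2 * A) \<ge> (1 / 864) / real q" using A assms by (simp add: field_simps)
  ultimately show ?thesis by linarith
qed

text \<open>Multiplying by 3 makes the summand 2/3 integral and costs a factor 9: 3 from the larger
  denominator, 3 from the scaling of the error.\<close>

lemma alpha_badly_approximable:
  assumes "q \<ge> (1::nat)"
  shows "\<bar>real q * alpha - of_int p\<bar> \<ge> (1 / 7776) / real q"
proof -
  have "(1 / 864) / real (3 * q) \<le> \<bar>real (3 * q) * beta - of_int (3 * p - 2 * int q)\<bar>"
    using assms by (intro beta_badly_approximable) simp
  also have "real (3 * q) * beta - of_int (3 * p - 2 * int q) = 3 * (real q * alpha - of_int p)"
    by (simp add: alpha_beta algebra_simps)
  finally show ?thesis by (simp add: abs_mult)
qed

section \<open>Irrationality exponent of gamma\<close>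

lemma bit_double [simp]: "x + x = (0 :: bit)"
  by (cases x) simp_all

lemma bit_mult_self: "x * x = (x :: bit)"
  by (cases x) simp_all

lemma of_int_bit_eq_0_iff: "(of_int x :: bit) = 0 \<longleftrightarrow> even x"
proof (cases "even x")
  case False
  then obtain k where "x = 2 * k + 1" by (elim oddE)
  then show ?thesis by simp
qed (auto elim!: evenE)

text \<open>In characteristic two the terms i and m - i cancel, so only a central term survives.
  Applied to f_i f_(m-i) this yields the Frobenius identity f(X)^2 = f(X^2).\<close>

lemma sum_palindrome_bit:
  fixes g :: "nat \<Rightarrow> bit"
  assumes "\<And>i. i \<le> m \<Longrightarrow> g (m - i) = g i"
  shows "(\<Sum>i=0..m. g i) = (if even m then g (m div 2) else 0)"
proof -
  define h where "h = (m + 1) div 2"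
  have "(\<Sum>i\<in>{m - h<..m}. g i) = (\<Sum>i\<in>{..<h}. g i)"
    by (rule sum.reindex_bij_witness[where i = "\<lambda>i. m - i" and j = "\<lambda>i. m - i"])
      (use assms in \<open>auto simp: h_def\<close>)
  then have z: "(\<Sum>i\<in>{m - h<..m}. g i) + (\<Sum>i\<in>{..<h}. g i) = 0" by simp
  show ?thesis
  proof (cases "even m")
    case True
    then obtain n where n: "m = 2 * n" by blast
    have "{0..m} = insert n ({m - h<..m} \<union> {..<h})" by (auto simp: n h_def)
    moreover have "n \<notin> {m - h<..m} \<union> {..<h}" "{m - h<..m} \<inter> {..<h} = {}" by (auto simp: n h_def)
    ultimately have "(\<Sum>i=0..m. g i) = g n + ((\<Sum>i\<in>{m - h<..m}. g i) + (\<Sum>i\<in>{..<h}. g i))"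
      by (simp add: sum.union_disjoint)
    then show ?thesis using z by (simp add: n)
  next
    case False
    then obtain n where n: "m = 2 * n + 1" using oddE by blast
    have "{0..m} = {m - h<..m} \<union> {..<h}" by (auto simp: n h_def)
    moreover have "{m - h<..m} \<inter> {..<h} = {}" by (auto simp: n h_def)
    ultimately have "(\<Sum>i=0..m. g i) = (\<Sum>i\<in>{m - h<..m}. g i) + (\<Sum>i\<in>{..<h}. g i)"
      by (simp add: sum.union_disjoint)
    then show ?thesis using z False by simp
  qed
qed

lemma fps_square_nth_bit: "(f ^ 2) $ m = (if even m then f $ (m div 2) else (0 :: bit))"
proof -
  have "(f ^ 2) $ m = (\<Sum>i=0..m. f $ i * f $ (m - i))"
    by (simp add: power2_eq_square fps_mult_nth)
  also have "\<dots> = (if even m then f $ (m div 2) * f $ (m - m div 2) else 0)"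
    by (rule sum_palindrome_bit) (simp add: mult.commute)
  also have "even m \<Longrightarrow> m - m div 2 = m div 2" by auto
  then have "(if even m then f $ (m div 2) * f $ (m - m div 2) else 0) = (if even m then f $ (m div 2) else 0)"
    by (simp add: bit_mult_self)
  finally show ?thesis .
qed

text \<open>Polymorphic because the same series is needed over \<open>int\<close> and, reduced
  modulo 2, over \<open>bit\<close>.\<close>

definition tm_fps :: "'a::comm_ring_1 fps" where
  "tm_fps = Abs_fps (\<lambda>n. of_nat (thue_morse n))"

text \<open>Modulo 2 the rules for t_(2n) and t_(2n+1) read F(X) = (1 + X) F(X^2) + X / (1 + X^2).
  By Frobenius F(X^2) = F(X)^2 and 1 + X^2 = (1 + X)^2; clearing the denominator gives the equation.
  \<open>H\<close> is the series X / (1 + X^2), with coefficient 1 at the odd indices.\<close>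

lemma tm_fps_quadratic:
  "(1 + fps_X) ^ 3 * tm_fps ^ 2 + (1 + fps_X) ^ 2 * tm_fps + fps_X = (0 :: bit fps)"
proof -
  define F :: "bit fps" where "F = tm_fps"
  define H where "H = (1 + fps_X) * F ^ 2 + F"
  have H: "H $ n = (if odd n then 1 else 0)" for n
  proof (cases n)
    case 0
    then show ?thesis by (simp add: H_def F_def tm_fps_def fps_square_nth_bit)
  next
    case (Suc m)
    have X: "(fps_X * F ^ 2) $ Suc m = (F ^ 2) $ m" by simp
    have e: "H $ n = (F ^ 2) $ Suc m + (F ^ 2) $ m + F $ Suc m"
      unfolding H_def Suc distrib_right by (simp only: fps_add_nth mult_1_left X)
    show ?thesis
    proof (cases "even m")
      case True
      then obtain j where j: "m = 2 * j" by blast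
      have "thue_morse j = 0 \<or> thue_morse j = 1" by (rule thue_morse_cases)
      then show ?thesis unfolding e unfolding Suc
        by (auto simp: fps_square_nth_bit F_def tm_fps_def j)
    next
      case False
      then obtain j where j: "m = 2 * j + 1" using oddE by blast
      have "thue_morse (Suc (Suc (2 * j))) = thue_morse (Suc j)"
        using thue_morse_double[of "Suc j"] by simp
      then show ?thesis unfolding e unfolding Suc
        by (simp add: fps_square_nth_bit F_def tm_fps_def j)
    qed
  qed
  have two: "(2 :: bit fps) = 0"
    by (rule fps_ext) (simp add: numeral_fps_const)
  have "(1 + fps_X ^ 2) * H + fps_X = 0"
  proof (rule fps_ext)
    fix n
    have "((1 + fps_X ^ 2) * H + fps_X) $ n = H $ n + (if n < 2 then 0 else H $ (n - 2)) + (if n = 1 then 1 else 0)"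
      by (simp add: distrib_right fps_X_power_mult_nth)
    also have "\<dots> = 0" by (auto simp: H elim: oddE)
    finally show "((1 + fps_X ^ 2) * H + fps_X) $ n = 0 $ n" by simp
  qed
  moreover have "(1 + fps_X) ^ 2 = (1 + fps_X ^ 2 :: bit fps)"
    using two by (simp add: power2_sum)
  ultimately have "(1 + fps_X) ^ 2 * H + fps_X = 0" by (simp only:)
  then show ?thesis
    unfolding H_def F_def distrib_left[of _ "_ * _"] by (simp only: power2_eq_square power3_eq_cube mult.assoc)
qed

text \<open>An Eisenstein argument at the point 1, where l vanishes: evaluation forces l to divide
  Q, and after cancelling l also P. Dividing both by l gives a smaller solution of the same
  equation.\<close>

lemma binary_form_descent:
  fixes P Q :: "bit poly"
  defines "l \<equiv> [:1, 1:]"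
  assumes "l * P ^ 2 + l * P * Q + [:0, 1:] * Q ^ 2 = 0"
  shows "P = 0 \<and> Q = 0"
  using assms(2)
proof (induction "degree Q" arbitrary: P Q rule: less_induct)
  case less
  have l0: "l \<noteq> 0" by (simp add: l_def)
  have l1: "poly l 1 = 0" by (simp add: l_def)
  have dvd: "\<exists>R'. R = l * R'" if "poly R 1 = 0" for R
  proof -
    have "[:- 1, 1:] dvd R" using that by (simp only: poly_eq_0_iff_dvd)
    moreover have "[:- 1, 1:] = l" by (simp add: l_def)
    ultimately show ?thesis by (auto elim: dvdE)
  qed
  show ?case
  proof (cases "Q = 0")
    case True
    then show ?thesis using less.prems l0 by simp
  next
    case False
    have "poly (l * P ^ 2 + l * P * Q + [:0, 1:] * Q ^ 2) 1 = 0" using less.prems by simp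
    then have "poly Q 1 = 0" using l1 by simp
    then obtain Q' where Q': "Q = l * Q'" using dvd by blast
    have "l * (P ^ 2 + l * P * Q' + [:0, 1:] * l * Q' ^ 2) = 0"
      using less.prems unfolding Q' by (simp only: power2_eq_square algebra_simps)
    then have P: "P ^ 2 + l * P * Q' + [:0, 1:] * l * Q' ^ 2 = 0" using l0 by simp
    then have "poly (P ^ 2 + l * P * Q' + [:0, 1:] * l * Q' ^ 2) 1 = 0" by simp
    then have "poly P 1 = 0" using l1 by simp
    then obtain P' where P': "P = l * P'" using dvd by blast
    have "l * (l * P' ^ 2 + l * P' * Q' + [:0, 1:] * Q' ^ 2) = 0"
      using P unfolding P' by (simp only: power2_eq_square algebra_simps)
    then have "l * P' ^ 2 + l * P' * Q' + [:0, 1:] * Q' ^ 2 = 0" using l0 by simp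
    moreover have "Q' \<noteq> 0" using False Q' by auto
    then have "degree Q = degree l + degree Q'" unfolding Q' using l0 by (intro degree_mult_eq)
    then have "degree Q' < degree Q" by (simp add: l_def)
    ultimately have "Q' = 0" using less.hyps by blast
    then show ?thesis using \<open>Q' \<noteq> 0\<close> by simp
  qed
qed

text \<open>The form is the homogenised quadratic equation of the series, so the claim is that this
  equation has no rational root. Evaluation at 1 gives Q = l Q', and cancelling l^2 leaves the form
  of the descent.\<close>

lemma binary_form_nonzero:
  fixes P Q :: "bit poly"
  assumes "[:1, 1:] ^ 3 * P ^ 2 + [:1, 1:] ^ 2 * P * Q + [:0, 1:] * Q ^ 2 = 0"
  shows "P = 0 \<and> Q = 0"
proof -
  define l :: "bit poly" where "l = [:1, 1:]"
  have eq: "l ^ 3 * P ^ 2 + l ^ 2 * P * Q + [:0, 1:] * Q ^ 2 = 0" using assms by (simp only: l_def)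
  have l0: "l \<noteq> 0" "poly l 1 = 0" by (simp_all add: l_def)
  have "poly (l ^ 3 * P ^ 2 + l ^ 2 * P * Q + [:0, 1:] * Q ^ 2) 1 = 0" using eq by simp
  then have "poly Q 1 = 0" using l0 by simp
  then have "[:- 1, 1:] dvd Q" by (simp only: poly_eq_0_iff_dvd)
  moreover have "[:- 1, 1:] = l" by (simp add: l_def)
  ultimately obtain Q' where Q': "Q = l * Q'" by (auto elim: dvdE)
  have "l ^ 2 * (l * P ^ 2 + l * P * Q' + [:0, 1:] * Q' ^ 2) = 0"
    using eq unfolding Q' by (simp only: power2_eq_square power3_eq_cube algebra_simps)
  then have "l * P ^ 2 + l * P * Q' + [:0, 1:] * Q' ^ 2 = 0" using l0 by simp
  then have "P = 0 \<and> Q' = 0" unfolding l_def by (rule binary_form_descent)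
  then show ?thesis by (simp add: Q')
qed

text \<open>Liouville's argument: the quadratic form that annihilates the series takes at \<open>(P, Q)\<close> a nonzero
  polynomial value of degree at most \<open>2 d + 3\<close>, and this value is a multiple of the remainder.\<close>
lemma tm_fps_zero_estimate_bit:
  fixes P Q :: "bit poly"
  assumes deg: "degree P \<le> d" "degree Q \<le> d"
    and van: "\<And>n. n \<le> 2 * d + 3 \<Longrightarrow> (fps_of_poly Q * tm_fps - fps_of_poly P) $ n = 0"
  shows "P = 0 \<and> Q = 0"
proof (rule binary_form_nonzero)
  define N where "N = [:1, 1:] ^ 3 * P ^ 2 + [:1, 1:] ^ 2 * P * Q + [:0, 1:] * Q ^ 2"
  define E where "E = fps_of_poly Q * tm_fps - fps_of_poly P"
  define a b where "a = (1 + fps_X :: bit fps) ^ 3" and "b = (1 + fps_X :: bit fps) ^ 2"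
  have l: "fps_of_poly [:1, 1:] = (1 + fps_X :: bit fps)" "fps_of_poly [:0, 1:] = (fps_X :: bit fps)"
    by (simp_all add: fps_of_poly_pCons)
  have P: "fps_of_poly P = fps_of_poly Q * tm_fps - E" by (simp add: E_def)
  have "fps_of_poly N = a * fps_of_poly P ^ 2 + b * fps_of_poly P * fps_of_poly Q + fps_X * fps_of_poly Q ^ 2"
    unfolding N_def by (simp only: fps_of_poly_add fps_of_poly_mult fps_of_poly_power l a_def b_def)
  \<comment> \<open>Substituting P = Q F - E isolates the quadratic equation as the coefficient of
    Q^2; everything else carries a factor E.\<close>
  also have "\<dots> = fps_of_poly Q ^ 2 * (a * tm_fps ^ 2 + b * tm_fps + fps_X)
      + E * (a * E - 2 * a * fps_of_poly Q * tm_fps - b * fps_of_poly Q)"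
    unfolding P by (simp add: power2_eq_square algebra_simps)
  also have "a * tm_fps ^ 2 + b * tm_fps + fps_X = 0"
    unfolding a_def b_def by (rule tm_fps_quadratic)
  finally have NE: "fps_of_poly N = E * (a * E - 2 * a * fps_of_poly Q * tm_fps - b * fps_of_poly Q)"
    by simp
  have "coeff N n = 0" for n
  proof (cases "n \<le> 2 * d + 3")
    case True
    have "coeff N n = (E * (a * E - 2 * a * fps_of_poly Q * tm_fps - b * fps_of_poly Q)) $ n"
      by (simp flip: NE)
    also have "\<dots> = 0" unfolding fps_mult_nth
      using van True by (intro sum.neutral) (auto simp: E_def)
    finally show ?thesis .
  next
    case False
    have d2: "degree (P ^ 2) \<le> 2 * d" "degree (Q ^ 2) \<le> 2 * d"
      using degree_power_le[of P 2] degree_power_le[of Q 2] deg by linarith+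
    have l2: "degree ([:1, 1:] ^ 3 :: bit poly) \<le> 3" "degree ([:1, 1:] ^ 2 :: bit poly) \<le> 2"
      using degree_power_le[of "[:1, 1:] :: bit poly" 3] degree_power_le[of "[:1, 1:] :: bit poly" 2] by simp_all
    have "degree N \<le> 2 * d + 3" unfolding N_def
    proof (intro degree_add_le)
      show "degree ([:1, 1:] ^ 3 * P ^ 2) \<le> 2 * d + 3"
        using degree_mult_le[of "[:1, 1:] ^ 3" "P ^ 2"] d2 l2 by linarith
      show "degree ([:1, 1:] ^ 2 * P * Q) \<le> 2 * d + 3"
        using degree_mult_le[of "[:1, 1:] ^ 2" P] degree_mult_le[of "[:1, 1:] ^ 2 * P" Q] deg l2 by linarith
      show "degree ([:0, 1:] * Q ^ 2) \<le> 2 * d + 3"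
        using degree_mult_le[of "[:0, 1:]" "Q ^ 2"] d2 by simp
    qed
    then show ?thesis using False by (intro coeff_eq_0) simp
  qed
  then show "[:1, 1:] ^ 3 * P ^ 2 + [:1, 1:] ^ 2 * P * Q + [:0, 1:] * Q ^ 2 = 0"
    unfolding N_def[symmetric] by (simp add: poly_eq_iff)
qed

text \<open>Reduction modulo 2 shows that all coefficients of P and Q are even. Halving preserves
  the hypotheses and strictly decreases the total size of the coefficients of a nonzero
  pair.\<close>

lemma tm_fps_zero_estimate_int:
  fixes P Q :: "int poly"
  assumes deg: "degree P \<le> d" "degree Q \<le> d"
    and van: "\<And>n. n \<le> 2 * d + 3 \<Longrightarrow> (fps_of_poly Q * tm_fps - fps_of_poly P) $ n = 0"
  shows "P = 0 \<and> Q = 0"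
  using assms
proof (induction "\<Sum>i\<le>d. nat \<bar>coeff P i\<bar> + nat \<bar>coeff Q i\<bar>" arbitrary: P Q rule: less_induct)
  case less
  define r where "r = (map_poly of_int :: int poly \<Rightarrow> bit poly)"
  have cr: "coeff (r R) i = of_int (coeff R i)" for R i by (simp add: r_def coeff_map_poly)
  have "r P = 0 \<and> r Q = 0"
  proof (rule tm_fps_zero_estimate_bit[where d = d])
    show "degree (r P) \<le> d" "degree (r Q) \<le> d"
      using less.prems by (auto intro!: degree_le simp: cr coeff_eq_0)
    fix n assume n: "n \<le> 2 * d + 3"
    have "(fps_of_poly (r Q) * tm_fps - fps_of_poly (r P)) $ n
        = of_int ((fps_of_poly Q * tm_fps - fps_of_poly P) $ n)"
      by (simp add: fps_mult_nth cr tm_fps_def)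
    then show "(fps_of_poly (r Q) * tm_fps - fps_of_poly (r P)) $ n = 0"
      using less.prems(3)[OF n] by simp
  qed
  then have ev: "even (coeff P i)" "even (coeff Q i)" for i
    using cr[of P i] cr[of Q i] by (auto simp: of_int_bit_eq_0_iff)
  define h where "h = (map_poly (\<lambda>x. x div 2) :: int poly \<Rightarrow> int poly)"
  have ch: "coeff (h R) i = coeff R i div 2" for R i by (simp add: h_def coeff_map_poly)
  have hPQ: "P = smult 2 (h P)" "Q = smult 2 (h Q)" using ev by (auto simp: poly_eq_iff ch)
  show ?case
  proof (rule ccontr)
    assume ne: "\<not> (P = 0 \<and> Q = 0)"
    have "(\<Sum>i\<le>d. nat \<bar>coeff (h P) i\<bar> + nat \<bar>coeff (h Q) i\<bar>) < (\<Sum>i\<le>d. nat \<bar>coeff P i\<bar> + nat \<bar>coeff Q i\<bar>)"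
    proof (rule sum_strict_mono_ex1)
      show "\<forall>i\<in>{..d}. nat \<bar>coeff (h P) i\<bar> + nat \<bar>coeff (h Q) i\<bar> \<le> nat \<bar>coeff P i\<bar> + nat \<bar>coeff Q i\<bar>"
      proof
        fix i
        show "nat \<bar>coeff (h P) i\<bar> + nat \<bar>coeff (h Q) i\<bar> \<le> nat \<bar>coeff P i\<bar> + nat \<bar>coeff Q i\<bar>"
          using ev[of i] unfolding ch by (auto elim!: evenE)
      qed
      obtain i where i: "coeff P i \<noteq> 0 \<or> coeff Q i \<noteq> 0" using ne by (auto simp: poly_eq_iff)
      then have "i \<le> d" using less.prems le_degree by (meson order_trans)
      moreover have "nat \<bar>coeff (h P) i\<bar> + nat \<bar>coeff (h Q) i\<bar> < nat \<bar>coeff P i\<bar> + nat \<bar>coeff Q i\<bar>"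
        using i ev[of i] unfolding ch by (auto elim!: evenE)
      ultimately show "\<exists>i\<in>{..d}. nat \<bar>coeff (h P) i\<bar> + nat \<bar>coeff (h Q) i\<bar> < nat \<bar>coeff P i\<bar> + nat \<bar>coeff Q i\<bar>"
        by auto
    qed simp
    moreover have "degree (h P) \<le> d" "degree (h Q) \<le> d"
      using less.prems hPQ by (metis degree_smult_eq zero_neq_numeral)+
    moreover have "(fps_of_poly (h Q) * tm_fps - fps_of_poly (h P)) $ n = 0" if "n \<le> 2 * d + 3" for n
    proof -
      have "fps_of_poly P = fps_const 2 * fps_of_poly (h P)" "fps_of_poly Q = fps_const 2 * fps_of_poly (h Q)"
        using hPQ by (metis fps_of_poly_smult)+
      then have "fps_of_poly Q * tm_fps - fps_of_poly P = fps_const 2 * (fps_of_poly (h Q) * tm_fps - fps_of_poly (h P))"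
        by (simp only: right_diff_distrib mult.assoc)
      then have "(fps_of_poly Q * tm_fps - fps_of_poly P) $ n = 2 * (fps_of_poly (h Q) * tm_fps - fps_of_poly (h P)) $ n"
        by (simp only: fps_mult_left_const_nth)
      then show ?thesis using less.prems(3)[OF that] by simp
    qed
    ultimately have "h P = 0 \<and> h Q = 0" using less.hyps by blast
    then show False using ne hPQ by auto
  qed
qed

section \<open>Pade approximants of the sign series\<close>

definition tm_sign_int :: "nat \<Rightarrow> int" where "tm_sign_int n = 1 - 2 * int (thue_morse n)"

abbreviation tm_remainder :: "int poly \<Rightarrow> int poly \<Rightarrow> int fps" where
  "tm_remainder Q P \<equiv> fps_of_poly Q * Abs_fps tm_sign_int - fps_of_poly P"

text \<open>The sign series T is 1 / (1 - X) - 2 F. Clearing 1 - X raises the degrees to d + 1, and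
  2 (d + 1) + 3 = 2 d + 5.\<close>

lemma tm_sign_zero_estimate:
  fixes P Q :: "int poly"
  assumes deg: "degree P \<le> d" "degree Q \<le> d"
    and van: "\<And>n. n \<le> 2 * d + 5 \<Longrightarrow> tm_remainder Q P $ n = 0"
  shows "P = 0 \<and> Q = 0"
proof -
  define Q' P' where "Q' = smult (-2) ([:1, -1:] * Q)" and "P' = [:1, -1:] * P - Q"
  have fl: "fps_of_poly [:1, -1:] = (1 - fps_X :: int fps)" by (simp add: fps_of_poly_pCons)
  have m2: "fps_const (-2) = (-2 :: int fps)" by (simp add: numeral_fps_const)
  have S: "(1 - fps_X) * Abs_fps (\<lambda>n. 1) = (1 :: int fps)"
    by (rule fps_ext) (auto simp: left_diff_distrib)
  have eq: "Abs_fps tm_sign_int = Abs_fps (\<lambda>n. 1) - 2 * tm_fps"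
    by (rule fps_ext) (simp add: tm_sign_int_def tm_fps_def numeral_fps_const)
  have "(1 - fps_X) * Abs_fps tm_sign_int = (1 - fps_X) * Abs_fps (\<lambda>n. 1) - 2 * (1 - fps_X) * tm_fps"
    unfolding eq by (simp only: right_diff_distrib mult_ac)
  then have T: "(1 - fps_X) * Abs_fps tm_sign_int = 1 - 2 * (1 - fps_X) * tm_fps"
    by (simp only: S)
  have "P' = 0 \<and> Q' = 0"
  proof (rule tm_fps_zero_estimate_int[where d = "d + 1"])
    show "degree P' \<le> d + 1" unfolding P'_def
      using degree_mult_le[of "[:1, -1:]" P] deg by (intro degree_diff_le) auto
    show "degree Q' \<le> d + 1" unfolding Q'_def
      using degree_mult_le[of "[:1, -1:]" Q] deg by auto
    fix n assume n: "n \<le> 2 * (d + 1) + 3"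
    have "fps_of_poly Q' * tm_fps - fps_of_poly P' =
        fps_of_poly Q * (1 - 2 * (1 - fps_X) * tm_fps) - (1 - fps_X) * fps_of_poly P"
      unfolding Q'_def P'_def fps_of_poly_smult fps_of_poly_diff fps_of_poly_mult fl m2
      by (simp add: algebra_simps)
    also have "\<dots> = (1 - fps_X) * tm_remainder Q P"
      unfolding T[symmetric] by (simp add: algebra_simps)
    finally show "(fps_of_poly Q' * tm_fps - fps_of_poly P') $ n = 0"
      using n van by (simp add: left_diff_distrib)
  qed
  then have "[:1, -1:] * Q = 0" unfolding Q'_def by (simp only: smult_eq_0_iff) simp
  then have Q: "Q = 0" by (simp only: mult_eq_0_iff) simp
  then have "[:1, -1:] * P = 0" using \<open>P' = 0 \<and> Q' = 0\<close> by (simp add: P'_def)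
  then have "P = 0" by (simp only: mult_eq_0_iff) simp
  with Q show ?thesis by simp
qed

lemma of_int_tm_sign_int: "of_int (tm_sign_int n) = (tm_sign n :: real)"
  by (simp add: tm_sign_int_def tm_sign_eq)

lemma abs_tm_sign_int: "\<bar>tm_sign_int n\<bar> = 1"
  using thue_morse_cases[of n] by (auto simp: tm_sign_int_def)

lemma fps_of_poly_mult_nth:
  fixes Q :: "int poly"
  assumes "degree Q \<le> d"
  shows "(fps_of_poly Q * F) $ n = (\<Sum>i\<le>d. if i \<le> n then coeff Q i * F $ (n - i) else 0)"
proof -
  have "(fps_of_poly Q * F) $ n = (\<Sum>i\<in>{0..n}. coeff Q i * F $ (n - i))" by (simp add: fps_mult_nth)
  also have "\<dots> = (\<Sum>i\<in>{0..n} \<union> {..d}. if i \<le> n then coeff Q i * F $ (n - i) else 0)"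
    by (rule sum.mono_neutral_cong_left) auto
  also have "\<dots> = (\<Sum>i\<le>d. if i \<le> n then coeff Q i * F $ (n - i) else 0)"
    using assms by (intro sum.mono_neutral_right) (auto simp: coeff_eq_0)
  finally show ?thesis .
qed

text \<open>Chosen so that the pigeonhole count closes: for this value B, (2 (d+1) (B+1))^d = B
  (B+1)^d is less than (B+1)^(d+1).\<close>

definition pade_height :: "nat \<Rightarrow> nat" where "pade_height d = (2 * (d + 1)) ^ d"

text \<open>Siegel's lemma: d homogeneous linear conditions on d + 1 integer coefficients. Two
  coefficient vectors with the same image are subtracted, which gives a height depending on d
  alone.\<close>

lemma pade_denominator_exists:
  "\<exists>Q::int poly. Q \<noteq> 0 \<and> degree Q \<le> d \<and> (\<forall>i. \<bar>coeff Q i\<bar> \<le> int (pade_height d)) \<and>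
     (\<forall>n\<in>{d+1..2*d}. (fps_of_poly Q * Abs_fps tm_sign_int) $ n = 0)"
proof -
  define B where "B = pade_height d"
  define D where "D = {..d} \<rightarrow>\<^sub>E {0..int B}"
  define R where "R = {d+1..2*d} \<rightarrow>\<^sub>E {- int ((d + 1) * B)..int ((d + 1) * B)}"
  define \<phi> where "\<phi> = (\<lambda>c. \<lambda>n\<in>{d+1..2*d}. \<Sum>i\<le>d. c i * tm_sign_int (n - i))"
  have "nat (int B + 1) = B + 1" by simp
  then have cD: "card D = (B + 1) ^ (d + 1)" by (simp add: D_def card_PiE)
  have cR: "card R = (2 * (d + 1) * B + 1) ^ d"
  proof -
    have "card {- int X..int X} = 2 * X + 1" for X by simp
    then show ?thesis by (simp only: R_def card_PiE finite_atLeastAtMost prod_constant card_atLeastAtMost)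
      (simp add: algebra_simps)
  qed
  have "\<phi> ` D \<subseteq> R"
  proof (rule image_subsetI)
    fix c assume c: "c \<in> D"
    have "\<bar>\<Sum>i\<le>d. c i * tm_sign_int (n - i)\<bar> \<le> int ((d + 1) * B)" for n
    proof -
      have "\<bar>\<Sum>i\<le>d. c i * tm_sign_int (n - i)\<bar> \<le> (\<Sum>i\<le>d. \<bar>c i * tm_sign_int (n - i)\<bar>)" by (rule sum_abs)
      also have "\<dots> \<le> (\<Sum>i\<le>d. int B)"
        using c by (intro sum_mono) (auto simp: abs_mult abs_tm_sign_int D_def PiE_iff)
      finally show ?thesis by (simp add: distrib_right)
    qed
    then show "\<phi> c \<in> R" by (auto simp: \<phi>_def R_def abs_le_iff minus_le_iff)
  qed
  then have "card (\<phi> ` D) \<le> card R" by (intro card_mono) (auto simp: R_def intro: finite_PiE)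
  also have "\<dots> \<le> (2 * (d + 1) * (B + 1)) ^ d" unfolding cR by (intro power_mono) auto
  also have "\<dots> = B * (B + 1) ^ d" by (simp only: power_mult_distrib B_def pade_height_def)
  also have "\<dots> < card D" unfolding cD by simp
  finally have "\<not> inj_on \<phi> D" by (rule pigeonhole)
  then obtain c c' where c: "c \<in> D" "c' \<in> D" "\<phi> c = \<phi> c'" "c \<noteq> c'" by (auto simp: inj_on_def)
  define Q where "Q = (\<Sum>i\<le>d. monom (c i - c' i) i)"
  have cQ: "coeff Q i = (if i \<le> d then c i - c' i else 0)" for i
    by (simp add: Q_def coeff_sum)
  have "Q \<noteq> 0"
  proof
    assume "Q = 0"
    then have "c i = c' i" if "i \<in> {..d}" for i using that cQ[of i] by simp
    then have "c = c'" using c unfolding D_def by (intro PiE_ext) auto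
    then show False using c by simp
  qed
  moreover have dQ: "degree Q \<le> d" by (rule degree_le) (simp add: cQ)
  moreover have "\<bar>coeff Q i\<bar> \<le> int B" for i
  proof (cases "i \<le> d")
    case True
    then have "c i \<in> {0..int B}" "c' i \<in> {0..int B}" using c by (auto simp: D_def PiE_iff)
    then have "\<bar>c i - c' i\<bar> \<le> int B" unfolding atLeastAtMost_iff by linarith
    then show ?thesis using True by (simp add: cQ)
  qed (simp add: cQ)
  moreover have "(fps_of_poly Q * Abs_fps tm_sign_int) $ n = 0" if n: "n \<in> {d+1..2*d}" for n
  proof -
    have "(fps_of_poly Q * Abs_fps tm_sign_int) $ n = (\<Sum>i\<le>d. (c i - c' i) * tm_sign_int (n - i))"
      unfolding fps_of_poly_mult_nth[OF dQ] using n by (intro sum.cong) (auto simp: cQ)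
    also have "\<dots> = \<phi> c n - \<phi> c' n" using n by (simp add: \<phi>_def left_diff_distrib sum_subtractf)
    finally show ?thesis using c by simp
  qed
  ultimately show ?thesis unfolding B_def by blast
qed

text \<open>P is Q T truncated at degree d, so the vanishing of the next d coefficients gives order
  at least 2 d + 1, and the zero estimate caps it at 2 d + 5. This bounded window is why the
  exponent excess tends to 0 as d grows.\<close>

lemma pade_approximant_exists:
  "\<exists>Q P :: int poly. degree Q \<le> d \<and> degree P \<le> d \<and> (\<forall>i. \<bar>coeff Q i\<bar> \<le> int (pade_height d)) \<and>
     (\<forall>n. \<bar>tm_remainder Q P $ n\<bar> \<le> int ((d + 1) * pade_height d)) \<and>
     (\<exists>m\<in>{2*d+1..2*d+5}. tm_remainder Q P $ m \<noteq> 0 \<and>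
       (\<forall>n<m. tm_remainder Q P $ n = 0))"
proof -
  obtain Q :: "int poly" where Q: "Q \<noteq> 0" "degree Q \<le> d" "\<And>i. \<bar>coeff Q i\<bar> \<le> int (pade_height d)"
     "\<And>n. n \<in> {d+1..2*d} \<Longrightarrow> (fps_of_poly Q * Abs_fps tm_sign_int) $ n = 0"
    using pade_denominator_exists by blast
  define P where "P = (\<Sum>i\<le>d. monom ((fps_of_poly Q * Abs_fps tm_sign_int) $ i) i)"
  have cP: "coeff P i = (if i \<le> d then (fps_of_poly Q * Abs_fps tm_sign_int) $ i else 0)" for i
    by (simp add: P_def coeff_sum)
  have dP: "degree P \<le> d" by (rule degree_le) (simp add: cP)
  define e where "e = fps_of_poly Q * Abs_fps tm_sign_int - fps_of_poly P"
  have e: "e $ n = (if n \<le> d then 0 else (fps_of_poly Q * Abs_fps tm_sign_int) $ n)" for n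
    by (simp add: e_def cP)
  have bound: "\<bar>e $ n\<bar> \<le> int ((d + 1) * pade_height d)" for n
  proof -
    have "\<bar>(fps_of_poly Q * Abs_fps tm_sign_int) $ n\<bar> \<le> (\<Sum>i\<le>d. \<bar>if i \<le> n then coeff Q i * tm_sign_int (n - i) else 0\<bar>)"
      unfolding fps_of_poly_mult_nth[OF Q(2)] fps_nth_Abs_fps by (rule sum_abs)
    also have "\<dots> \<le> (\<Sum>i\<le>d. int (pade_height d))"
      using Q(3) by (intro sum_mono) (auto simp: abs_mult abs_tm_sign_int)
    finally have "\<bar>(fps_of_poly Q * Abs_fps tm_sign_int) $ n\<bar> \<le> int ((d + 1) * pade_height d)"
      by (simp add: distrib_right)
    then show ?thesis by (simp add: e)
  qed
  have "\<exists>n. n \<le> 2 * d + 5 \<and> e $ n \<noteq> 0"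
    using tm_sign_zero_estimate[OF dP Q(2)] Q(1) unfolding e_def by blast
  then obtain n0 where n0: "n0 \<le> 2 * d + 5" "e $ n0 \<noteq> 0" by blast
  define m where "m = (LEAST n. e $ n \<noteq> 0)"
  have m: "e $ m \<noteq> 0" "m \<le> n0" "\<forall>n<m. e $ n = 0"
    unfolding m_def using LeastI[of "\<lambda>n. e $ n \<noteq> 0", OF n0(2)] Least_le[of "\<lambda>n. e $ n \<noteq> 0", OF n0(2)]
    by (auto dest: not_less_Least)
  have "\<not> m \<le> 2 * d"
  proof
    assume "m \<le> 2 * d"
    then have "e $ m = 0" using Q(4)[of m] by (simp add: e)
    then show False using m by simp
  qed
  then have "m \<in> {2*d+1..2*d+5}" using m n0 by auto
  then show ?thesis using Q(2,3) dP bound m unfolding e_def by blast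
qed

section \<open>From Pade approximants to rational approximations\<close>

definition tm_series :: "real \<Rightarrow> real" where "tm_series z = (\<Sum>n. tm_sign n * z ^ n)"

lemma summable_bounded_power_series:
  fixes f :: "nat \<Rightarrow> real"
  assumes "\<bar>z\<bar> < 1" "\<And>n. \<bar>f n\<bar> \<le> C"
  shows "summable (\<lambda>n. f n * z ^ n)" "\<bar>\<Sum>n. f n * z ^ n\<bar> \<le> C / (1 - \<bar>z\<bar>)"
proof -
  have g: "(\<lambda>n. C * \<bar>z\<bar> ^ n) sums (C * (1 / (1 - \<bar>z\<bar>)))"
    using assms by (intro sums_mult geometric_sums) auto
  have le: "norm (f n * z ^ n) \<le> C * \<bar>z\<bar> ^ n" for n
    using assms(2)[of n] by (simp add: abs_mult power_abs mult_right_mono)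
  show "summable (\<lambda>n. f n * z ^ n)"
    by (rule summable_comparison_test'[OF sums_summable[OF g] le])
  have "norm (\<Sum>n. f n * z ^ n) \<le> (\<Sum>n. C * \<bar>z\<bar> ^ n)"
    by (rule norm_suminf_le[OF le sums_summable[OF g]])
  then show "\<bar>\<Sum>n. f n * z ^ n\<bar> \<le> C / (1 - \<bar>z\<bar>)"
    using sums_unique[OF g] by simp
qed

lemma tm_series_sums: "\<bar>z\<bar> < 1 \<Longrightarrow> (\<lambda>n. tm_sign n * z ^ n) sums tm_series z"
  unfolding tm_series_def using summable_bounded_power_series(1)[of z tm_sign 1] by (simp add: summable_sums)

lemma tm_series_square:
  assumes "\<bar>z\<bar> < 1"
  shows "tm_series z = (1 - z) * tm_series (z ^ 2)"
proof -
  have "(\<lambda>n. \<Sum>i\<in>{n*2..<n*2+2}. tm_sign i * z ^ i) sums tm_series z"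
    by (rule sums_group[OF tm_series_sums[OF assms]]) simp
  moreover have "(\<Sum>i\<in>{n*2..<n*2+2}. tm_sign i * z ^ i) = (1 - z) * (tm_sign n * (z ^ 2) ^ n)" for n
  proof -
    have "{n*2..<n*2+2} = {2 * n, Suc (2 * n)}" by auto
    then have "(\<Sum>i\<in>{n*2..<n*2+2}. tm_sign i * z ^ i) = (\<Sum>i\<in>{2 * n, Suc (2 * n)}. tm_sign i * z ^ i)"
      by (simp only:)
    also have "\<dots> = (1 - z) * (tm_sign n * z ^ (2 * n))" by (simp add: left_diff_distrib)
    finally show ?thesis by (simp only: power_mult)
  qed
  moreover have "(\<lambda>n. (1 - z) * (tm_sign n * (z ^ 2) ^ n)) sums ((1 - z) * tm_series (z ^ 2))"
    using assms by (intro sums_mult tm_series_sums) (simp add: abs_square_less_1)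
  ultimately show ?thesis using sums_unique2 by auto
qed

definition tm_prod :: "nat \<Rightarrow> real" where "tm_prod k = (\<Prod>j<k. 1 - (1 / 2) ^ (2 ^ j))"

lemma tm_series_half: "tm_series (1 / 2) = tm_prod k * tm_series ((1 / 2) ^ (2 ^ k))"
proof (induction k)
  case (Suc k)
  have "\<bar>(1 / 2 :: real) ^ (2 ^ k)\<bar> < 1" by (simp add: power_less_one_iff)
  from tm_series_square[OF this] Suc show ?case
    by (simp add: tm_prod_def mult.commute flip: power_mult)
qed (simp add: tm_prod_def)

lemma tm_prod_int: "\<exists>a::int. 2 ^ (2 ^ k) * tm_prod k = of_int a"
proof (induction k)
  case (Suc k)
  then obtain a :: int where a: "2 ^ (2 ^ k) * tm_prod k = of_int a" by blast
  have "2 ^ (2 ^ Suc k) * tm_prod (Suc k) = (2 ^ (2 ^ k) * tm_prod k) * (2 ^ (2 ^ k) * (1 - (1 / 2) ^ (2 ^ k)))"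
    by (simp add: tm_prod_def mult_2 power_add)
  also have "\<dots> = of_int (a * (2 ^ (2 ^ k) - 1))"
    by (simp add: a right_diff_distrib power_divide)
  finally show ?case by blast
qed (auto simp: tm_prod_def intro: exI[of _ 2])

lemma tm_prod_bounds: "1 / 4 \<le> tm_prod k" "tm_prod k \<le> 1"
proof -
  \<comment> \<open>The bare bound 1/4 is not inductive. With z = 2^(-2^k) the strengthened one is,
    since (1 + 2 z)(1 - z) >= 1 + 2 z^2 holds for 0 <= z <= 1/4; this excludes k = 0, which is
    computed directly.\<close>
  have "(1 / 4) * (1 + 2 * (1 / 2) ^ (2 ^ k)) \<le> tm_prod k"
  proof (induction k)
    case (Suc k)
    show ?case
    proof (cases "k = 0")
      case False
      define z :: real where "z = (1 / 2) ^ (2 ^ k)"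
      have "(2::nat) ^ 1 \<le> 2 ^ k" using False by (intro power_increasing) auto
      then have z: "0 \<le> z" "z \<le> (1 / 2) ^ 2" unfolding z_def by (auto intro: power_decreasing)
      have zz: "(1 / 2) ^ (2 ^ Suc k) = z ^ 2" by (simp add: z_def mult.commute flip: power_mult)
      have "z * z \<le> (1 / 2) ^ 2 * z" using z by (intro mult_right_mono) auto
      then have "z * z \<le> z / 4" by (simp add: power2_eq_square)
      moreover have "(1 / 4) * (1 + 2 * z) * (1 - z) - (1 / 4) * (1 + 2 * z ^ 2) = z / 4 - z * z"
        by (simp add: power2_eq_square field_simps)
      ultimately have "(1 / 4) * (1 + 2 * z ^ 2) \<le> (1 / 4) * (1 + 2 * z) * (1 - z)" by linarith
      also have "\<dots> \<le> tm_prod k * (1 - z)"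
        using Suc z by (intro mult_right_mono) (auto simp: z_def power2_eq_square)
      finally show ?thesis unfolding zz by (simp add: tm_prod_def z_def)
    qed (simp add: tm_prod_def power2_eq_square)
  qed (simp add: tm_prod_def)
  moreover have "1 / 4 \<le> (1 / 4) * (1 + 2 * (1 / 2 :: real) ^ (2 ^ k))" by simp
  ultimately show "1 / 4 \<le> tm_prod k" by (rule order_trans[rotated])
  show "tm_prod k \<le> 1" unfolding tm_prod_def by (intro prod_le_1) (simp add: power_le_one)
qed

lemma poly_remainder_sums:
  fixes Q P :: "int poly"
  assumes z: "\<bar>z\<bar> < 1" and deg: "degree Q \<le> d" "degree P \<le> d"
  shows "(\<lambda>n. of_int (tm_remainder Q P $ n) * z ^ n) sums
    ((\<Sum>i\<le>d. of_int (coeff Q i) * z ^ i) * tm_series z - (\<Sum>i\<le>d. of_int (coeff P i) * z ^ i))"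
proof -
  have 1: "(\<lambda>n. if i \<le> n then of_int (coeff Q i) * tm_sign (n - i) * z ^ n else 0) sums (of_int (coeff Q i) * z ^ i * tm_series z)" for i
  proof -
    define f where "f = (\<lambda>n. if i \<le> n then of_int (coeff Q i) * tm_sign (n - i) * z ^ n else 0)"
    have "(\<lambda>n. of_int (coeff Q i) * z ^ i * (tm_sign n * z ^ n)) sums (of_int (coeff Q i) * z ^ i * tm_series z)"
      by (intro sums_mult tm_series_sums z)
    moreover have "f (n + i) = of_int (coeff Q i) * z ^ i * (tm_sign n * z ^ n)" for n
      by (simp add: f_def power_add)
    ultimately have "(\<lambda>n. f (n + i)) sums (of_int (coeff Q i) * z ^ i * tm_series z)" by simp
    moreover have "(\<Sum>k<i. f k) = 0" by (simp add: f_def)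
    ultimately have "f sums (of_int (coeff Q i) * z ^ i * tm_series z)" using sums_iff_shift'[of f i] by simp
    then show ?thesis by (simp add: f_def)
  qed
  have "(\<lambda>n. \<Sum>i\<le>d. if i \<le> n then of_int (coeff Q i) * tm_sign (n - i) * z ^ n else 0)
      sums (\<Sum>i\<le>d. of_int (coeff Q i) * z ^ i * tm_series z)"
    by (intro sums_sum 1)
  moreover have "(\<lambda>n. of_int (coeff P n) * z ^ n) sums (\<Sum>i\<le>d. of_int (coeff P i) * z ^ i)"
    by (rule sums_finite) (use deg in \<open>auto simp: coeff_eq_0\<close>)
  ultimately have "(\<lambda>n. (\<Sum>i\<le>d. if i \<le> n then of_int (coeff Q i) * tm_sign (n - i) * z ^ n else 0) - of_int (coeff P n) * z ^ n)
      sums ((\<Sum>i\<le>d. of_int (coeff Q i) * z ^ i * tm_series z) - (\<Sum>i\<le>d. of_int (coeff P i) * z ^ i))"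
    by (rule sums_diff)
  moreover have "(\<Sum>i\<le>d. if i \<le> n then of_int (coeff Q i) * tm_sign (n - i) * z ^ n else 0) - of_int (coeff P n) * z ^ n
      = of_int (tm_remainder Q P $ n) * z ^ n" for n
    by (simp add: fps_of_poly_mult_nth[OF deg(1)] left_diff_distrib sum_distrib_right of_int_tm_sign_int if_distrib[of of_int]
        if_distrib[of "\<lambda>x. x * _"] cong: if_cong)
  ultimately show ?thesis by (simp add: sum_distrib_right)
qed

text \<open>The leading coefficient is a nonzero integer, hence at least 1 in size, while C z <= 1/4
  keeps the whole tail below 1/3 of z^m.\<close>

lemma leading_term_bounds:
  fixes f :: "nat \<Rightarrow> int" and C z S :: real
  assumes S: "(\<lambda>n. of_int (f n) * z ^ n) sums S" and z: "0 < z" "4 * C * z \<le> 1" and C: "C \<ge> 1"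
    and f: "\<And>n. \<bar>of_int (f n)\<bar> \<le> C" "f m \<noteq> 0" "\<And>n. n < m \<Longrightarrow> f n = 0"
  shows "z ^ m / 2 \<le> \<bar>S\<bar>" "\<bar>S\<bar> \<le> 2 * C * z ^ m"
proof -
  have "4 * 1 * z \<le> 4 * C * z" using C z by (intro mult_right_mono mult_left_mono) auto
  then have z4: "z \<le> 1 / 4" using z by linarith
  define R where "R = (\<Sum>n. of_int (f (n + Suc m)) * z ^ n)"
  have az: "\<bar>z\<bar> < 1" using z z4 by simp
  have R: "(\<lambda>n. of_int (f (n + Suc m)) * z ^ n) sums R"
    unfolding R_def by (rule summable_sums, rule summable_bounded_power_series[OF az, where C = C]) (rule f)
  have "\<bar>R\<bar> \<le> C / (1 - \<bar>z\<bar>)"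
    unfolding R_def by (rule summable_bounded_power_series[OF az]) (rule f)
  also have "\<dots> \<le> C / (3 / 4)" using z z4 C by (intro divide_left_mono) auto
  finally have "z * \<bar>R\<bar> \<le> z * (C / (3 / 4))" using z by (intro mult_left_mono) auto
  also have "\<dots> = (4 * C * z) / 3" by simp
  also have "\<dots> \<le> 1 / 3" using z by simp
  finally have zR: "\<bar>z * R\<bar> \<le> 1 / 3" using z by (simp add: abs_mult)
  have "(\<lambda>n. z ^ Suc m * (of_int (f (n + Suc m)) * z ^ n)) sums (z ^ Suc m * R)"
    by (rule sums_mult[OF R])
  then have "(\<lambda>n. of_int (f (n + Suc m)) * z ^ (n + Suc m)) sums (z ^ Suc m * R)"
    by (simp add: power_add mult_ac)
  then have "(\<lambda>n. of_int (f n) * z ^ n) sums (z ^ Suc m * R + (\<Sum>n<Suc m. of_int (f n) * z ^ n))"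
    by (subst (asm) sums_iff_shift)
  then have "S = z ^ Suc m * R + (\<Sum>n<Suc m. of_int (f n) * z ^ n)" using S sums_unique2 by blast
  also have "(\<Sum>n<Suc m. of_int (f n) * z ^ n) = of_int (f m) * z ^ m" using f(3) by simp
  finally have "S = z ^ m * (of_int (f m) + z * R)" by (simp add: algebra_simps)
  then have aS: "\<bar>S\<bar> = z ^ m * \<bar>of_int (f m) + z * R\<bar>" using z by (simp add: abs_mult)
  have "1 \<le> \<bar>real_of_int (f m)\<bar>" using f(2) by linarith
  then have "1 / 2 \<le> \<bar>of_int (f m) + z * R\<bar>" "\<bar>of_int (f m) + z * R\<bar> \<le> 2 * C"
    using zR f(1)[of m] C by linarith+
  then show "z ^ m / 2 \<le> \<bar>S\<bar>" "\<bar>S\<bar> \<le> 2 * C * z ^ m"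
    unfolding aS using z mult_left_mono[of _ _ "z ^ m"] by (auto simp: mult.commute)
qed

definition pade_const :: "nat \<Rightarrow> real" where "pade_const d = real ((d + 1) * pade_height d)"

lemma pade_const_ge_1: "pade_const d \<ge> 1"
proof -
  have "0 < (d + 1) * pade_height d" by (simp add: pade_height_def)
  then show ?thesis unfolding pade_const_def by (simp only: Suc_le_eq[symmetric] One_nat_def[symmetric] real_of_nat_ge_one_iff)
qed

lemma pade_const_mono: "d \<le> d' \<Longrightarrow> pade_const d \<le> pade_const d'"
proof -
  assume d: "d \<le> d'"
  have "pade_height d \<le> (2 * (d' + 1)) ^ d" unfolding pade_height_def using d by (intro power_mono) auto
  also have "\<dots> \<le> pade_height d'" unfolding pade_height_def using d by (intro power_increasing) auto
  finally show ?thesis unfolding pade_const_def using d by (intro of_nat_mono mult_mono) auto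
qed

text \<open>The Pade approximant of degree \<open>d\<close>, evaluated at \<open>z = 2^(-2^k)\<close> and pulled back to \<open>1/2\<close> by the functional
  equation. The lower bound on the error serves the case of proportional approximations.\<close>
lemma tm_series_half_approx:
  fixes d k :: nat
  defines "Y \<equiv> (2::real) ^ (2 ^ k)"
  assumes k: "4 * pade_const d \<le> Y"
  shows "\<exists>(q::int) (p::int). \<bar>of_int q\<bar> \<le> pade_const d * Y ^ (d + 1) \<and>
     (1 / 8) / Y ^ (d + 4) \<le> \<bar>of_int q * tm_series (1 / 2) - of_int p\<bar> \<and>
     \<bar>of_int q * tm_series (1 / 2) - of_int p\<bar> \<le> 2 * pade_const d / Y ^ d"
proof -
  define C where "C = pade_const d"
  define z where "z = 1 / Y"
  have C1: "C \<ge> 1" unfolding C_def by (rule pade_const_ge_1)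
  have Y: "Y \<ge> 4" using k C1 by (simp add: C_def)
  have z: "0 < z" "z \<le> 1 / 4" "4 * C * z \<le> 1" using Y k by (auto simp: z_def C_def field_simps)
  have zh: "(1 / 2) ^ (2 ^ k) = z" by (simp add: z_def Y_def power_divide)
  obtain Q P :: "int poly" and m where QP: "degree Q \<le> d" "degree P \<le> d" "\<And>i. \<bar>coeff Q i\<bar> \<le> int (pade_height d)"
     "\<And>n. \<bar>tm_remainder Q P $ n\<bar> \<le> int ((d + 1) * pade_height d)"
     and m: "m \<in> {2*d+1..2*d+5}" "tm_remainder Q P $ m \<noteq> 0"
       "\<And>n. n < m \<Longrightarrow> tm_remainder Q P $ n = 0"
    using pade_approximant_exists[of d] by blast
  define Qz where "Qz = (\<Sum>i\<le>d. real_of_int (coeff Q i) * z ^ i)"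
  define Pz where "Pz = (\<Sum>i\<le>d. real_of_int (coeff P i) * z ^ i)"
  define S where "S = Qz * tm_series z - Pz"
  have sums: "(\<lambda>n. of_int (tm_remainder Q P $ n) * z ^ n) sums S"
    unfolding S_def Qz_def Pz_def by (rule poly_remainder_sums[OF _ QP(1,2)]) (use z in simp)
  have bd: "\<bar>real_of_int (tm_remainder Q P $ n)\<bar> \<le> C" for n
    using QP(4)[of n] unfolding C_def pade_const_def by linarith
  have S: "z ^ m / 2 \<le> \<bar>S\<bar>" "\<bar>S\<bar> \<le> 2 * C * z ^ m"
    using leading_term_bounds[OF sums z(1,3) C1 bd m(2,3)] by auto
  obtain a :: int where a: "Y * tm_prod k = of_int a" using tm_prod_int[of k] by (auto simp: Y_def)
  define Yi where "Yi = (2::int) ^ (2 ^ k)"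
  have Yi: "of_int Yi = Y" by (simp add: Yi_def Y_def)
  \<comment> \<open>Y^d clears the powers of z in Q(z) and P(z); one more Y clears the denominator
    of \<open>tm_prod k\<close>.\<close>
  define q where "q = (\<Sum>i\<le>d. coeff Q i * Yi ^ (d - i)) * Yi"
  define p where "p = (\<Sum>i\<le>d. coeff P i * Yi ^ (d - i)) * a"
  have pw: "Y ^ (d - i) = Y ^ d * z ^ i" if "i \<le> d" for i
  proof -
    have "Y ^ d = Y ^ (d - i) * Y ^ i" using that by (simp flip: power_add)
    then show ?thesis using Y by (simp add: z_def power_divide)
  qed
  have q: "of_int q = Y ^ (d + 1) * Qz"
  proof -
    have "of_int q = (\<Sum>i\<le>d. of_int (coeff Q i) * Y ^ (d - i)) * Y" by (simp add: q_def Yi)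
    also have "(\<Sum>i\<le>d. of_int (coeff Q i) * Y ^ (d - i)) = (\<Sum>i\<le>d. Y ^ d * (of_int (coeff Q i) * z ^ i))"
      by (intro sum.cong) (auto simp: pw)
    finally show ?thesis by (simp add: Qz_def sum_distrib_left mult_ac)
  qed
  have p: "of_int p = Y ^ (d + 1) * tm_prod k * Pz"
  proof -
    have "of_int p = (\<Sum>i\<le>d. of_int (coeff P i) * Y ^ (d - i)) * (Y * tm_prod k)" by (simp add: p_def Yi a)
    also have "(\<Sum>i\<le>d. of_int (coeff P i) * Y ^ (d - i)) = (\<Sum>i\<le>d. Y ^ d * (of_int (coeff P i) * z ^ i))"
      by (intro sum.cong) (auto simp: pw)
    finally show ?thesis by (simp add: Pz_def sum_distrib_left mult_ac)
  qed
  have "of_int q * tm_series (1 / 2) - of_int p = Y ^ (d + 1) * tm_prod k * S"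
    unfolding q p S_def tm_series_half[of k] zh by (simp add: algebra_simps)
  then have err: "\<bar>of_int q * tm_series (1 / 2) - of_int p\<bar> = Y ^ (d + 1) * tm_prod k * \<bar>S\<bar>"
    using Y tm_prod_bounds[of k] by (simp add: abs_mult)
  have "\<bar>of_int q\<bar> \<le> C * Y ^ (d + 1)"
  proof -
    have "\<bar>Qz\<bar> \<le> (\<Sum>i\<le>d. \<bar>real_of_int (coeff Q i) * z ^ i\<bar>)" unfolding Qz_def by (rule sum_abs)
    also have "\<dots> \<le> (\<Sum>i\<le>d. real (pade_height d) * 1)"
    proof (rule sum_mono)
      fix i
      have "\<bar>real_of_int (coeff Q i)\<bar> \<le> real (pade_height d)" using QP(3)[of i] by linarith
      moreover have "\<bar>z ^ i\<bar> \<le> 1" using z by (simp add: power_le_one)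
      ultimately show "\<bar>real_of_int (coeff Q i) * z ^ i\<bar> \<le> real (pade_height d) * 1"
        unfolding abs_mult by (intro mult_mono) auto
    qed
    also have "\<dots> = C" by (simp add: C_def pade_const_def distrib_right)
    finally have "Y ^ (d + 1) * \<bar>Qz\<bar> \<le> Y ^ (d + 1) * C" using Y by (intro mult_left_mono) auto
    then show ?thesis unfolding q using Y by (simp add: abs_mult mult.commute)
  qed
  moreover have "(1 / 8) / Y ^ (d + 4) \<le> Y ^ (d + 1) * tm_prod k * \<bar>S\<bar>"
  proof -
    \<comment> \<open>The extreme orders m = 2 d + 5 and m = 2 d + 1, multiplied by Y^(d+1), give
      the two exponents d + 4 and d of the statement.\<close>
    have "Y ^ (2 * d + 5) = Y ^ (d + 1) * Y ^ (d + 4)"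
      unfolding power_add[symmetric] by (rule arg_cong[where f = "\<lambda>i. Y ^ i"]) simp
    then have "(1 / 8) / Y ^ (d + 4) = Y ^ (d + 1) * (1 / 4) * (z ^ (2 * d + 5) / 2)"
      using Y by (simp add: z_def power_divide field_simps)
    also have "z ^ (2 * d + 5) \<le> z ^ m" using m(1) z by (intro power_decreasing) auto
    also have "Y ^ (d + 1) * (1 / 4) * (z ^ m / 2) \<le> Y ^ (d + 1) * tm_prod k * \<bar>S\<bar>"
      using S(1) tm_prod_bounds(1)[of k] Y z by (intro mult_mono) auto
    finally show ?thesis using Y by (simp add: mult_left_mono)
  qed
  moreover have "Y ^ (d + 1) * tm_prod k * \<bar>S\<bar> \<le> 2 * C / Y ^ d"
  proof -
    have "Y ^ (d + 1) * tm_prod k * \<bar>S\<bar> \<le> Y ^ (d + 1) * 1 * (2 * C * z ^ m)"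
      using S(2) tm_prod_bounds[of k] Y by (intro mult_mono) auto
    also have "\<dots> \<le> Y ^ (d + 1) * 1 * (2 * C * z ^ (2 * d + 1))"
      using m(1) z Y C1 by (intro mult_left_mono power_decreasing) auto
    also have "Y ^ (2 * d + 1) = Y ^ (d + 1) * Y ^ d"
      unfolding power_add[symmetric] by (rule arg_cong[where f = "\<lambda>i. Y ^ i"]) simp
    then have "Y ^ (d + 1) * 1 * (2 * C * z ^ (2 * d + 1)) = 2 * C / Y ^ d"
      using Y by (simp add: z_def power_divide field_simps)
    finally show ?thesis .
  qed
  ultimately show ?thesis using err unfolding C_def by metis
qed

text \<open>For given \<open>q\<close> one chooses \<open>k\<close> and then \<open>d\<close> between \<open>D\<close> and \<open>2 D\<close> such that \<open>2^(2^k d)\<close> just exceeds a multiple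
  of \<open>q\<close>; small \<open>q\<close> are reduced to large ones by scaling with \<open>M\<close>.\<close>
lemma tm_series_half_exponent:
  assumes D: "D \<ge> (1::nat)"
  shows "\<exists>c>0. \<forall>(q::nat) (p::int). q \<ge> 1 \<longrightarrow> \<bar>real q * tm_series (1 / 2) - of_int p\<bar> \<ge> c / real q powr (1 + 7 / D)"
proof -
  define C where "C = pade_const (2 * D)"
  define E where "E = 1 + 7 / real D"
  define \<tau> where "\<tau> = tm_series (1 / 2)"
  have C1: "C \<ge> 1" unfolding C_def by (rule pade_const_ge_1)
  have E0: "E \<ge> 0" by (simp add: E_def)
  define L where "L = nat \<lceil>4 * C\<rceil>"
  have "real L < 2 ^ L" by simp
  moreover have "4 * C \<le> real L" unfolding L_def by linarith
  ultimately have L: "4 * C \<le> 2 ^ L" by linarith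
  have L1: "L \<ge> 1" using \<open>4 * C \<le> real L\<close> C1 by (cases L) auto
  \<comment> \<open>Threshold for large denominators: Q1 >= M gives n > 2 D L, hence K > L and Y =
    2^K >= 4 C.\<close>
  define M :: nat where "M = 2 ^ (2 * D * L)"
  have M0: "M \<ge> 1" by (simp add: M_def)
  define c0 where "c0 = 1 / (8 * C * (8 * C) powr (E + 1))"
  have main: "\<bar>real Q1 * \<tau> - of_int P1\<bar> \<ge> c0 / real Q1 powr E" if Q1: "Q1 \<ge> M" for Q1 :: nat and P1 :: int
  proof -
    have Q0: "real Q1 \<ge> 1" using Q1 M0 by linarith
    define x where "x = \<bar>real Q1 * \<tau> - of_int P1\<bar>"
    have ex: "\<exists>n. 4 * C * Q1 \<le> 2 ^ n" using real_arch_pow[of 2 "4 * C * Q1"] by (auto intro: less_imp_le)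
    define n where "n = (LEAST n. 4 * C * Q1 \<le> 2 ^ n)"
    have n: "4 * C * Q1 \<le> 2 ^ n" unfolding n_def using ex by (rule LeastI_ex)
    have CQ: "1 * 1 \<le> C * real Q1" using C1 Q0 by (intro mult_mono) auto
    have n0: "n \<noteq> 0" using n CQ by (intro notI) simp
    have "\<not> 4 * C * Q1 \<le> 2 ^ (n - 1)" using n0 unfolding n_def by (intro not_less_Least) simp
    then have n2: "2 ^ n \<le> 8 * C * Q1" using n0 by (cases n) auto
    have "1 * real M < 4 * C * real Q1" using C1 Q1 Q0 M0
      by (intro mult_less_le_imp_less) auto
    moreover have "real M = 2 ^ (2 * D * L)" by (simp add: M_def)
    ultimately have "(2::real) ^ (2 * D * L) < 2 ^ n" using n by linarith
    then have nL: "2 * D * L < n" by (rule power_less_imp_less_exp[rotated]) simp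
    have "2 * D * 1 \<le> 2 * D * L" using L1 by (intro mult_le_mono2)
    then have nD: "D \<le> n" using nL by linarith
    then have "n div D \<ge> 1" using D by (simp add: div_greater_zero_iff Suc_leI)
    then obtain k where k: "2 ^ k \<le> n div D" "n div D < 2 ^ (k + 1)" using ex_power_ivl1[of 2 "n div D"] by auto
    define K :: nat where "K = 2 ^ k"
    have K0: "K \<ge> 1" by (simp add: K_def)
    have KD: "K * D \<le> n" using k(1) D by (simp add: K_def less_eq_div_iff_mult_less_eq)
    have nK: "n < 2 * K * D" using k(2) D by (simp add: K_def div_less_iff_less_mult)
    \<comment> \<open>The quotient n/K rounded up. It is at most 2 D because n < 2 K D, so the
      single constant \<open>C\<close> covers every degree that can occur.\<close>
    define d where "d = (n + K - 1) div K"
    have Kd: "n \<le> K * d" "K * d \<le> n + K - 1"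
    proof -
      have "K * d + (n + K - 1) mod K = n + K - 1" unfolding d_def by simp
      moreover have "(n + K - 1) mod K < K" using K0 by simp
      ultimately show "n \<le> K * d" "K * d \<le> n + K - 1" using K0 by linarith+
    qed
    have "K * d < K * (2 * D + 1)" using Kd nK K0 by (simp add: algebra_simps)
    then have "d < 2 * D + 1" by (simp only: mult_less_cancel1)
    then have d2: "d \<le> 2 * D" by simp
    have "2 * K * D = 2 * D * K" by simp
    then have "(2 * D) * L < (2 * D) * K" using nL nK by linarith
    then have "L < K" by (simp only: mult_less_cancel1)
    then have "L \<le> K" by simp
    then have YL: "4 * C \<le> 2 ^ K" using L power_increasing[of L K "2::real"] by linarith
    define Y where "Y = (2::real) ^ (2 ^ k)"
    have YK: "Y = 2 ^ K" by (simp add: Y_def K_def)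
    have Y1: "Y \<ge> 1" by (simp add: Y_def)
    have pC: "pade_const d \<le> C" unfolding C_def by (rule pade_const_mono[OF d2])
    then have "4 * pade_const d \<le> 2 ^ (2 ^ k)" using YL YK by (simp add: Y_def)
    from tm_series_half_approx[OF this]
    obtain q p :: int where qp: "\<bar>of_int q\<bar> \<le> pade_const d * Y ^ (d + 1)" "(1 / 8) / Y ^ (d + 4) \<le> \<bar>of_int q * \<tau> - of_int p\<bar>"
        "\<bar>of_int q * \<tau> - of_int p\<bar> \<le> 2 * pade_const d / Y ^ d"
      unfolding Y_def \<tau>_def by blast
    have q: "\<bar>of_int q\<bar> \<le> C * Y ^ (d + 1)"
      by (rule order_trans[OF qp(1)]) (use pC Y1 in \<open>auto intro: mult_right_mono\<close>)
    have Yd: "2 ^ n \<le> Y ^ d" unfolding YK power_mult[symmetric] using Kd by (intro power_increasing) auto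
    have err: "real Q1 * \<bar>of_int q * \<tau> - of_int p\<bar> \<le> 1 / 2"
    proof -
      have "\<bar>of_int q * \<tau> - of_int p\<bar> \<le> 2 * C / Y ^ d"
        by (rule order_trans[OF qp(3)]) (use pC Y1 in \<open>auto intro: divide_right_mono\<close>)
      also have "\<dots> \<le> 2 * C / (4 * C * Q1)"
        using n Yd C1 Q0 Y1 by (intro divide_left_mono mult_pos_pos) auto
      finally have "\<bar>of_int q * \<tau> - of_int p\<bar> \<le> 1 / (2 * real Q1)" using C1 by simp
      then have "real Q1 * \<bar>of_int q * \<tau> - of_int p\<bar> \<le> real Q1 * (1 / (2 * real Q1))"
        by (intro mult_left_mono) auto
      then show ?thesis using Q0 by simp
    qed
    have qx: "\<bar>of_int q\<bar> * x \<le> C * Y ^ (d + 1) * x"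
      using q by (intro mult_right_mono) (auto simp: x_def)
    \<comment> \<open>For proportional pairs the determinant vanishes and the lower bound for the
      Pade error is used. Otherwise the determinant is a nonzero integer, of which the Pade error
      accounts for at most 1/2.\<close>
    have low: "real Q1 / 8 / Y ^ (d + 4) \<le> C * Y ^ (d + 1) * x"
    proof (cases "q * P1 = int Q1 * p")
      case True
      then have "of_int q * of_int P1 = real Q1 * of_int p" by (metis of_int_mult of_int_of_nat_eq)
      then have "of_int q * (real Q1 * \<tau> - of_int P1) = real Q1 * (of_int q * \<tau> - of_int p)"
        by (simp add: algebra_simps)
      then have "\<bar>of_int q\<bar> * x = real Q1 * \<bar>of_int q * \<tau> - of_int p\<bar>"
        unfolding x_def by (metis abs_mult abs_of_nat)
      also have "\<dots> \<ge> real Q1 * ((1 / 8) / Y ^ (d + 4))" using qp(2) by (intro mult_left_mono) auto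
      finally show ?thesis using qx by simp
    next
      case False
      then have "q * P1 - int Q1 * p \<noteq> 0" by simp
      then have "1 \<le> \<bar>real_of_int (q * P1 - int Q1 * p)\<bar>" by linarith
      also have "real_of_int (q * P1 - int Q1 * p)
          = real Q1 * (of_int q * \<tau> - of_int p) - of_int q * (real Q1 * \<tau> - of_int P1)"
        by (simp add: algebra_simps)
      also have "\<bar>\<dots>\<bar> \<le> \<bar>real Q1 * (of_int q * \<tau> - of_int p)\<bar> + \<bar>of_int q * (real Q1 * \<tau> - of_int P1)\<bar>"
        by (rule abs_triangle_ineq4)
      also have "\<dots> = real Q1 * \<bar>of_int q * \<tau> - of_int p\<bar> + \<bar>of_int q\<bar> * x"
        by (simp add: abs_mult x_def)
      finally have "1 / 2 \<le> C * Y ^ (d + 1) * x" using err qx by linarith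
      moreover have "real Q1 / 8 / Y ^ (d + 4) \<le> 1 / 2"
      proof -
        have "real Q1 \<le> 4 * C * Q1" using mult_right_mono[of 1 "4 * C" "real Q1"] C1 by simp
        also have "\<dots> \<le> Y ^ d" using n Yd by linarith
        also have "\<dots> \<le> Y ^ (d + 4)" using Y1 by (intro power_increasing) auto
        finally have "real Q1 / 8 \<le> 1 / 2 * Y ^ (d + 4)" by simp
        then show ?thesis using Y1 by (simp add: divide_le_eq)
      qed
      ultimately show ?thesis by linarith
    qed
    have Ye: "Y ^ (2 * d + 5) \<le> (8 * C * Q1) powr (E + 1)"
    proof -
      have "Y ^ (2 * d + 5) = 2 powr (K * (2 * d + 5))"
        unfolding YK power_mult[symmetric] by (subst powr_realpow) auto
      \<comment> \<open>Rounding up gives K d <= n + K, so K (2 d + 5) <= 2 n + 7 K, and K <= n/D.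
        This is the origin of the 7 in the exponent.\<close>
      also have "\<dots> \<le> 2 powr (n * (E + 1))"
      proof (rule powr_mono)
        have "real (K * d) \<le> real (n + K)" using Kd by (intro of_nat_mono) linarith
        then have 1: "real K * real d \<le> real n + real K" by simp
        have "real (K * D) \<le> real n" using KD by (intro of_nat_mono)
        then have 2: "real K \<le> real n / real D" using D by (simp add: field_simps)
        have "real K * (2 * real d + 5) = 2 * (real K * real d) + 5 * real K" by (simp add: algebra_simps)
        also have "\<dots> \<le> 2 * real n + 7 * (real n / real D)" using 1 2 by linarith
        also have "\<dots> = real n * (E + 1)" using D by (simp add: E_def field_simps)
        finally show "real (K * (2 * d + 5)) \<le> real n * (E + 1)" by simp
      qed simp
      also have "\<dots> = (2 ^ n) powr (E + 1)" by (simp add: powr_powr flip: powr_realpow)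
      also have "\<dots> \<le> (8 * C * Q1) powr (E + 1)" using n2 E0 by (intro powr_mono2) auto
      finally show ?thesis .
    qed
    have "Y ^ (2 * d + 5) = Y ^ (d + 1) * Y ^ (d + 4)"
      unfolding power_add[symmetric] by (rule arg_cong[where f = "\<lambda>i. Y ^ i"]) simp
    then have "real Q1 \<le> 8 * C * Y ^ (2 * d + 5) * x"
      using low Y1 by (simp add: field_simps)
    also have "\<dots> \<le> 8 * C * (8 * C * Q1) powr (E + 1) * x"
      using Ye C1 by (intro mult_right_mono mult_left_mono) (auto simp: x_def)
    also have "(8 * C * Q1) powr (E + 1) = (8 * C) powr (E + 1) * (real Q1 powr E * real Q1)"
      using C1 Q0 by (simp add: powr_mult powr_add)
    finally have "real Q1 * 1 \<le> real Q1 * (8 * C * ((8 * C) powr (E + 1) * real Q1 powr E) * x)"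
      by (simp only: mult_ac mult_1_right)
    then have "1 \<le> 8 * C * ((8 * C) powr (E + 1) * real Q1 powr E) * x"
      by (rule mult_left_le_imp_le) (use Q0 in linarith)
    then show ?thesis unfolding x_def[symmetric] c0_def using C1 Q0 by (simp add: field_simps)
  qed
  define c where "c = c0 / (real M * real M powr E)"
  have c0: "c0 > 0" using C1 by (simp add: c0_def)
  have "c / real q powr E \<le> \<bar>real q * \<tau> - of_int p\<bar>" if q: "q \<ge> 1" for q :: nat and p :: int
  proof -
    have "c0 / real (M * q) powr E \<le> \<bar>real (M * q) * \<tau> - of_int (int M * p)\<bar>"
      using q M0 by (intro main) simp
    also have "real (M * q) * \<tau> - of_int (int M * p) = real M * (real q * \<tau> - of_int p)"
      by (simp add: algebra_simps)
    also have "\<bar>\<dots>\<bar> = real M * \<bar>real q * \<tau> - of_int p\<bar>" by (simp add: abs_mult)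
    finally have "c0 / real (M * q) powr E / real M \<le> real M * \<bar>real q * \<tau> - of_int p\<bar> / real M"
      by (intro divide_right_mono) auto
    also have "\<dots> = \<bar>real q * \<tau> - of_int p\<bar>" using M0 by simp
    also have "real (M * q) powr E = real M powr E * real q powr E" by (simp add: powr_mult)
    finally have "c0 / (real M powr E * real q powr E) / real M \<le> \<bar>real q * \<tau> - of_int p\<bar>" .
    then show ?thesis by (simp add: c_def mult_ac)
  qed
  moreover have "c > 0" using c0 M0 by (simp add: c_def)
  ultimately show ?thesis unfolding E_def \<tau>_def by blast
qed

lemma gamma_tm_series: "4 * gamma = 2 + tm_series (1 / 2)"
proof -
  have "(\<lambda>n. tm_sign n * (1 / 2) ^ n + (1 / 2) ^ n) sums (tm_series (1 / 2) + 1 / (1 - 1 / 2))"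
    by (intro sums_add tm_series_sums geometric_sums) auto
  then have "(\<lambda>n. (tm_sign n * (1 / 2) ^ n + (1 / 2) ^ n) / 4) sums ((tm_series (1 / 2) + 2) / 4)"
    by (intro sums_divide) simp
  moreover have "(tm_sign n * (1 / 2) ^ n + (1 / 2) ^ n) / 4 = (1 - real (thue_morse n)) / 2 ^ (n + 1)" for n
    by (simp add: tm_sign_eq power_divide field_simps)
  ultimately have "gamma = (tm_series (1 / 2) + 2) / 4" unfolding gamma_def by (simp add: sums_iff)
  then show ?thesis by simp
qed

lemma gamma_exponent:
  assumes D: "D \<ge> (1::nat)"
  shows "\<exists>c>0. \<forall>(q::nat) (p::int). q \<ge> 1 \<longrightarrow> \<bar>real q * gamma - of_int p\<bar> \<ge> c / real q powr (1 + 7 / D)"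
proof -
  obtain c where c: "c > 0" "\<And>(q::nat) (p::int). q \<ge> 1 \<Longrightarrow> \<bar>real q * tm_series (1 / 2) - of_int p\<bar> \<ge> c / real q powr (1 + 7 / D)"
    using tm_series_half_exponent[OF D] by blast
  have "(c / 4) / real q powr (1 + 7 / D) \<le> \<bar>real q * gamma - of_int p\<bar>" if "q \<ge> 1" for q :: nat and p :: int
  proof -
    have "c / real q powr (1 + 7 / D) \<le> \<bar>real q * tm_series (1 / 2) - of_int (4 * p - 2 * int q)\<bar>"
      by (rule c(2)[OF that])
    also have "real q * tm_series (1 / 2) - of_int (4 * p - 2 * int q) = 4 * (real q * gamma - of_int p)"
    proof -
      have eq: "tm_series (1 / 2) = 4 * gamma - 2" using gamma_tm_series by simp
      show ?thesis unfolding eq by (simp add: algebra_simps)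
    qed
    finally show ?thesis by (simp add: abs_mult)
  qed
  then show ?thesis using c(1) by (intro exI[of _ "c / 4"]) auto
qed

section \<open>Bounds for alpha\<close>

lemma kronecker_bigo:
  assumes "c > 0" "\<delta> \<ge> 0"
    and "\<And>(q::nat) (p::int). q \<ge> 1 \<Longrightarrow> \<bar>real q * \<theta> - p\<bar> \<ge> c / real q powr (1 + \<delta>)"
  shows "(\<lambda>N. real N * star_discrepancy (\<lambda>n. frac (real n * \<theta>)) N)
    \<in> O(\<lambda>N. real N powr \<delta> * (1 + log 2 (real N)))"
proof (rule bigoI[where c = "3 / c"])
  show "\<forall>\<^sub>F N in sequentially. norm (real N * star_discrepancy (\<lambda>n. frac (real n * \<theta>)) N)
      \<le> 3 / c * norm (real N powr \<delta> * (1 + log 2 (real N)))"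
  proof (rule eventually_sequentiallyI[of 1])
    fix N :: nat assume N: "1 \<le> N"
    have "real N * star_discrepancy (\<lambda>n. frac (real n * \<theta>)) N \<le> 3 / c * real N powr \<delta> * (1 + log 2 (real N))"
      by (intro kronecker_star_discrepancy_le rotation_dev_diophantine assms N)
    moreover have "0 \<le> log 2 (real N)" using N by simp
    ultimately show "norm (real N * star_discrepancy (\<lambda>n. frac (real n * \<theta>)) N)
      \<le> 3 / c * norm (real N powr \<delta> * (1 + log 2 (real N)))"
      using star_discrepancy_nonneg[of N "\<lambda>n. frac (real n * \<theta>)"] by (simp add: abs_mult mult.assoc)
  qed
qed

lemma alpha_exponent: "q \<ge> 1 \<Longrightarrow> \<bar>real q * alpha - of_int p\<bar> \<ge> (1 / 7776) / real q powr (1 + 0)" for q :: nat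
  using alpha_badly_approximable[of q p] by simp

lemma kronecker_alpha:
  "(\<lambda>N. real N * star_discrepancy (\<lambda>n. frac (real n * alpha)) N) \<in> O(\<lambda>N. ln (real N))"
proof -
  have "(\<lambda>N. real N * star_discrepancy (\<lambda>n. frac (real n * alpha)) N)
    \<in> O(\<lambda>N. real N powr 0 * (1 + log 2 (real N)))"
    using alpha_exponent by (intro kronecker_bigo[where c = "1 / 7776"]) auto
  also have "(\<lambda>N. real N powr 0 * (1 + log 2 (real N))) \<in> O(\<lambda>N. ln (real N))"
    by real_asymp
  finally show ?thesis .
qed

lemma odd_bnum: "odd (bnum k)"
  by (induction k) (auto simp: bden_def)

text \<open>These are numerator and denominator of 2/3 + bnum k / bden k. The numerator is odd, and
  it is prime to 3 because bden k is a power of 4.\<close>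

lemma coprime_alpha_num:
  "coprime (2 * int (bden k) + 3 * int (bnum k)) (int (3 * bden k))"
proof -
  let ?P = "2 * int (bden k) + 3 * int (bnum k)"
  have "odd ?P" using odd_bnum[of k] by simp
  then have "coprime ?P 2" by (simp add: coprime_right_2_iff_odd)
  then have "coprime ?P (2 ^ (2 * 2 ^ Suc k))" by simp
  moreover have "int (bden k) = 2 ^ (2 * 2 ^ Suc k)" by (simp add: bden_def power_mult)
  ultimately have 1: "coprime ?P (int (bden k))" by simp
  have m: "int (bden k) mod 3 = 1" using power_mod[of "4::int" 3 "2 ^ Suc k"] by (simp add: bden_def)
  have "\<not> 3 dvd ?P"
  proof
    assume "3 dvd ?P"
    then have "3 dvd 2 * int (bden k)" by (simp add: dvd_add_left_iff)
    then show False using m by presburger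
  qed
  then have "coprime 3 ?P" by (intro prime_imp_coprime) auto
  then show ?thesis using 1 by (simp add: coprime_commute)
qed

text \<open>Successive \<open>bden\<close> are squares of each other, so the first one above 100 N
  may be as large as (100 N)^2. This is harmless because Q enters only through its logarithm. The
  factor 100 ensures 12 N < bden k, the accuracy asked for by \<open>tm_dev_bound\<close>.\<close>

lemma tm_dev_alpha_le:
  assumes N: "N \<ge> 1" and a: "a \<in> {0..1}"
  shows "\<bar>tm_dev alpha (2 * N) a\<bar> \<le> (3 + 2 * ln (30000 * real N ^ 2)) * (6 * real (2 * N) powr (ln 3 / ln 4)) + 1"
proof -
  have ex: "\<exists>k. bden k \<ge> 100 * N" by (rule bden_unbounded)
  define k where "k = (LEAST k. bden k \<ge> 100 * N)"
  have k: "bden k \<ge> 100 * N" unfolding k_def using ex by (rule LeastI_ex)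
  have k2: "bden k \<le> (100 * N) ^ 2"
  proof (cases k)
    case 0
    have "bden k = 16" using 0 by (simp add: bden_def)
    also have "\<dots> \<le> (100 * 1) ^ 2" by simp
    also have "\<dots> \<le> (100 * N) ^ 2" using N by (intro power_mono mult_le_mono2) auto
    finally show ?thesis .
  next
    case (Suc j)
    have "\<not> bden j \<ge> 100 * N" using Suc unfolding k_def by (intro not_less_Least) simp
    then show ?thesis unfolding Suc bden_Suc by (intro power_mono) auto
  qed
  define Q where "Q = 3 * bden k"
  define P where "P = 2 * int (bden k) + 3 * int (bnum k)"
  define b where "b = real (bden k)"
  have b: "b \<ge> 100 * real N" "b > 0" using k N unfolding b_def by (linarith, simp add: bden_def)
  have eq: "alpha - P / Q = beta - bnum k / bden k"
    using b(2) unfolding b_def by (simp add: alpha_beta P_def Q_def field_simps)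
  have Q: "ln (real Q) \<le> ln (30000 * real N ^ 2)"
  proof -
    have "real (bden k) \<le> (100 * real N) ^ 2" using k2 by (metis of_nat_le_iff of_nat_mult of_nat_numeral of_nat_power)
    then have "real Q \<le> 30000 * real N ^ 2" by (simp add: Q_def power2_eq_square)
    moreover have "real Q > 0" using b by (simp add: Q_def b_def)
    ultimately show ?thesis by (intro ln_mono)
  qed
  have "\<bar>tm_dev alpha (2 * N) a\<bar> \<le> (3 + 2 * ln Q) * (6 * real (2 * N) powr (ln 3 / ln 4)) + 1"
  proof (rule tm_dev_bound)
    show "1 \<le> 2 * N" "2 * N \<le> Q" using N k by (auto simp: Q_def)
    show "coprime P (int Q)" unfolding P_def Q_def by (rule coprime_alpha_num)
    show "0 \<le> alpha - P / Q" unfolding eq using beta_bounds(1)[of k] by simp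
    have "real (2 * N) * (alpha - P / Q) \<le> real (2 * N) * (2 / b^2)"
      unfolding eq b_def by (intro mult_left_mono beta_bounds(2)) auto
    also have "\<dots> < 1 / (3 * b)" using b N by (simp add: field_simps power2_eq_square)
    finally show "real (2 * N) * (alpha - P / Q) < 1 / Q" by (simp add: Q_def b_def)
  qed (rule a)
  also have "\<dots> \<le> (3 + 2 * ln (30000 * real N ^ 2)) * (6 * real (2 * N) powr (ln 3 / ln 4)) + 1"
    using Q by (intro add_mono mult_right_mono mult_left_mono) auto
  finally show ?thesis .
qed

lemma thue_morse_alpha_upper:
  assumes e: "\<epsilon> > 0"
  shows "(\<lambda>N. real N * star_discrepancy (\<lambda>k. frac (real (thue_morse_integer k) * alpha)) N)
     \<in> O(\<lambda>N. real N powr (ln 3 / ln 4 + \<epsilon>))"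
proof -
  define \<kappa> :: real where "\<kappa> = ln 3 / ln 4"
  have \<kappa>: "\<kappa> > 0" by (simp add: \<kappa>_def)
  define B where "B = (\<lambda>N::nat. 3 * 7776 * (1 + log 2 (real (2 * N))) + ((3 + 2 * ln (30000 * real N ^ 2)) * (6 * real (2 * N) powr \<kappa>) + 1))"
  have "(\<lambda>N. real N * star_discrepancy (\<lambda>k. frac (real (thue_morse_integer k) * alpha)) N) \<in> O(B)"
  proof (rule bigoI[where c = 1], rule eventually_sequentiallyI[of 1])
    fix N :: nat assume N: "1 \<le> N"
    have d: "rotation_dev alpha 0 (2 * N) a \<le> 3 * 7776 * (1 + log 2 (real (2 * N)))" if "a \<in> {0..1}" for a
    proof -
      have "rotation_dev alpha 0 (2 * N) a \<le> 3 / (1 / 7776) * real (2 * N) powr 0 * (1 + log 2 (real (2 * N)))"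
        using that N by (intro rotation_dev_diophantine alpha_exponent) auto
      then show ?thesis using N by simp
    qed
    have "real N * star_discrepancy (\<lambda>k. frac (real (thue_morse_integer k) * alpha)) N \<le> B N / 2"
      unfolding B_def \<kappa>_def using d tm_dev_alpha_le[OF N] by (rule thue_morse_star_discrepancy_le)
    then show "norm (real N * star_discrepancy (\<lambda>k. frac (real (thue_morse_integer k) * alpha)) N) \<le> 1 * norm (B N)"
      using star_discrepancy_nonneg[of N "\<lambda>k. frac (real (thue_morse_integer k) * alpha)"] by simp
  qed
  also have "B \<in> O(\<lambda>N. real N powr (\<kappa> + \<epsilon>))"
    unfolding B_def using e \<kappa> by real_asymp
  finally show ?thesis by (simp add: \<kappa>_def)
qed

section \<open>Products along the binary orbit of alpha\<close>

lemma norm_one_minus_ee_pos: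
  assumes "\<And>p::int. x \<noteq> of_int p"
  shows "norm (1 - ee x) > 0"
proof -
  have "sin (pi * x) \<noteq> 0"
  proof
    assume "sin (pi * x) = 0"
    then obtain k :: int where "pi * x = of_int k * pi" using sin_zero_iff_int2 by blast
    then have "x = of_int k" by simp
    then show False using assms by blast
  qed
  then show ?thesis by (simp add: norm_one_minus_ee)
qed

lemma two_thirds_mod_1: "\<exists>w::int. 2 ^ i * (2 / 3) = of_int w + (if even i then 2 / 3 else 1 / 3 :: real)"
proof (induction i)
  case 0
  show ?case by (rule exI[of _ 0]) simp
next
  case (Suc i)
  then obtain w :: int where w: "2 ^ i * (2 / 3) = of_int w + (if even i then 2 / 3 else 1 / 3 :: real)" by blast
  have "2 ^ Suc i * (2 / 3 :: real) = 2 * (2 ^ i * (2 / 3))" by simp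
  also have "\<dots> = of_int (2 * w + (if even i then 1 else 0)) + (if even (Suc i) then 2 / 3 else 1 / 3)"
    unfolding w by simp
  finally show ?case by blast
qed

lemma bden_eq: "bden j = 2 ^ (2 ^ (j + 2))"
proof -
  have "(4::nat) ^ (2 ^ Suc j) = (2 ^ 2) ^ (2 ^ Suc j)" by simp
  then show ?thesis unfolding bden_def power_mult[symmetric] by simp
qed

text \<open>For i >= 2^(j+2) the partial sum up to j becomes an integer after multiplication by 2^i.
  The remaining tail starts with 2^(-2^(j+3)), which turns into 2^(-d); the later terms add at most
  the fraction 2/256, whence 129/128.\<close>

lemma alpha_dyadic:
  assumes i: "2 ^ (j + 2) \<le> i" "i < 2 ^ (j + 3)"
  defines "d \<equiv> 2 ^ (j + 3) - i"
  shows "\<exists>\<delta>>0. \<delta> \<le> (129 / 128) / 2 ^ d \<and> ee (2 ^ i * alpha) = ee ((if even i then 2 / 3 else 1 / 3) + \<delta>)"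
proof -
  define B where "B = real (bden (Suc j))"
  define \<delta> where "\<delta> = 2 ^ i * (beta - bnum j / bden j)"
  have B: "B = 2 ^ (2 ^ (j + 3))" unfolding B_def bden_eq by (simp add: numeral_3_eq_3)
  have "(2::nat) ^ 3 \<le> 2 ^ (j + 3)" by (intro power_increasing) auto
  then have "(2::real) ^ 8 \<le> 2 ^ (2 ^ (j + 3))" by (intro power_increasing) auto
  then have B256: "B \<ge> 256" by (simp add: B)
  have "i + d = 2 ^ (j + 3)" using i by (simp add: d_def)
  then have iB: "2 ^ i / B = 1 / 2 ^ d" unfolding B by (metis power_add divide_divide_eq_left nonzero_divide_mult_cancel_left power_eq_0_iff zero_neq_numeral)
  have "bden j > 0" by (simp add: bden_def)
  then have st: "real (bnum (Suc j)) / bden (Suc j) = bnum j / bden j + 1 / B"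
    by (simp add: B_def bden_Suc power2_eq_square field_simps)
  have "beta - bnum j / bden j \<le> 1 / B + 2 / B ^ 2"
    using beta_bounds(2)[of "Suc j"] st by (simp only: B_def)
  also have "\<dots> = (1 + 2 / B) / B" using B256 by (simp add: field_simps power2_eq_square)
  also have "\<dots> \<le> (129 / 128) / B" using B256 by (intro divide_right_mono) (auto simp: field_simps)
  finally have "\<delta> \<le> 2 ^ i * ((129 / 128) / B)" unfolding \<delta>_def by (intro mult_left_mono) auto
  also have "\<dots> = (129 / 128) * (2 ^ i / B)" by simp
  finally have "\<delta> \<le> (129 / 128) / 2 ^ d" unfolding iB by simp
  moreover have "\<delta> > 0" unfolding \<delta>_def using beta_bounds(1)[of j] by simp
  moreover have "ee (2 ^ i * alpha) = ee ((if even i then 2 / 3 else 1 / 3) + \<delta>)"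
  proof -
    obtain w :: int where w: "2 ^ i * (2 / 3) = of_int w + (if even i then 2 / 3 else 1 / 3 :: real)"
      using two_thirds_mod_1 by blast
    have "(2::real) ^ i = 2 ^ (2 ^ (j + 2)) * 2 ^ (i - 2 ^ (j + 2))" using i by (simp flip: power_add)
    then have z: "2 ^ i * (bnum j / bden j) = of_int (int (bnum j) * 2 ^ (i - 2 ^ (j + 2)))"
      by (simp add: bden_eq)
    have "2 ^ i * alpha = 2 ^ i * (2 / 3) + 2 ^ i * (bnum j / bden j) + \<delta>"
      by (simp add: alpha_beta \<delta>_def right_diff_distrib distrib_left)
    also have "\<dots> = ((if even i then 2 / 3 else 1 / 3) + \<delta>) + of_int (w + int (bnum j) * 2 ^ (i - 2 ^ (j + 2)))"
      unfolding w z by simp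
    finally show ?thesis by (simp only: ee_add_int)
  qed
  ultimately show ?thesis by blast
qed

lemma norm_one_minus_ee_third: "norm (1 - ee (if b then 2 / 3 else 1 / 3)) = sqrt 3"
proof -
  have "sin (pi * (2 / 3)) = sin (pi * (1 / 3))"
    using sin_pi_minus[of "pi * (1 / 3)"] by (simp add: algebra_simps)
  moreover have a: "sin (pi * (1 / 3)) = sqrt 3 / 2" by (simp add: sin_60)
  ultimately have b: "sin (pi * (2 / 3)) = sqrt 3 / 2" by (simp only:)
  have S: "\<bar>sin (pi * (2 / 3))\<bar> = sqrt 3 / 2" "\<bar>sin (pi * (1 / 3))\<bar> = sqrt 3 / 2"
    unfolding a b by simp_all
  show ?thesis
  proof (cases b)
    case True
    show ?thesis unfolding norm_one_minus_ee if_P[OF True] S by simp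
  next
    case False
    show ?thesis unfolding norm_one_minus_ee if_not_P[OF False] S by simp
  qed
qed

lemma norm_one_minus_ee_perturb: "norm (1 - ee (x + \<delta>)) \<ge> norm (1 - ee x) - 2 * pi * \<bar>\<delta>\<bar>"
proof -
  have "1 - ee x = (1 - ee (x + \<delta>)) - ee x * (1 - ee \<delta>)" by (simp add: ee_add algebra_simps)
  then have "norm (1 - ee x) \<le> norm (1 - ee (x + \<delta>)) + norm (ee x * (1 - ee \<delta>))"
    using norm_triangle_ineq4 by metis
  also have "norm (ee x * (1 - ee \<delta>)) = 2 * \<bar>sin (pi * \<delta>)\<bar>" by (simp add: norm_mult norm_one_minus_ee)
  also have "\<dots> \<le> 2 * \<bar>pi * \<delta>\<bar>" by (intro mult_left_mono abs_sin_x_le_abs_x) auto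
  finally show ?thesis by (simp add: abs_mult)
qed

text \<open>\<open>sqrt 3 * dyadic_factor d\<close> bounds \<open>\<bar>1 - e(2^i \<alpha>)\<bar>\<close> from below when \<open>d\<close> is the distance from \<open>i\<close> to the
  next power of two: the perturbation of \<open>1/3\<close> or \<open>2/3\<close> is at most \<open>(129/128) / 2^d\<close>, and \<open>2 pi \<le> 4 sqrt 3\<close>.\<close>
definition dyadic_factor :: "nat \<Rightarrow> real" where
  "dyadic_factor d = (if d \<le> 3 then 9 / 100 else 1 - (129 / 32) / 2 ^ d)"

lemma sqrt3_bounds: "17 / 10 \<le> sqrt 3" "sqrt 3 \<le> 7 / 4"
  by (rule real_le_rsqrt, simp add: power_divide, rule real_le_lsqrt, simp_all add: power_divide)

lemma alpha_factor_bound: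
  assumes i: "2 ^ (j + 2) \<le> i" "i < 2 ^ (j + 3)"
  defines "d \<equiv> 2 ^ (j + 3) - i"
  shows "norm (1 - ee (2 ^ i * alpha)) \<ge> sqrt 3 * dyadic_factor d"
proof -
  define x :: real where "x = (if even i then 2 / 3 else 1 / 3)"
  obtain \<delta> where \<delta>: "\<delta> > 0" "\<delta> \<le> (129 / 128) / 2 ^ d" "ee (2 ^ i * alpha) = ee (x + \<delta>)"
    using alpha_dyadic[OF i] unfolding d_def x_def by blast
  have d: "d \<ge> 1" "even d = even i" using i by (auto simp: d_def)
  show ?thesis
  proof (cases "d \<le> 3")
    case False
    have "sqrt 3 - 2 * pi * \<bar>\<delta>\<bar> \<le> norm (1 - ee (x + \<delta>))"
      using norm_one_minus_ee_perturb[of x \<delta>] norm_one_minus_ee_third[of "even i"] unfolding x_def by simp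
    moreover have "2 * pi * \<bar>\<delta>\<bar> \<le> 4 * sqrt 3 * \<delta>"
      using \<delta>(1) pi_approx sqrt3_bounds by simp
    moreover have "4 * sqrt 3 * \<delta> \<le> 4 * sqrt 3 * ((129 / 128) / 2 ^ d)"
      using \<delta>(2) by (intro mult_left_mono) auto
    moreover have "sqrt 3 * dyadic_factor d = sqrt 3 - 4 * sqrt 3 * ((129 / 128) / 2 ^ d)"
      using False by (simp add: dyadic_factor_def algebra_simps)
    ultimately show ?thesis unfolding \<delta>(3) by linarith
  next
    case True
    \<comment> \<open>Near a power of two the perturbation is too large for the triangle inequality.
      Since d and i have the same parity, d = 1 and d = 3 start from 1/3 and d = 2 from 2/3, so the
      point stays away from 1. The tightest case is 2/3 + 129/512.\<close>
    have y: "8 / 100 \<le> min (x + \<delta>) (1 - (x + \<delta>)) \<and> 0 \<le> x + \<delta> \<and> x + \<delta> \<le> 1"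
    proof -
      consider "d = 1" "odd i" | "d = 2" "even i" | "d = 3" "odd i" using d True
        by (metis One_nat_def Suc_1 dvd_refl le_Suc_eq le_zero_eq not_less_eq_eq numeral_3_eq_3 odd_Suc_minus_one even_Suc odd_one)
      then show ?thesis using \<delta>(1,2) by cases (auto simp: x_def power2_eq_square power3_eq_cube)
    qed
    then have "sin (pi * (x + \<delta>)) \<ge> 8 / 100" using sin_pi_ge[of "x + \<delta>"] by linarith
    then have "norm (1 - ee (x + \<delta>)) \<ge> 16 / 100" by (simp add: norm_one_minus_ee)
    moreover have "sqrt 3 * dyadic_factor d \<le> 16 / 100" using True sqrt3_bounds by (simp add: dyadic_factor_def)
    ultimately show ?thesis unfolding \<delta>(3) by linarith
  qed
qed

lemma dyadic_factor_nonneg: "dyadic_factor d \<ge> 0"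
proof (cases "d \<le> 3")
  case False
  then have "(2::real) ^ 4 \<le> 2 ^ d" by (intro power_increasing) auto
  then show ?thesis using False by (simp add: dyadic_factor_def field_simps)
qed (simp add: dyadic_factor_def)

lemma prod_dyadic_factor_ge: "(\<Prod>d=1..n. dyadic_factor d) \<ge> 1 / 4000" if "n \<ge> 4"
proof -
  have "{1..n} = {1..3} \<union> {4..n}" using that by auto
  then have "(\<Prod>d=1..n. dyadic_factor d) = (\<Prod>d=1..3. dyadic_factor d) * (\<Prod>d=4..n. dyadic_factor d)"
    by (simp add: prod.union_disjoint)
  also have "(\<Prod>d=1..3. dyadic_factor d) = (9 / 100) ^ 3" by (simp add: dyadic_factor_def numeral_3_eq_3)
  also have "(\<Prod>d=4..n. dyadic_factor d) = (\<Prod>d=4..n. 1 - (129 / 32) / 2 ^ d)"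
    by (intro prod.cong) (auto simp: dyadic_factor_def)
  finally have eq: "(\<Prod>d=1..n. dyadic_factor d) = (9 / 100) ^ 3 * (\<Prod>d=4..n. 1 - (129 / 32) / 2 ^ d)" .
  \<comment> \<open>Weierstrass' product inequality. The sum stays below 129/256, and (9/100)^3 *
    (127/256) exceeds 1/4000.\<close>
  have "1 - (\<Sum>d=4..n. (129 / 32) / 2 ^ d) \<le> (\<Prod>d=4..n. 1 - (129 / 32) / 2 ^ d :: real)"
  proof (rule Weierstrass_prod_ineq)
    fix d assume "d \<in> {4..n}"
    then have "(2::real) ^ 4 \<le> 2 ^ d" by (intro power_increasing) auto
    then show "(129 / 32) / 2 ^ d \<in> {0..1::real}" by (simp add: field_simps)
  qed
  moreover have "(\<Sum>d=4..n. (129 / 32) / 2 ^ d) = (129 / 32) * (1 / 8 - 1 / 2 ^ n :: real)"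
    using that
  proof (induction n rule: nat_induct_at_least)
    case (Suc n)
    have "{4..Suc n} = insert (Suc n) {4..n}" using Suc.hyps by auto
    then show ?case using Suc by simp
  qed simp
  moreover have "(129 / 32) * (1 / 8 - 1 / 2 ^ n :: real) \<le> (129 / 32) * (1 / 8)" by simp
  ultimately have "1 - 129 / 256 \<le> (\<Prod>d=4..n. 1 - (129 / 32) / 2 ^ d :: real)" by linarith
  then have "(9 / 100) ^ 3 * (1 - 129 / 256) \<le> (\<Prod>d=1..n. dyadic_factor d)"
    unfolding eq by (intro mult_left_mono) auto
  then show ?thesis by (simp add: power3_eq_cube)
qed

text \<open>Over the block the distances d run through 1, ..., 2^(j+2) once each, so the loss
  against the ideal power of sqrt 3 is bounded independently of j.\<close>

lemma alpha_block_product: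
  "(\<Prod>i\<in>{2 ^ (j + 2)..<2 ^ (j + 3)}. norm (1 - ee (2 ^ i * alpha))) \<ge> (1 / 4000) * sqrt 3 ^ (2 ^ (j + 2))"
proof -
  let ?n = "2 ^ (j + 2) :: nat"
  have n2: "2 ^ (j + 3) = 2 * ?n" by (simp add: numeral_3_eq_3)
  have "(2::nat) ^ 2 \<le> ?n" by (intro power_increasing) auto
  then have "1 / 4000 \<le> (\<Prod>d=1..?n. dyadic_factor d)" by (intro prod_dyadic_factor_ge) simp
  then have "(1 / 4000) * sqrt 3 ^ ?n \<le> (\<Prod>d=1..?n. dyadic_factor d) * sqrt 3 ^ ?n"
    by (intro mult_right_mono) auto
  also have "\<dots> = (\<Prod>d=1..?n. sqrt 3 * dyadic_factor d)" by (simp add: prod.distrib)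
  also have "\<dots> = (\<Prod>i\<in>{?n..<2 * ?n}. sqrt 3 * dyadic_factor (2 * ?n - i))"
    by (rule prod.reindex_bij_witness[where i = "\<lambda>i. 2 * ?n - i" and j = "\<lambda>d. 2 * ?n - d"]) auto
  also have "\<dots> \<le> (\<Prod>i\<in>{?n..<2 * ?n}. norm (1 - ee (2 ^ i * alpha)))"
    using alpha_factor_bound[of j] n2 dyadic_factor_nonneg by (intro prod_mono) auto
  finally show ?thesis unfolding n2 .
qed

lemma alpha_not_int: "q \<ge> (1::nat) \<Longrightarrow> real q * alpha \<noteq> of_int p"
  using alpha_badly_approximable[of q p] by (auto simp: divide_le_0_iff)

text \<open>The loss 4000^(-j) over 2^(j+2) factors is only a power of log N when N is about
  2^(2^(j+2)). The first four factors lie outside the blocks and enter through the constant c; 9 is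
  sqrt 3 ^ 4.\<close>

lemma alpha_product:
  "\<exists>c>0. \<forall>j. (\<Prod>i<2 ^ (j + 2). norm (1 - ee (2 ^ i * alpha))) \<ge> c * (1 / 4000) ^ j * sqrt 3 ^ (2 ^ (j + 2))"
proof -
  define c where "c = (\<Prod>i<4. norm (1 - ee (2 ^ i * alpha))) / 9"
  have "0 < (\<Prod>i<4. norm (1 - ee (2 ^ i * alpha)))"
  proof (rule prod_pos, rule norm_one_minus_ee_pos)
    fix i :: nat and p :: int
    show "2 ^ i * alpha \<noteq> of_int p" using alpha_not_int[of "2 ^ i" p] by simp
  qed
  then have c: "c > 0" by (simp add: c_def)
  have "(\<Prod>i<2 ^ (j + 2). norm (1 - ee (2 ^ i * alpha))) \<ge> c * (1 / 4000) ^ j * sqrt 3 ^ (2 ^ (j + 2))" for j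
  proof (induction j)
    case 0
    have "sqrt 3 ^ 4 = 9" by (simp add: eval_nat_numeral)
    then show ?case by (simp add: c_def)
  next
    case (Suc j)
    let ?n = "2 ^ (j + 2) :: nat"
    have n2: "2 ^ (Suc j + 2) = 2 * ?n" "2 ^ (j + 3) = 2 * ?n" by (simp_all add: numeral_3_eq_3)
    have "c * (1 / 4000) ^ Suc j * sqrt 3 ^ (2 * ?n) = (c * (1 / 4000) ^ j * sqrt 3 ^ ?n) * ((1 / 4000) * sqrt 3 ^ ?n)"
      by (simp add: mult_2 power_add)
    also have "\<dots> \<le> (\<Prod>i<?n. norm (1 - ee (2 ^ i * alpha))) * (\<Prod>i\<in>{?n..<2 * ?n}. norm (1 - ee (2 ^ i * alpha)))"
      using Suc alpha_block_product[of j] c unfolding n2 by (intro mult_mono prod_nonneg) auto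
    also have "\<dots> = (\<Prod>i\<in>{..<?n} \<union> {?n..<2 * ?n}. norm (1 - ee (2 ^ i * alpha)))"
      by (subst prod.union_disjoint) auto
    also have "{..<?n} \<union> {?n..<2 * ?n} = {..<2 * ?n}" by auto
    finally show ?case unfolding n2 .
  qed
  then show ?thesis using c by blast
qed

lemma infinitely_often_OmegaI:
  assumes c: "c > 0" and ev: "eventually (\<lambda>j. F (g j) \<ge> c * h (g j)) sequentially" and g: "filterlim g at_top sequentially"
  shows "infinitely_often_Omega F h"
proof -
  have "\<exists>\<^sub>\<infinity>N. F N \<ge> c * h N"
    unfolding INFM_nat
  proof
    fix m
    have "eventually (\<lambda>j. g j > m) sequentially"
      using g unfolding filterlim_at_top by (auto simp: Suc_le_eq[symmetric])
    with ev have "eventually (\<lambda>j. F (g j) \<ge> c * h (g j) \<and> g j > m) sequentially" by eventually_elim auto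
    then show "\<exists>n>m. F n \<ge> c * h n" by (auto simp: eventually_sequentially)
  qed
  then show ?thesis using c unfolding infinitely_often_Omega_def by blast
qed

lemma thue_morse_alpha_lower:
  assumes e: "\<epsilon> > 0"
  shows "infinitely_often_Omega
     (\<lambda>N. real N * star_discrepancy (\<lambda>k. frac (real (thue_morse_integer k) * alpha)) N)
     (\<lambda>N. real N powr (ln 3 / ln 4 - \<epsilon>))"
proof -
  obtain c where c: "c > 0" and prod:
      "\<And>j. (\<Prod>i<2 ^ (j + 2). norm (1 - ee (2 ^ i * alpha))) \<ge> c * (1 / 4000) ^ j * sqrt 3 ^ (2 ^ (j + 2))"
    using alpha_product by blast
  define A where "A = 2 / norm (1 - ee alpha)"
  define l where "l = (\<lambda>j. 2 ^ (j + 2) - 1 :: nat)"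
  let ?D = "\<lambda>N. star_discrepancy (\<lambda>k. frac (real (thue_morse_integer k) * alpha)) N"
  have Sl: "Suc (l j) = 2 ^ (j + 2)" for j by (simp add: l_def)
  have rl: "real (l j) = 2 ^ (j + 2) - 1" for j by (simp add: l_def of_nat_diff)
  have irr: "ee (real 1 * alpha) \<noteq> 1"
    using norm_one_minus_ee_pos[of alpha] alpha_not_int[of 1] by auto
  have lower: "real (2 ^ l j) * ?D (2 ^ l j) \<ge> (c * (1 / 4000) ^ j * sqrt 3 ^ (2 ^ (j + 2)) - A) / (4 * pi)" for j
  proof -
    have "((\<Prod>i<Suc (l j). norm (1 - ee (2 ^ i * (real 1 * alpha)))) - 2 / norm (1 - ee (real 1 * alpha))) / (4 * pi * real 1)
        \<le> 2 ^ l j * ?D (2 ^ l j)"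
      by (rule thue_morse_star_discrepancy_ge) (use irr in auto)
    moreover have "(c * (1 / 4000) ^ j * sqrt 3 ^ (2 ^ (j + 2)) - A) / (4 * pi)
        \<le> ((\<Prod>i<Suc (l j). norm (1 - ee (2 ^ i * (real 1 * alpha)))) - 2 / norm (1 - ee (real 1 * alpha))) / (4 * pi * real 1)"
      using prod[of j] unfolding Sl A_def by (simp add: divide_right_mono)
    ultimately show ?thesis by simp
  qed
  have N: "real (2 ^ l j) powr (ln 3 / ln 4 - \<epsilon>) \<le> sqrt 3 ^ (2 ^ (j + 2)) * 2 powr (- \<epsilon> * (2 ^ (j + 2) - 1))" for j
  proof -
    have l4: "ln (4::real) = 2 * ln 2" using ln_realpow[of 2 2] by simp
    have "real (2 ^ l j) powr (ln 3 / ln 4) = exp (real (l j) * ln (sqrt 3))"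
      by (simp add: powr_def ln_realpow ln_sqrt l4)
    also have "\<dots> = sqrt 3 ^ l j" by (simp add: exp_of_nat_mult)
    also have "\<dots> \<le> sqrt 3 ^ (2 ^ (j + 2))" by (intro power_increasing) (auto simp: l_def)
    finally have 1: "real (2 ^ l j) powr (ln 3 / ln 4) \<le> sqrt 3 ^ (2 ^ (j + 2))" .
    have "real (2 ^ l j) powr (- \<epsilon>) = (2 powr real (l j)) powr (- \<epsilon>)" by (simp add: powr_realpow)
    also have "\<dots> = 2 powr (- \<epsilon> * (2 ^ (j + 2) - 1))" by (simp add: powr_powr rl mult.commute)
    finally have 2: "real (2 ^ l j) powr (- \<epsilon>) = 2 powr (- \<epsilon> * (2 ^ (j + 2) - 1))" .
    have "real (2 ^ l j) powr (ln 3 / ln 4 - \<epsilon>) = real (2 ^ l j) powr (ln 3 / ln 4) * real (2 ^ l j) powr (- \<epsilon>)"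
      by (simp flip: powr_add)
    then show ?thesis unfolding 2 using 1 by (simp add: mult_right_mono)
  qed
  \<comment> \<open>With n = 2^(j+2), sqrt 3 ^ n is at least 2^(n/2). A factor of about 2^(n/4) pays
    for 4000^(-j), and the remaining one outgrows the constant A left by the geometric sum.\<close>
  have ev1: "eventually (\<lambda>j::nat. A \<le> c / 2 * (1 / 4000) ^ j * sqrt 3 ^ (2 ^ (j + 2))) sequentially"
  proof -
    have "filterlim (\<lambda>j::nat. c / 2 * 2 powr (1 / 4 * 2 ^ (j + 2))) at_top sequentially"
      using c by real_asymp
    then have "eventually (\<lambda>j::nat. A \<le> c / 2 * 2 powr (1 / 4 * 2 ^ (j + 2))) sequentially"
      by (simp add: filterlim_at_top)
    moreover have "eventually (\<lambda>j::nat. 2 powr (- (1 / 4) * (2 ^ (j + 2) - 1)) \<le> (1 / 4000 :: real) ^ j) sequentially"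
      by real_asymp
    ultimately show ?thesis
    proof eventually_elim
      case (elim j)
      have "2 powr (1 / 4 * 2 ^ (j + 2)) \<le> 2 powr (- (1 / 4) * (2 ^ (j + 2) - 1) + 1 / 2 * 2 ^ (j + 2) :: real)"
        by (intro powr_mono) auto
      also have "\<dots> = 2 powr (- (1 / 4) * (2 ^ (j + 2) - 1)) * 2 powr (1 / 2 * 2 ^ (j + 2))"
        by (rule powr_add)
      also have "\<dots> \<le> (1 / 4000) ^ j * sqrt 3 ^ (2 ^ (j + 2))"
      proof (intro mult_mono elim(2))
        have "(2 :: real) powr (1 / 2 * 2 ^ (j + 2)) = (2 powr (1 / 2)) powr (2 ^ (j + 2))"
          by (simp only: powr_powr)
        also have "\<dots> = sqrt 2 ^ (2 ^ (j + 2))" by (simp add: powr_half_sqrt flip: powr_realpow)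
        also have "\<dots> \<le> sqrt 3 ^ (2 ^ (j + 2))" by (intro power_mono) auto
        finally show "(2 :: real) powr (1 / 2 * 2 ^ (j + 2)) \<le> sqrt 3 ^ (2 ^ (j + 2))" .
      qed auto
      finally have "c / 2 * 2 powr (1 / 4 * 2 ^ (j + 2)) \<le> c / 2 * ((1 / 4000) ^ j * sqrt 3 ^ (2 ^ (j + 2)))"
        using c by (intro mult_left_mono) auto
      then show ?case using elim(1) by (simp only: mult.assoc)
    qed
  qed
  have ev2: "eventually (\<lambda>j::nat. 2 powr (- \<epsilon> * (2 ^ (j + 2) - 1)) \<le> (1 / 4000) ^ j) sequentially"
    using e by real_asymp
  show ?thesis
  proof (rule infinitely_often_OmegaI[where c = "c / 2 / (4 * pi)" and g = "\<lambda>j. 2 ^ l j"])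
    show "c / 2 / (4 * pi) > 0" using c by simp
    show "\<forall>\<^sub>F j in sequentially. c / 2 / (4 * pi) * real (2 ^ l j) powr (ln 3 / ln 4 - \<epsilon>) \<le> real (2 ^ l j) * ?D (2 ^ l j)"
      using ev1 ev2
    proof eventually_elim
      case (elim j)
      have "c / 2 * real (2 ^ l j) powr (ln 3 / ln 4 - \<epsilon>) \<le> c / 2 * (sqrt 3 ^ (2 ^ (j + 2)) * (1 / 4000) ^ j)"
        using N[of j] elim(2) c by (intro mult_left_mono order_trans[OF N[of j]]) auto
      also have "\<dots> \<le> c * (1 / 4000) ^ j * sqrt 3 ^ (2 ^ (j + 2)) - A"
        using elim(1) by (simp add: algebra_simps)
      finally have "c / 2 * real (2 ^ l j) powr (ln 3 / ln 4 - \<epsilon>) / (4 * pi)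
          \<le> (c * (1 / 4000) ^ j * sqrt 3 ^ (2 ^ (j + 2)) - A) / (4 * pi)"
        by (intro divide_right_mono) auto
      then show ?case using lower[of j] by simp
    qed
    show "filterlim (\<lambda>j. 2 ^ l j :: nat) at_top sequentially"
    proof (rule filterlim_at_top_mono[OF filterlim_ident], rule always_eventually, rule allI)
      fix j :: nat
      have "j < 2 ^ j" by simp
      also have "\<dots> \<le> 2 ^ l j"
      proof (rule power_increasing)
        have "j < 2 ^ j" by simp
        moreover have "l j = 4 * 2 ^ j - 1" by (simp add: l_def)
        ultimately show "j \<le> l j" by linarith
      qed simp
      finally show "j \<le> 2 ^ l j" by simp
    qed
  qed
qed

section \<open>Bounds for gamma\<close>

lemma cos_ge_poly:
  fixes y :: real
  shows "cos y \<ge> 1 - y ^ 2 / 2 + y ^ 4 / 24 - y ^ 6 / 720 - y ^ 8 / 40320"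
proof -
  obtain t where t: "cos y = (\<Sum>m<8. cos_coeff m * y ^ m) + cos (t + 1 / 2 * real 8 * pi) / fact 8 * y ^ 8"
    using Maclaurin_cos_expansion[of y 8] by blast
  have "(\<Sum>m<8. cos_coeff m * y ^ m) = 1 - y ^ 2 / 2 + y ^ 4 / 24 - y ^ 6 / 720"
  proof -
    have "{..<8} = {0, 1, 2, 3, 4, 5, 6, 7 :: nat}" by auto
    then show ?thesis by (simp add: cos_coeff_def fact_numeral)
  qed
  moreover have "- 1 * (y ^ 8 / 40320) \<le> cos (t + 1 / 2 * real 8 * pi) * (y ^ 8 / 40320)"
    by (intro mult_right_mono) auto
  moreover have "cos (t + 1 / 2 * real 8 * pi) / fact 8 * y ^ 8 = cos (t + 1 / 2 * real 8 * pi) * (y ^ 8 / 40320)"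
    by (simp add: fact_numeral)
  ultimately show ?thesis unfolding t by linarith
qed

text \<open>The factor \<open>\<bar>1 - e(2^i h \<gamma>)\<bar>\<close> for the frequency \<open>h = 21\<close>. Numerically the products of length \<open>n\<close> grow like
  \<open>2^(0.677 n)\<close> for \<open>h = 21\<close>, but only like \<open>2^(0.6179 n)\<close> for \<open>h = 1\<close>; this leaves room for crude estimates.\<close>
definition cos_factor :: "real \<Rightarrow> real" where "cos_factor w = 2 * \<bar>cos (21 / 2 * pi * w)\<bar>"

text \<open>Reduces a lower bound to rational arithmetic: modulo pi the angle is within pi rho of 0,
  cosine decreases on [0, pi], 3.1416 exceeds pi, and the Taylor polynomial bounds cosine from
  below.\<close>

lemma cos_factor_ge:
  fixes k :: int
  assumes w: "\<bar>21 / 2 * w - of_int k\<bar> \<le> \<rho>" "\<rho> \<le> 1 / 2"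
    and c: "c \<le> 2 * (1 - (3.1416 * \<rho>) ^ 2 / 2 + (3.1416 * \<rho>) ^ 4 / 24 - (3.1416 * \<rho>) ^ 6 / 720 - (3.1416 * \<rho>) ^ 8 / 40320)"
  shows "c \<le> cos_factor w"
proof -
  define t where "t = 21 / 2 * w - of_int k"
  have r0: "0 \<le> \<rho>" using w(1) by linarith
  have "cos (3.1416 * \<rho>) \<le> cos (pi * \<bar>t\<bar>)"
  proof (rule cos_monotone_0_pi_le)
    have "pi * \<bar>t\<bar> \<le> 3.1416 * \<rho>"
      using w(1) pi_approx(2) r0 by (intro mult_mono) (auto simp: t_def)
    then show "pi * \<bar>t\<bar> \<le> 3.1416 * \<rho>" .
    have "3.1416 * \<rho> \<le> 3.1416 * (1 / 2)" using w(2) by (intro mult_left_mono) auto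
    then show "3.1416 * \<rho> \<le> pi" using pi_approx(1) by simp
  qed simp
  moreover have "cos (pi * \<bar>t\<bar>) = cos (pi * t)" by (cases "t \<ge> 0") (simp_all add: abs_if)
  moreover have "\<bar>cos (21 / 2 * pi * w)\<bar> = \<bar>cos (pi * t)\<bar>"
  proof -
    have eq: "21 / 2 * pi * w = pi * t + of_int k * pi" by (simp add: t_def algebra_simps)
    have s0: "sin (of_int k * pi) = 0" unfolding sin_zero_iff_int2 by blast
    then have "\<bar>cos (of_int k * pi)\<bar> = 1" by (rule sin_zero_abs_cos_one)
    then show ?thesis unfolding eq cos_add s0 by (simp add: abs_mult)
  qed
  ultimately have "2 * cos (3.1416 * \<rho>) \<le> cos_factor w" unfolding cos_factor_def by linarith
  moreover have "c \<le> 2 * cos (3.1416 * \<rho>)"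
    using cos_ge_poly[of "3.1416 * \<rho>"] by (intro order_trans[OF c] mult_left_mono) auto
  ultimately show ?thesis by linarith
qed

lemma cos_factor_nonneg: "0 \<le> cos_factor w" by (simp add: cos_factor_def)

lemma cos_factor_uminus: "cos_factor (- w) = cos_factor w" by (simp add: cos_factor_def)

text \<open>The tail is taken of signs rather than of binary digits: modulo 1, 2^i gamma is 1/2 +
  tail/2, and since \<open>cos_factor\<close> is even, negating all the signs changes no factor. A
  block of 8 digits then matters only through the relative sign of its successor.\<close>

definition tm_tail :: "nat \<Rightarrow> real" where "tm_tail i = (\<Sum>n. tm_sign (i + n) / 2 ^ (n + 1))"

lemma tm_tail_sums: "(\<lambda>n. tm_sign (i + n) / 2 ^ (n + 1)) sums tm_tail i"
  and abs_tm_tail_le: "\<bar>tm_tail i\<bar> \<le> 1"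
proof -
  have g: "(\<lambda>n. (1 / 2 :: real) ^ n * (1 / 2)) sums (1 / (1 - 1 / 2) * (1 / 2))"
    by (intro sums_mult2 geometric_sums) simp
  have le: "norm (tm_sign (i + n) / 2 ^ (n + 1)) \<le> (1 / 2) ^ n * (1 / 2)" for n
    by (simp add: abs_divide power_divide)
  have "summable (\<lambda>n. tm_sign (i + n) / 2 ^ (n + 1))"
    by (rule summable_comparison_test'[OF sums_summable[OF g] le])
  then show "(\<lambda>n. tm_sign (i + n) / 2 ^ (n + 1)) sums tm_tail i"
    unfolding tm_tail_def by (rule summable_sums)
  have "norm (tm_tail i) \<le> (\<Sum>n. (1 / 2) ^ n * (1 / 2 :: real))"
    unfolding tm_tail_def by (rule norm_suminf_le[OF le sums_summable[OF g]])
  then show "\<bar>tm_tail i\<bar> \<le> 1" using sums_unique[OF g] by simp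
qed

lemma tm_tail_rec: "tm_tail i = (tm_sign i + tm_tail (Suc i)) / 2"
proof -
  have "(\<lambda>n. tm_sign (i + Suc n) / 2 ^ (Suc n + 1)) sums (tm_tail (Suc i) / 2)"
    using sums_divide[OF tm_tail_sums[of "Suc i"], of 2] by (simp add: mult.commute)
  then have "(\<lambda>n. tm_sign (i + n) / 2 ^ (n + 1)) sums (tm_tail (Suc i) / 2 + tm_sign (i + 0) / 2 ^ (0 + 1))"
    by (rule sums_Suc)
  then have "tm_tail i = tm_tail (Suc i) / 2 + tm_sign (i + 0) / 2 ^ (0 + 1)"
    using tm_tail_sums sums_unique2 by blast
  then show ?thesis by simp
qed

lemma gamma_tm_tail: "gamma = 1 / 2 + tm_tail 0 / 2"
proof -
  have "(\<lambda>n. (1 / 2 :: real) ^ n * (1 / 2)) sums (1 / (1 - 1 / 2) * (1 / 2))"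
    by (intro sums_mult2 geometric_sums) simp
  from sums_add[OF this tm_tail_sums[of 0]]
  have "(\<lambda>n. ((1 / 2) ^ n * (1 / 2) + tm_sign (0 + n) / 2 ^ (n + 1)) / 2) sums ((1 + tm_tail 0) / 2)"
    by (intro sums_divide) simp
  moreover have "((1 / 2) ^ n * (1 / 2) + tm_sign (0 + n) / 2 ^ (n + 1)) / 2 = (1 - real (thue_morse n)) / 2 ^ (n + 1)" for n
    by (simp add: tm_sign_eq power_divide field_simps)
  ultimately have "(\<lambda>n. (1 - real (thue_morse n)) / 2 ^ (n + 1)) sums ((1 + tm_tail 0) / 2)"
    by (simp only:)
  then have "gamma = (1 + tm_tail 0) / 2" unfolding gamma_def by (rule sums_unique[symmetric])
  then show ?thesis by simp
qed

lemma gamma_dyadic: "\<exists>z::int. 2 ^ i * gamma = of_int z + (1 / 2 + tm_tail i / 2)"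
proof (induction i)
  case 0
  show ?case by (rule exI[of _ 0]) (simp add: gamma_tm_tail)
next
  case (Suc i)
  then obtain z :: int where z: "2 ^ i * gamma = of_int z + (1 / 2 + tm_tail i / 2)" by blast
  have "2 ^ Suc i * gamma = 2 * (2 ^ i * gamma)" by simp
  also have "\<dots> = of_int (2 * z) + 1 + tm_tail i" unfolding z by simp
  also have "\<dots> = of_int (2 * z + (if tm_sign i = 1 then 1 else 0)) + (1 / 2 + tm_tail (Suc i) / 2)"
    using tm_sign_cases[of i] by (auto simp: tm_tail_rec[of i] field_simps)
  finally show ?case by blast
qed

text \<open>The frequency 21 is odd, so the centre 1/2 is mapped to 1/2 modulo 1, and the sine
  becomes a cosine centred at 0.\<close>

lemma norm_one_minus_ee_gamma: "norm (1 - ee (2 ^ i * (real 21 * gamma))) = cos_factor (tm_tail i)"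
proof -
  obtain z :: int where z: "2 ^ i * gamma = of_int z + (1 / 2 + tm_tail i / 2)" using gamma_dyadic by blast
  have "2 ^ i * (real 21 * gamma) = 21 * (2 ^ i * gamma)" by simp
  also have "\<dots> = (1 / 2 + 21 / 2 * tm_tail i) + of_int (21 * z + 10)" unfolding z by simp
  finally have "ee (2 ^ i * (real 21 * gamma)) = ee (1 / 2 + 21 / 2 * tm_tail i)" by (simp only: ee_add_int)
  moreover have "sin (pi * (1 / 2 + 21 / 2 * tm_tail i)) = cos (21 / 2 * pi * tm_tail i)"
  proof -
    have "pi * (1 / 2 + 21 / 2 * tm_tail i) = pi / 2 + 21 / 2 * pi * tm_tail i" by (simp add: algebra_simps)
    then show ?thesis by (simp only: sin_add sin_pi_half cos_pi_half mult_1 mult_zero_left add_0_right)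
  qed
  ultimately show ?thesis by (simp only: norm_one_minus_ee cos_factor_def)
qed

text \<open>The value \<open>45 / 256\<close> is the sum of \<open>(-1)^t\<^sub>n / 2^(n+1)\<close> over \<open>n < 8\<close>.\<close>
lemma cos_factor_block_opposite:
  assumes "w0 = (1 + w1) / 2" "w1 = (- 1 + w2) / 2" "w2 = (- 1 + w3) / 2" "w3 = (1 + w4) / 2"
    "w4 = (- 1 + w5) / 2" "w5 = (1 + w6) / 2" "w6 = (1 + w7) / 2" "w7 = (- 1 + w8) / 2"
    "\<bar>w8 + 45 / 256\<bar> \<le> 1 / 256"
  shows "cos_factor w0 * cos_factor w1 * cos_factor w2 * cos_factor w3 * cos_factor w4 * cos_factor w5 * cos_factor w6 * cos_factor w7 \<ge> 42"
proof -
  \<comment> \<open>The enclosure of \<open>w8\<close> is pulled back through the recursion, its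
    width halving at each step. In each case k is the integer nearest to 21/2 w, and rho is a
    rounded-up bound for the distance over the enclosure.\<close>
  have b8: "-23/128 \<le> w8" "w8 \<le> -11/64" using assms(9) unfolding abs_le_iff by linarith+
  have b7: "-151/256 \<le> w7" "w7 \<le> -75/128" using b8 assms(8) by simp_all
  have c7: "163 / 100 \<le> cos_factor w7"
    by (rule cos_factor_ge[where k = "-6" and \<rho> = "97 / 500"]) (use b7 in \<open>simp_all add: abs_le_iff power_divide\<close>)
  have b6: "105/512 \<le> w6" "w6 \<le> 53/256" using b7 assms(7) by simp_all
  have c6: "17 / 10 \<le> cos_factor w6"
    by (rule cos_factor_ge[where k = "2" and \<rho> = "87 / 500"]) (use b6 in \<open>simp_all add: abs_le_iff power_divide\<close>)
  have b5: "617/1024 \<le> w5" "w5 \<le> 309/512" using b6 assms(6) by simp_all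
  have c5: "97 / 100 \<le> cos_factor w5"
    by (rule cos_factor_ge[where k = "6" and \<rho> = "337 / 1000"]) (use b5 in \<open>simp_all add: abs_le_iff power_divide\<close>)
  have b4: "-407/2048 \<le> w4" "w4 \<le> -203/1024" using b5 assms(5) by simp_all
  have c4: "48 / 25 \<le> cos_factor w4"
    by (rule cos_factor_ge[where k = "-2" and \<rho> = "87 / 1000"]) (use b4 in \<open>simp_all add: abs_le_iff power_divide\<close>)
  have b3: "1641/4096 \<le> w3" "w3 \<le> 821/2048" using b4 assms(4) by simp_all
  have c3: "79 / 50 \<le> cos_factor w3"
    by (rule cos_factor_ge[where k = "4" and \<rho> = "21 / 100"]) (use b3 in \<open>simp_all add: abs_le_iff power_divide\<close>)
  have b2: "-2455/8192 \<le> w2" "w2 \<le> -1227/4096" using b3 assms(3) by simp_all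
  have c2: "179 / 100 \<le> cos_factor w2"
    by (rule cos_factor_ge[where k = "-3" and \<rho> = "147 / 1000"]) (use b2 in \<open>simp_all add: abs_le_iff power_divide\<close>)
  have b1: "-10647/16384 \<le> w1" "w1 \<le> -5323/8192" using b2 assms(2) by simp_all
  have c1: "169 / 100 \<le> cos_factor w1"
    by (rule cos_factor_ge[where k = "-7" and \<rho> = "89 / 500"]) (use b1 in \<open>simp_all add: abs_le_iff power_divide\<close>)
  have b0: "5737/32768 \<le> w0" "w0 \<le> 2869/16384" using b1 assms(1) by simp_all
  have c0: "87 / 50 \<le> cos_factor w0"
    by (rule cos_factor_ge[where k = "2" and \<rho> = "81 / 500"]) (use b0 in \<open>simp_all add: abs_le_iff power_divide\<close>)
  have "(42::real) \<le> (87 / 50) * (169 / 100) * (179 / 100) * (79 / 50) * (48 / 25) * (97 / 100) * (17 / 10) * (163 / 100)" by simp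
  also have "\<dots> \<le> cos_factor w0 * cos_factor w1 * cos_factor w2 * cos_factor w3 * cos_factor w4 * cos_factor w5 * cos_factor w6 * cos_factor w7"
    by (intro mult_mono mult_nonneg_nonneg cos_factor_nonneg c0 c1 c2 c3 c4 c5 c6 c7) simp_all
  finally show ?thesis .
qed

text \<open>The case of a successor block with the same sign, by the same backward enclosures. Being
  the smaller of the two bounds, 26 also serves for every odd-numbered block, whose successor's
  relative sign varies.\<close>

lemma cos_factor_block_equal:
  assumes "w0 = (1 + w1) / 2" "w1 = (- 1 + w2) / 2" "w2 = (- 1 + w3) / 2" "w3 = (1 + w4) / 2"
    "w4 = (- 1 + w5) / 2" "w5 = (1 + w6) / 2" "w6 = (1 + w7) / 2" "w7 = (- 1 + w8) / 2"
    "\<bar>w8 - 45 / 256\<bar> \<le> 1 / 256"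
  shows "cos_factor w0 * cos_factor w1 * cos_factor w2 * cos_factor w3 * cos_factor w4 * cos_factor w5 * cos_factor w6 * cos_factor w7 \<ge> 26"
proof -
  have b8: "11/64 \<le> w8" "w8 \<le> 23/128" using assms(9) unfolding abs_le_iff by linarith+
  have b7: "-53/128 \<le> w7" "w7 \<le> -105/256" using b8 assms(8) by simp_all
  have c7: "91 / 100 \<le> cos_factor w7"
    by (rule cos_factor_ge[where k = "-4" and \<rho> = "87 / 250"]) (use b7 in \<open>simp_all add: abs_le_iff power_divide\<close>)
  have b6: "75/256 \<le> w6" "w6 \<le> 151/512" using b7 assms(7) by simp_all
  have c6: "19 / 10 \<le> cos_factor w6"
    by (rule cos_factor_ge[where k = "3" and \<rho> = "97 / 1000"]) (use b6 in \<open>simp_all add: abs_le_iff power_divide\<close>)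
  have b5: "331/512 \<le> w5" "w5 \<le> 663/1024" using b6 assms(6) by simp_all
  have c5: "157 / 100 \<le> cos_factor w5"
    by (rule cos_factor_ge[where k = "7" and \<rho> = "53 / 250"]) (use b5 in \<open>simp_all add: abs_le_iff power_divide\<close>)
  have b4: "-181/1024 \<le> w4" "w4 \<le> -361/2048" using b5 assms(5) by simp_all
  have c4: "89 / 50 \<le> cos_factor w4"
    by (rule cos_factor_ge[where k = "-2" and \<rho> = "3 / 20"]) (use b4 in \<open>simp_all add: abs_le_iff power_divide\<close>)
  have b3: "843/2048 \<le> w3" "w3 \<le> 1687/4096" using b4 assms(4) by simp_all
  have c3: "26 / 25 \<le> cos_factor w3"
    by (rule cos_factor_ge[where k = "4" and \<rho> = "13 / 40"]) (use b3 in \<open>simp_all add: abs_le_iff power_divide\<close>)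
  have b2: "-1205/4096 \<le> w2" "w2 \<le> -2409/8192" using b3 assms(3) by simp_all
  have c2: "48 / 25 \<le> cos_factor w2"
    by (rule cos_factor_ge[where k = "-3" and \<rho> = "89 / 1000"]) (use b2 in \<open>simp_all add: abs_le_iff power_divide\<close>)
  have b1: "-5301/8192 \<le> w1" "w1 \<le> -10601/16384" using b2 assms(2) by simp_all
  have c1: "159 / 100 \<le> cos_factor w1"
    by (rule cos_factor_ge[where k = "-7" and \<rho> = "207 / 1000"]) (use b1 in \<open>simp_all add: abs_le_iff power_divide\<close>)
  have b0: "2891/16384 \<le> w0" "w0 \<le> 5783/32768" using b1 assms(1) by simp_all
  have c0: "89 / 50 \<le> cos_factor w0"
    by (rule cos_factor_ge[where k = "2" and \<rho> = "37 / 250"]) (use b0 in \<open>simp_all add: abs_le_iff power_divide\<close>)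
  have "(26::real) \<le> (89 / 50) * (159 / 100) * (48 / 25) * (26 / 25) * (89 / 50) * (157 / 100) * (19 / 10) * (91 / 100)" by simp
  also have "\<dots> \<le> cos_factor w0 * cos_factor w1 * cos_factor w2 * cos_factor w3 * cos_factor w4 * cos_factor w5 * cos_factor w6 * cos_factor w7"
    by (intro mult_mono mult_nonneg_nonneg cos_factor_nonneg c0 c1 c2 c3 c4 c5 c6 c7) simp_all
  finally show ?thesis .
qed

lemma tm_sign_values:
  "tm_sign 1 = -1" "tm_sign 2 = -1" "tm_sign 3 = 1" "tm_sign 4 = -1" "tm_sign 5 = 1" "tm_sign 6 = 1" "tm_sign 7 = -1"
  using tm_sign_Suc_double[of 0] tm_sign_double[of 1] tm_sign_Suc_double[of 1] tm_sign_double[of 2]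
    tm_sign_Suc_double[of 2] tm_sign_double[of 3] tm_sign_Suc_double[of 3]
  by (simp_all add: eval_nat_numeral)

text \<open>Multiplying by the sign of the block turns its eight signs into the fixed pattern + - -
  + - + + -, so one numerical computation covers all blocks.\<close>

lemma tm_tail_block:
  assumes v: "v = (\<lambda>r. tm_sign b * tm_tail (8 * b + r))"
  shows "v 0 = (1 + v 1) / 2" "v 1 = (- 1 + v 2) / 2" "v 2 = (- 1 + v 3) / 2" "v 3 = (1 + v 4) / 2"
    "v 4 = (- 1 + v 5) / 2" "v 5 = (1 + v 6) / 2" "v 6 = (1 + v 7) / 2" "v 7 = (- 1 + v 8) / 2"
proof -
  have *: "v r = (tm_sign r + v r') / 2" if "r < 8" "r' = Suc r" for r r'
  proof -
    have "tm_sign (8 * b + r) = tm_sign b * tm_sign r" using tm_sign_split[of r 3 b] that by simp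
    then have "tm_tail (8 * b + r) = (tm_sign b * tm_sign r + tm_tail (8 * b + Suc r)) / 2"
      using tm_tail_rec[of "8 * b + r"] by simp
    then show ?thesis using tm_sign_cases[of b] that by (auto simp: v)
  qed
  have "v 0 = (tm_sign 0 + v 1) / 2" "v 1 = (tm_sign 1 + v 2) / 2" "v 2 = (tm_sign 2 + v 3) / 2"
    "v 3 = (tm_sign 3 + v 4) / 2" "v 4 = (tm_sign 4 + v 5) / 2" "v 5 = (tm_sign 5 + v 6) / 2"
    "v 6 = (tm_sign 6 + v 7) / 2" "v 7 = (tm_sign 7 + v 8) / 2"
    by (rule *; simp)+
  then show "v 0 = (1 + v 1) / 2" "v 1 = (- 1 + v 2) / 2" "v 2 = (- 1 + v 3) / 2" "v 3 = (1 + v 4) / 2"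
    "v 4 = (- 1 + v 5) / 2" "v 5 = (1 + v 6) / 2" "v 6 = (1 + v 7) / 2" "v 7 = (- 1 + v 8) / 2"
    unfolding tm_sign_values tm_sign_0 .
qed

lemma tm_tail_block_start: "\<bar>tm_sign b * tm_tail (8 * b) - 45 / 256\<bar> \<le> 1 / 256"
proof -
  define v where "v = (\<lambda>r. tm_sign b * tm_tail (8 * b + r))"
  have "\<bar>v 8\<bar> \<le> 1" using abs_tm_tail_le[of "8 * b + 8"] by (simp add: v_def abs_mult)
  have "v 0 - 45 / 256 = v 8 / 256"
    by (simp add: tm_tail_block[OF v_def, unfolded One_nat_def] field_simps)
  then have "\<bar>v 0 - 45 / 256\<bar> = \<bar>v 8\<bar> / 256" by (simp only: abs_divide abs_numeral)
  also have "\<dots> \<le> 1 / 256" using \<open>\<bar>v 8\<bar> \<le> 1\<close> by simp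
  finally have "\<bar>v 0 - 45 / 256\<bar> \<le> 1 / 256" .
  then show ?thesis by (simp add: v_def)
qed

lemma cos_factor_sign: "cos_factor (tm_sign b * w) = cos_factor w"
  using tm_sign_cases[of b] cos_factor_uminus by auto

lemma cos_factor_block_product:
  "(\<Prod>r<8. cos_factor (tm_tail (8 * b + r))) \<ge> (if tm_sign (Suc b) = tm_sign b then 26 else 42)"
proof -
  define v where "v = (\<lambda>r. tm_sign b * tm_tail (8 * b + r))"
  note rec = tm_tail_block[OF v_def]
  have "cos_factor (tm_tail (8 * b + r)) = cos_factor (v r)" for r by (simp add: v_def cos_factor_sign)
  then have P: "(\<Prod>r<8. cos_factor (tm_tail (8 * b + r))) = cos_factor (v 0) * cos_factor (v 1) * cos_factor (v 2) * cos_factor (v 3) * cos_factor (v 4) * cos_factor (v 5) * cos_factor (v 6) * cos_factor (v 7)"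
    by (simp add: eval_nat_numeral)
  have st: "\<bar>tm_sign (Suc b) * tm_tail (8 * b + 8) - 45 / 256\<bar> \<le> 1 / 256"
    using tm_tail_block_start[of "Suc b"] by (simp add: add.commute)
  show ?thesis
  proof (cases "tm_sign (Suc b) = tm_sign b")
    case True
    have "\<bar>v 8 - 45 / 256\<bar> \<le> 1 / 256" using st True by (simp add: v_def)
    from cos_factor_block_equal[OF rec this] show ?thesis using True P by simp
  next
    case False
    then have "tm_sign (Suc b) = - tm_sign b" using tm_sign_cases[of b] tm_sign_cases[of "Suc b"] by auto
    then have "\<bar>- v 8 - 45 / 256\<bar> \<le> 1 / 256" using st unfolding v_def by simp
    then have "\<bar>v 8 + 45 / 256\<bar> \<le> 1 / 256" by (simp only: abs_le_iff) linarith
    from cos_factor_block_opposite[OF rec this] show ?thesis using False P by simp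
  qed
qed

lemma prod_blocks: "(\<Prod>i<8 * n. f i) = (\<Prod>b<n. \<Prod>r<8. f (8 * b + r))" for f :: "nat \<Rightarrow> real"
proof (induction n)
  case (Suc n)
  have e: "{..<8 * Suc n} = {..<8 * n} \<union> {8 * n..<8 * n + 8}" by auto
  have "(\<Prod>i<8 * Suc n. f i) = (\<Prod>i<8 * n. f i) * (\<Prod>i\<in>{8 * n..<8 * n + 8}. f i)"
    unfolding e by (rule prod.union_disjoint) auto
  also have "(\<Prod>i\<in>{8 * n..<8 * n + 8}. f i) = (\<Prod>r<8. f (8 * n + r))"
    by (rule prod.reindex_bij_witness[where i = "\<lambda>r. 8 * n + r" and j = "\<lambda>i. i - 8 * n"]) auto
  finally show ?case using Suc by simp
qed simp

text \<open>Blocks \<open>2 m\<close> and \<open>2 m + 1\<close> have opposite signs, and \<open>42 * 26 \<ge> 2^10\<close>: the rate per digit is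
  \<open>10 / 16 > 0.6178775\<close>.\<close>
lemma gamma_product: "(\<Prod>i<16 * m. cos_factor (tm_tail i)) \<ge> 1024 ^ m"
proof -
  define P where "P = (\<lambda>b. \<Prod>r<8. cos_factor (tm_tail (8 * b + r)))"
  have "1024 ^ m \<le> (\<Prod>b<2 * m. P b)"
  proof (induction m)
    case (Suc m)
    have e: "P (2 * m) \<ge> 42"
      using cos_factor_block_product[of "2 * m"] tm_sign_cases[of m] by (auto simp: P_def)
    have o: "P (Suc (2 * m)) \<ge> 26"
      using cos_factor_block_product[of "Suc (2 * m)"] by (auto simp: P_def split: if_splits)
    have "(1024 :: real) \<le> 42 * 26" by simp
    also have "\<dots> \<le> P (2 * m) * P (Suc (2 * m))" using e o by (intro mult_mono) auto
    finally have "1024 ^ m * 1024 \<le> (\<Prod>b<2 * m. P b) * (P (2 * m) * P (Suc (2 * m)))"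
      using Suc by (intro mult_mono) (auto intro!: prod_nonneg simp: P_def cos_factor_def)
    then show ?case by (simp add: mult_ac)
  qed simp
  moreover have "(\<Prod>i<16 * m. cos_factor (tm_tail i)) = (\<Prod>b<2 * m. P b)"
    using prod_blocks[of "\<lambda>i. cos_factor (tm_tail i)" "2 * m"] by (simp add: P_def)
  ultimately show ?thesis by simp
qed

lemma thue_morse_gamma_lower:
  "infinitely_often_Omega
     (\<lambda>N. real N * star_discrepancy (\<lambda>k. frac (real (thue_morse_integer k) * gamma)) N)
     (\<lambda>N. real N powr 0.6178775)"
proof -
  define A where "A = 2 / norm (1 - ee (real 21 * gamma))"
  let ?D = "\<lambda>N. star_discrepancy (\<lambda>k. frac (real (thue_morse_integer k) * gamma)) N"
  \<comment> \<open>Then \<open>Suc (l m)\<close> is 16 (m + 1), a whole number of double blocks,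
    and 0.6178775 * (16 m + 15) <= 10 (m + 1).\<close>
  define l where "l = (\<lambda>m. 16 * m + 15 :: nat)"
  have irr: "ee (real 21 * gamma) \<noteq> 1"
  proof
    assume "ee (real 21 * gamma) = 1"
    then have "cos_factor (tm_tail 0) = 0" using norm_one_minus_ee_gamma[of 0] by simp
    then have "(\<Prod>i<16 * 1. cos_factor (tm_tail i)) = 0" by (intro prod_zero) (auto intro!: bexI[of _ 0])
    then have "1024 ^ 1 \<le> (0 :: real)" using gamma_product[of 1] by (simp only:)
    then show False by simp
  qed
  have lower: "real (2 ^ l m) * ?D (2 ^ l m) \<ge> (1024 ^ Suc m - A) / (84 * pi)" for m
  proof -
    have "((\<Prod>i<Suc (l m). norm (1 - ee (2 ^ i * (real 21 * gamma)))) - 2 / norm (1 - ee (real 21 * gamma))) / (4 * pi * real 21)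
        \<le> 2 ^ l m * ?D (2 ^ l m)"
      by (rule thue_morse_star_discrepancy_ge) (use irr in auto)
    moreover have "Suc (l m) = 16 * Suc m" by (simp add: l_def)
    ultimately have "((\<Prod>i<16 * Suc m. cos_factor (tm_tail i)) - A) / (84 * pi) \<le> real (2 ^ l m) * ?D (2 ^ l m)"
      unfolding A_def by (simp only: norm_one_minus_ee_gamma) (simp add: mult.commute)
    moreover have "(1024 ^ Suc m - A) / (84 * pi) \<le> ((\<Prod>i<16 * Suc m. cos_factor (tm_tail i)) - A) / (84 * pi)"
      using gamma_product[of "Suc m"] by (intro divide_right_mono diff_right_mono) auto
    ultimately show ?thesis by linarith
  qed
  have N: "real (2 ^ l m) powr 0.6178775 \<le> 1024 ^ Suc m" for m
  proof -
    have "real (2 ^ l m) powr 0.6178775 = 2 powr (real (l m) * 0.6178775)"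
      by (simp add: powr_powr flip: powr_realpow)
    also have "\<dots> \<le> 2 powr (real (10 * Suc m))" by (intro powr_mono) (auto simp: l_def)
    also have "\<dots> = (2 ^ 10) ^ Suc m" by (simp only: powr_realpow power_mult zero_less_numeral)
    finally show ?thesis by simp
  qed
  have "filterlim (\<lambda>m::nat. 1024 ^ Suc m / 2 :: real) at_top sequentially" by real_asymp
  then have ev: "eventually (\<lambda>m::nat. A \<le> 1024 ^ Suc m / 2) sequentially"
    by (simp add: filterlim_at_top)
  show ?thesis
  proof (rule infinitely_often_OmegaI[where c = "1 / 2 / (84 * pi)" and g = "\<lambda>m. 2 ^ l m"])
    show "\<forall>\<^sub>F m in sequentially. 1 / 2 / (84 * pi) * real (2 ^ l m) powr 0.6178775 \<le> real (2 ^ l m) * ?D (2 ^ l m)"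
      using ev
    proof eventually_elim
      case (elim m)
      have "1 / 2 * real (2 ^ l m) powr 0.6178775 \<le> 1024 ^ Suc m - A" using N[of m] elim by linarith
      then have "(1 / 2 * real (2 ^ l m) powr 0.6178775) / (84 * pi) \<le> (1024 ^ Suc m - A) / (84 * pi)"
        by (intro divide_right_mono) auto
      also note lower[of m]
      finally show ?case by simp
    qed
    show "filterlim (\<lambda>m. 2 ^ l m :: nat) at_top sequentially"
    proof (rule filterlim_at_top_mono[OF filterlim_ident], rule always_eventually, rule allI)
      fix m :: nat
      have "m < 2 ^ m" by simp
      also have "\<dots> \<le> 2 ^ l m" by (rule power_increasing) (auto simp: l_def)
      finally show "m \<le> 2 ^ l m" by simp
    qed
  qed simp
qed

lemma kronecker_gamma:
  assumes e: "\<epsilon> > 0"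
  shows "(\<lambda>N. real N * star_discrepancy (\<lambda>n. frac (real n * gamma)) N) \<in> O(\<lambda>N. real N powr \<epsilon>)"
proof -
  \<comment> \<open>This makes 7/D strictly smaller than epsilon; the gap absorbs the
    logarithm.\<close>
  obtain D :: nat where D: "14 / \<epsilon> < real D" using reals_Archimedean2 by blast
  have "0 < 14 / \<epsilon>" using e by simp
  then have D1: "D \<ge> 1" using D by (cases D) auto
  define \<delta> where "\<delta> = 7 / real D"
  have \<delta>: "0 \<le> \<delta>" "\<delta> < \<epsilon>" using D D1 e by (auto simp: \<delta>_def field_simps)
  obtain c where c: "c > 0" "\<And>(q::nat) (p::int). q \<ge> 1 \<Longrightarrow> \<bar>real q * gamma - of_int p\<bar> \<ge> c / real q powr (1 + \<delta>)"
    using gamma_exponent[OF D1] unfolding \<delta>_def by blast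
  have "(\<lambda>N. real N * star_discrepancy (\<lambda>n. frac (real n * gamma)) N)
      \<in> O(\<lambda>N. real N powr \<delta> * (1 + log 2 (real N)))"
    by (rule kronecker_bigo[OF c(1) \<delta>(1) c(2)])
  also have "(\<lambda>N. real N powr \<delta> * (1 + log 2 (real N))) \<in> O(\<lambda>N. real N powr \<epsilon>)"
    using \<delta>(2) by real_asymp
  finally show ?thesis .
qed

theorem theorem4:
  "((\<lambda>N. real N * star_discrepancy (\<lambda>n. frac (real n * alpha)) N) \<in> O(\<lambda>N. ln (real N))
    \<and> (\<forall>\<epsilon>>0.
         (\<lambda>N. real N * star_discrepancy (\<lambda>k. frac (real (thue_morse_integer k) * alpha)) N)
           \<in> O(\<lambda>N. real N powr (ln 3 / ln 4 + \<epsilon>))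
         \<and> infinitely_often_Omega
           (\<lambda>N. real N * star_discrepancy (\<lambda>k. frac (real (thue_morse_integer k) * alpha)) N)
           (\<lambda>N. real N powr (ln 3 / ln 4 - \<epsilon>))))
   \<and>
   ((\<forall>\<epsilon>>0. (\<lambda>N. real N * star_discrepancy (\<lambda>n. frac (real n * gamma)) N)
             \<in> O(\<lambda>N. real N powr \<epsilon>))
    \<and> infinitely_often_Omega
        (\<lambda>N. real N * star_discrepancy (\<lambda>k. frac (real (thue_morse_integer k) * gamma)) N)
        (\<lambda>N. real N powr 0.6178775))"
  using kronecker_alpha thue_morse_alpha_upper thue_morse_alpha_lower kronecker_gamma thue_morse_gamma_lower
  by blast

end
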